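(* Let $n\ge 1$ be an integer, let $\alpha_1,\dots,\alpha_{n+1},\beta_1,\dots,\beta_n\in\mathbb{C}$ and $\beta_{n+1}=1$. Assume that for all $1\le i,j\le n+1$ $$\mathrm{Re}(\alpha_i-\beta_j+1)>0\ (j\ne i),\qquad \mathrm{Re}(\beta_j-\alpha_j)>0,\qquad \alpha_i-\beta_j\notin\mathbb{Z},\qquad \beta_i-\beta_j\notin\mathbb{Z}\ (j\neq i).$$ Then for $0<z<1$ we have, for $1\le i\le n$, $$F_{\tilde D_i^{(1)}}(z)=\sum_{j=1}^{n+1}\frac{s(\beta_i-\alpha_i)\,s(\alpha_{n+1})}{s(\beta_j-\alpha_i)\,s(\beta_j-\alpha_{n+1})}\prod_{1\le k\le n+1,\ k\ne j}\frac{s(\alpha_k-\beta_j)}{s(\beta_k-\beta_j)}\;F_{\tilde D_j^{(0)}}(z),$$ and $$F_{\tilde D_{n+1}^{(1)}}(z)=\sum_{j=1}^{n+1}\ \prod_{1\le k\le n+1,\ k\ne j}\frac{s(\alpha_k-\beta_j)}{s(\beta_k-\beta_j)}\;F_{\tilde D_j^{(0)}}(z).$$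
   Context: Notation: $s(A)=\sin(\pi A)$ for $A\in\mathbb{C}$. Put $\lambda_i=\alpha_{i+1}-\beta_i$ ($1\le i\le n$), $\mu_i=\beta_i-\alpha_i-1$ ($1\le i\le n+1$), with the convention $\beta_{n+1}=1$. For real $z\in(0,1)$ and $t=(t_1,\dots,t_n)\in\mathbb{R}^n$ put $t_0=1$, $t_{n+1}=z$. For a domain $D\subset\mathbb{R}^n$ on which all $t_i$ $(1\le i\le n)$ and all $t_{i-1}-t_i$ $(1\le i\le n+1)$ are nonzero of constant sign, let $$u_D(t)=\prod_{i=1}^n(\epsilon_it_i)^{\lambda_i}\prod_{i=1}^{n+1}\bigl(\eta_i(t_{i-1}-t_i)\bigr)^{\mu_i},$$ where the signs $\epsilon_i,\eta_i\in\{1,-1\}$ are chosen so that $\epsilon_it_i>0$ and $\eta_i(t_{i-1}-t_i)>0$ on $D$, and the powers of positive reals are taken with argument $0$ (i.e. $x^\lambda=e^{\lambda\log x}$ with real $\log x$). Let $F_D(z)=\int_D u_D(t)\,dt_1\cdots dt_n$, with $D$ carrying the standard orientation of $\mathbb{R}^n$. The domains are (for $0<z<1$; empty chains of inequalities impose no condition): $\tilde D_i^{(0)}=\{t\in\mathbb{R}^n: 0<t_i<\cdots<t_n<z,\ 1<t_1<\cdots<t_{i-1}\}$ for $1\le i\le n+1$; $\tilde D_i^{(1)}=\{t\in\mathbb{R}^n: t_i<\cdots<t_n<0,\ 0<t_{i-1}<\cdots<t_1<1\}$ for $1\le i\le n$; $\tilde D_{n+1}^{(1)}=\{t\in\mathbb{R}^n: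 z<t_n<\cdots<t_1<1\}$. *)

theory Defs
  imports "HOL-Analysis.Analysis"
begin

text \<open>
  A point of \<open>\<real>\<^sup>n\<close> is a function in \<open>{1..n} \<rightarrow>\<^sub>E UNIV\<close>, the space of the product measure
  \<open>\<Pi>\<^sub>M i\<in>{1..n}. lborel\<close>, so that coordinates keep their indices \<open>1, \<dots>, n\<close>. The parameters
  \<open>\<alpha>\<close> and \<open>\<beta>\<close> are functions on \<open>nat\<close> of which only the values at \<open>1, \<dots>, n + 1\<close> are used.
\<close>

definition s :: "complex \<Rightarrow> complex" where
  "s A = sin (complex_of_real pi * A)"

definition lam :: "(nat \<Rightarrow> complex) \<Rightarrow> (nat \<Rightarrow> complex) \<Rightarrow> nat \<Rightarrow> complex" where
  "lam \<alpha> \<beta> i = \<alpha> (i + 1) - \<beta> i"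

definition mu :: "(nat \<Rightarrow> complex) \<Rightarrow> (nat \<Rightarrow> complex) \<Rightarrow> nat \<Rightarrow> complex" where
  "mu \<alpha> \<beta> i = \<beta> i - \<alpha> i - 1"

definition coord :: "nat \<Rightarrow> real \<Rightarrow> (nat \<Rightarrow> real) \<Rightarrow> nat \<Rightarrow> real" where
  "coord n z t i = (if i = 0 then 1 else if i = n + 1 then z else t i)"

text \<open>The sign \<open>\<epsilon>\<close> with \<open>\<epsilon> f > 0\<close> on \<open>D\<close>; meaningful when \<open>D\<close> is nonempty and \<open>f\<close> is nonzero
  of constant sign on \<open>D\<close>.\<close>

definition sign_on :: "(nat \<Rightarrow> real) set \<Rightarrow> ((nat \<Rightarrow> real) \<Rightarrow> real) \<Rightarrow> real" where
  "sign_on D f = (THE e. e \<in> {1, -1} \<and> (\<forall>t\<in>D. e * f t > 0))"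

text \<open>On \<open>D\<close> all bases below are positive reals, where complex \<open>powr\<close> is
  \<open>x powr a = exp (a * ln x)\<close> with the real logarithm.\<close>

definition u ::
  "nat \<Rightarrow> (nat \<Rightarrow> complex) \<Rightarrow> (nat \<Rightarrow> complex) \<Rightarrow> real \<Rightarrow> (nat \<Rightarrow> real) set \<Rightarrow> (nat \<Rightarrow> real) \<Rightarrow> complex"
where
  "u n \<alpha> \<beta> z D t =
     (\<Prod>i = 1..n.
        complex_of_real (sign_on D (\<lambda>x. coord n z x i) * coord n z t i) powr lam \<alpha> \<beta> i) *
     (\<Prod>i = 1..n + 1.
        complex_of_real
          (sign_on D (\<lambda>x. coord n z x (i - 1) - coord n z x i) *
            (coord n z t (i - 1) - coord n z t i)) powr mu \<alpha> \<beta> i)"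

definition F ::
  "nat \<Rightarrow> (nat \<Rightarrow> complex) \<Rightarrow> (nat \<Rightarrow> complex) \<Rightarrow> (nat \<Rightarrow> real) set \<Rightarrow> real \<Rightarrow> complex"
where
  "F n \<alpha> \<beta> D z = (LINT t:D|(\<Pi>\<^sub>M i\<in>{1..n}. lborel). u n \<alpha> \<beta> z D t)"

text \<open>Chains of inequalities are written as \<open>sorted_wrt (<)\<close>. Note that \<open>[i..<n + 1]\<close> lists
  \<open>i, \<dots>, n\<close>. A chain without variables reduces to \<open>0 < z\<close>, \<open>0 < 1\<close> or nothing, so it imposes no
  condition when \<open>0 < z < 1\<close>.\<close>

definition D0 :: "nat \<Rightarrow> real \<Rightarrow> nat \<Rightarrow> (nat \<Rightarrow> real) set" where
  "D0 n z i = {t \<in> {1..n} \<rightarrow>\<^sub>E UNIV.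
     sorted_wrt (<) ([0] @ map t [i..<n + 1] @ [z]) \<and>
     sorted_wrt (<) ([1] @ map t [1..<i])}"

definition D1 :: "nat \<Rightarrow> real \<Rightarrow> nat \<Rightarrow> (nat \<Rightarrow> real) set" where
  "D1 n z i =
     (if i = n + 1
      then {t \<in> {1..n} \<rightarrow>\<^sub>E UNIV. sorted_wrt (<) ([z] @ map t (rev [1..<n + 1]) @ [1])}
      else {t \<in> {1..n} \<rightarrow>\<^sub>E UNIV.
        sorted_wrt (<) (map t [i..<n + 1] @ [0]) \<and>
        sorted_wrt (<) ([0] @ map t (rev [1..<i]) @ [1])})"

end

theory Submission
  imports Defs "HOL-Complex_Analysis.Complex_Analysis"
begin

text \<open>
  Up to powers of the coordinates the integrand depends on ratios only. With \<open>x\<^sub>i = t\<^sub>i / t\<^sub>i\<^sub>-\<^sub>1\<close> for \<open>1 \<le> i \<le> n + 1\<close>, so that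
  the product of all \<open>x\<^sub>i\<close> is \<open>z\<close>, these powers telescope and \<open>u dt\<close> becomes
  \<open>z powr \<beta>\<^sub>n\<^sub>+\<^sub>1\<close> times the product of \<open>\<bar>x\<^sub>i\<bar> powr (- \<beta>\<^sub>i) * \<bar>1 - x\<^sub>i\<bar> powr (\<beta>\<^sub>i - \<alpha>\<^sub>i - 1)\<close> with respect to Haar measure.
  Each of the domains is given by the piece (\<open>0 < x\<^sub>i < 1\<close>, \<open>x\<^sub>i > 1\<close> or \<open>x\<^sub>i < 0\<close>) in which every ratio lies: for the
  \<open>j\<close>-th domain of the first kind \<open>x\<^sub>j\<close> is inner and all other ratios are outer; for the last domain of the second kind all
  ratios are inner; for the \<open>i\<close>-th one \<open>x\<^sub>i\<close> and \<open>x\<^sub>n\<^sub>+\<^sub>1\<close> are negative and the others inner. Hence every integral is, up to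
  the same power of \<open>z\<close>, a multiplicative convolution of \<open>n + 1\<close> restricted kernels, called a word below
  (\<open>F_eq_word\<close>), and the order of the letters is immaterial. In logarithmic coordinates these are convolutions on the line.

  For two letters there are relations. The product of two kernels continues holomorphically from the line to a strip of
  width \<open>\<pi>\<close>, and Cauchy's theorem compares its boundary values (\<open>strip_relation\<close>). Exchanging the two letters gives a second
  relation. Elimination expresses a pair of inner letters, and also a pair of negative letters, through pairs with at
  most one inner letter (\<open>Inner_Inner\<close>, \<open>Negative_Negative\<close>).

  Applied repeatedly, these relations express every word in question through the words of the first kind and the word
  that has outer letters only. To find the coefficients, each word carries a symbol, a product of sines which is formally
  its Mellin transform divided by a common factor. Sine identities show that the symbols satisfy the same relations
  (\<open>reducible_step\<close>). At \<open>\<beta>\<^sub>j\<close> all symbols of words of the first kind vanish except the \<open>j\<close>-th, as does the symbol of the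
  outer word; moreover the outer word itself vanishes for \<open>z < 1\<close>. So the coefficient is a quotient of symbols
  (\<open>reducible_expand\<close>), which is the product of sines in the theorem.

  The real parts of the exponents are such that different kernels have compatible exponential tails. The class of
  functions with an integrable singularity at \<open>0\<close> and exponential tails is closed under convolution under this condition
  (\<open>tame_nnconv\<close>). Therefore all convolutions of absolute values are finite except possibly at \<open>ln z = 0\<close>, and
  Fubini's theorem applies at every single \<open>z\<close> in \<open>(0, 1)\<close>.
\<close>

section \<open>Convolutions of functions with exponential tails\<close>

text \<open>
  The profile \<open>exp (- p x)\<close> on the left and \<open>exp (- q x)\<close> on the right. The two rates
  are independent: a single kernel may grow towards both ends, and convergence of a convolution comes from conditions
  that relate the left rate of one kernel to the right rate of another.
\<close>
definition decay :: "real \<Rightarrow> real \<Rightarrow> real \<Rightarrow> real" where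
  "decay p q x = exp (- (p * min x 0 + q * max x 0))"

lemma decay_pos [simp]: "decay p q x > 0" "decay p q x \<ge> 0" "decay p q x \<noteq> 0"
  by (auto simp: decay_def)

lemma decay_measurable [measurable]: "decay p q \<in> borel_measurable borel"
  unfolding decay_def[abs_def] by measurable

lemma decay_mono: "p \<le> p' \<Longrightarrow> q' \<le> q \<Longrightarrow> decay p q x \<le> decay p' q' x"
proof -
  assume *: "p \<le> p'" "q' \<le> q"
  have "p' * min x 0 \<le> p * min x 0" using * by (simp add: mult_right_mono_neg)
  moreover have "q' * max x 0 \<le> q * max x 0" using * by (simp add: mult_right_mono)
  ultimately show ?thesis by (simp add: decay_def)
qed

lemma decay_shift: "decay p q (v - x) \<le> exp ((\<bar>p\<bar> + \<bar>q\<bar>) * \<bar>x\<bar>) * decay p q v"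
proof -
  have "p * min v 0 - p * min (v - x) 0 \<le> \<bar>p\<bar> * \<bar>x\<bar>"
  proof -
    have "\<bar>p * (min v 0 - min (v - x) 0)\<bar> \<le> \<bar>p\<bar> * \<bar>x\<bar>"
      unfolding abs_mult by (intro mult_left_mono) auto
    then show ?thesis by (simp add: algebra_simps)
  qed
  moreover have "q * max v 0 - q * max (v - x) 0 \<le> \<bar>q\<bar> * \<bar>x\<bar>"
  proof -
    have "\<bar>q * (max v 0 - max (v - x) 0)\<bar> \<le> \<bar>q\<bar> * \<bar>x\<bar>"
      unfolding abs_mult by (intro mult_left_mono) auto
    then show ?thesis by (simp add: algebra_simps)
  qed
  ultimately show ?thesis
    unfolding decay_def by (simp flip: exp_add) (simp add: algebra_simps)
qed

text \<open>
  The integrand of a convolution of two profiles is dominated by the profile of the slower rates,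
  with a factor that is integrable in \<open>x\<close> when \<open>e > 0\<close>. The loss \<open>e\<close> in the rates absorbs the polynomial factor
  which appears when two rates coincide, so that no case distinction on equal rates is needed.
\<close>
lemma decay_mult_le:
  assumes e: "e \<ge> 0" "p1 + e \<le> p" "p2 + e \<le> p" "q \<le> q1 - e" "q \<le> q2 - e" "p1 + e \<le> q2" "p2 + e \<le> q1"
  shows "decay p1 q1 x * decay p2 q2 (v - x) \<le> exp (- e * \<bar>x\<bar>) * decay p q v"
proof -
  have "p * min v 0 + q * max v 0 + e * \<bar>x\<bar>
      \<le> p1 * min x 0 + q1 * max x 0 + (p2 * min (v - x) 0 + q2 * max (v - x) 0)"
  proof (cases "v \<le> 0")
    case v: True
    consider "x \<le> v" | "v \<le> x" "x \<le> 0" | "0 \<le> x" by linarith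
    then show ?thesis
    proof cases
      case 1
      have m: "min v 0 = v" "max v 0 = 0" "min x 0 = x" "max x 0 = 0"
        "min (v - x) 0 = 0" "max (v - x) 0 = v - x" "\<bar>x\<bar> = - x"
        using 1 v by auto
      have "(p1 + e) * (v - x) \<le> q2 * (v - x)" using e 1 by (intro mult_right_mono) auto
      moreover have "p * v \<le> (p1 + e) * v" using e v by (intro mult_right_mono_neg) auto
      ultimately show ?thesis unfolding m by (simp only: ring_distribs, linarith?)
    next
      case 2
      have m: "min v 0 = v" "max v 0 = 0" "min x 0 = x" "max x 0 = 0"
        "min (v - x) 0 = v - x" "max (v - x) 0 = 0" "\<bar>x\<bar> = - x"
        using 2 v by auto
      have "p * (v - x) \<le> p2 * (v - x)" using e 2 by (intro mult_right_mono_neg) auto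
      moreover have "p * x \<le> (p1 + e) * x" using e 2 by (intro mult_right_mono_neg) auto
      ultimately show ?thesis unfolding m by (simp only: ring_distribs, linarith?)
    next
      case 3
      have m: "min v 0 = v" "max v 0 = 0" "min x 0 = 0" "max x 0 = x"
        "min (v - x) 0 = v - x" "max (v - x) 0 = 0" "\<bar>x\<bar> = x"
        using 3 v by auto
      have "p * v \<le> p2 * v" using e v by (intro mult_right_mono_neg) auto
      moreover have "(p2 + e) * x \<le> q1 * x" using e 3 by (intro mult_right_mono) auto
      ultimately show ?thesis unfolding m by (simp only: ring_distribs, linarith?)
    qed
  next
    case False
    then have v: "v > 0" by simp
    consider "v \<le> x" | "0 \<le> x" "x \<le> v" | "x \<le> 0" by linarith
    then show ?thesis
    proof cases
      case 1
      have m: "min v 0 = 0" "max v 0 = v" "min x 0 = 0" "max x 0 = x"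
        "min (v - x) 0 = v - x" "max (v - x) 0 = 0" "\<bar>x\<bar> = x"
        using 1 v by auto
      have "(p2 + e) * (x - v) \<le> q1 * (x - v)" using e 1 by (intro mult_right_mono) auto
      moreover have "(q + e) * v \<le> q1 * v" using e v by (intro mult_right_mono) auto
      ultimately show ?thesis unfolding m by (simp only: ring_distribs, linarith?)
    next
      case 2
      have m: "min v 0 = 0" "max v 0 = v" "min x 0 = 0" "max x 0 = x"
        "min (v - x) 0 = 0" "max (v - x) 0 = v - x" "\<bar>x\<bar> = x"
        using 2 v by auto
      have "q * (v - x) \<le> q2 * (v - x)" using e 2 by (intro mult_right_mono) auto
      moreover have "(q + e) * x \<le> q1 * x" using e 2 by (intro mult_right_mono) auto
      ultimately show ?thesis unfolding m by (simp only: ring_distribs, linarith?)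
    next
      case 3
      have m: "min v 0 = 0" "max v 0 = v" "min x 0 = x" "max x 0 = 0"
        "min (v - x) 0 = 0" "max (v - x) 0 = v - x" "\<bar>x\<bar> = - x"
        using 3 v by auto
      have "q * v \<le> q2 * v" using e v by (intro mult_right_mono) auto
      moreover have "q2 * x \<le> (p1 + e) * x" using e 3 by (intro mult_right_mono_neg) auto
      ultimately show ?thesis unfolding m by (simp only: ring_distribs, linarith?)
    qed
  qed
  then show ?thesis unfolding decay_def by (simp flip: exp_add)
qed

definition nnconv :: "(real \<Rightarrow> ennreal) \<Rightarrow> (real \<Rightarrow> ennreal) \<Rightarrow> real \<Rightarrow> ennreal" where
  "nnconv f g v = (\<integral>\<^sup>+x. f x * g (v - x) \<partial>lborel)"

lemma nnconv_measurable [measurable]: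
  assumes [measurable]: "f \<in> borel_measurable borel" "g \<in> borel_measurable borel"
  shows "nnconv f g \<in> borel_measurable borel"
  unfolding nnconv_def[abs_def] by measurable

lemma nnconv_mono: "(\<And>x. f x \<le> f' x) \<Longrightarrow> (\<And>x. g x \<le> g' x) \<Longrightarrow> nnconv f g v \<le> nnconv f' g' v"
  unfolding nnconv_def by (intro nn_integral_mono mult_mono) auto

lemma nnconv_commute:
  assumes [measurable]: "f \<in> borel_measurable borel" "g \<in> borel_measurable borel"
  shows "nnconv f g v = nnconv g f v"
  unfolding nnconv_def
  by (subst nn_integral_real_affine[where c = "-1" and t = v]) (auto simp: mult.commute)

lemma nnconv_add:
  assumes [measurable]: "f \<in> borel_measurable borel" "g \<in> borel_measurable borel" "h \<in> borel_measurable borel"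
  shows "nnconv (\<lambda>x. f x + g x) h v = nnconv f h v + nnconv g h v"
    "nnconv h (\<lambda>x. f x + g x) v = nnconv h f v + nnconv h g v"
  unfolding nnconv_def by (auto simp: distrib_right distrib_left nn_integral_add)

text \<open>Together with commutativity this allows any reordering of an iterated convolution.\<close>
lemma nnconv_left_commute:
  assumes [measurable]: "f \<in> borel_measurable borel" "g \<in> borel_measurable borel" "h \<in> borel_measurable borel"
  shows "nnconv f (nnconv g h) v = nnconv g (nnconv f h) v"
proof -
  have "nnconv f (nnconv g h) v = (\<integral>\<^sup>+x. \<integral>\<^sup>+y. f x * (g y * h (v - x - y)) \<partial>lborel \<partial>lborel)"
    unfolding nnconv_def by (simp add: nn_integral_cmult)
  also have "\<dots> = (\<integral>\<^sup>+y. \<integral>\<^sup>+x. f x * (g y * h (v - x - y)) \<partial>lborel \<partial>lborel)"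
    by (rule lborel_pair.Fubini') simp
  also have "\<dots> = (\<integral>\<^sup>+y. \<integral>\<^sup>+x. g y * (f x * h (v - y - x)) \<partial>lborel \<partial>lborel)"
    by (intro nn_integral_cong) (simp add: mult.left_commute algebra_simps)
  also have "\<dots> = nnconv g (nnconv f h) v"
    unfolding nnconv_def by (simp add: nn_integral_cmult)
  finally show ?thesis .
qed

lemma nn_integral_nnconv:
  assumes [measurable]: "f \<in> borel_measurable borel" "g \<in> borel_measurable borel"
  shows "(\<integral>\<^sup>+v. nnconv f g v \<partial>lborel) = (\<integral>\<^sup>+x. f x \<partial>lborel) * (\<integral>\<^sup>+x. g x \<partial>lborel)"
proof -
  have "(\<integral>\<^sup>+v. nnconv f g v \<partial>lborel) = (\<integral>\<^sup>+x. \<integral>\<^sup>+v. f x * g (v - x) \<partial>lborel \<partial>lborel)"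
    unfolding nnconv_def by (rule lborel_pair.Fubini') simp
  also have "\<dots> = (\<integral>\<^sup>+x. f x * (\<integral>\<^sup>+v. g v \<partial>lborel) \<partial>lborel)"
  proof (rule nn_integral_cong)
    fix x
    have "(\<integral>\<^sup>+v. g v \<partial>lborel) = (\<integral>\<^sup>+v. g (v - x) \<partial>lborel)"
      by (subst nn_integral_real_affine[where c = 1 and t = "-x"]) auto
    then show "(\<integral>\<^sup>+v. f x * g (v - x) \<partial>lborel) = f x * (\<integral>\<^sup>+v. g v \<partial>lborel)"
      by (simp add: nn_integral_cmult)
  qed
  finally show ?thesis by (simp add: nn_integral_multc)
qed

lemma nn_integral_even_finite:
  fixes f :: "real \<Rightarrow> ennreal"
  assumes [measurable]: "f \<in> borel_measurable borel" and even: "\<And>x. f (- x) = f x"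
    and half: "(\<integral>\<^sup>+x. f x * indicator {0..} x \<partial>lborel) < \<infinity>"
  shows "(\<integral>\<^sup>+x. f x \<partial>lborel) < \<infinity>"
proof -
  have "(\<integral>\<^sup>+x. f x * indicator {..0} x \<partial>lborel) = (\<integral>\<^sup>+x. f x * indicator {0..} x \<partial>lborel)"
    by (subst nn_integral_real_affine[where c = "-1" and t = 0])
       (auto intro!: nn_integral_cong simp: indicator_def even)
  moreover have "(\<integral>\<^sup>+x. f x \<partial>lborel) \<le> (\<integral>\<^sup>+x. f x * indicator {0..} x + f x * indicator {..0} x \<partial>lborel)"
    by (intro nn_integral_mono) (auto simp: indicator_def)
  ultimately show ?thesis using half by (subst (asm) nn_integral_add) (auto intro: le_less_trans)
qed

lemma nn_integral_exp_abs_finite: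
  assumes "e > 0" shows "(\<integral>\<^sup>+x. ennreal (exp (- e * \<bar>x\<bar>)) \<partial>lborel) < \<infinity>"
proof (rule nn_integral_even_finite)
  have "(\<integral>\<^sup>+x. ennreal (exp (- e * x)) * indicator {0..} x \<partial>lborel) = ennreal (0 - (- exp (- e * 0) / e))"
  proof (rule nn_integral_FTC_atLeast)
    have "filterlim (\<lambda>x. - e * x) at_bot at_top"
      using assms by (intro filterlim_tendsto_neg_mult_at_bot[OF tendsto_const _ filterlim_ident]) auto
    from filterlim_compose[OF exp_at_bot this]
    have "((\<lambda>x. - exp (- e * x) / e) \<longlongrightarrow> - 0 / e) at_top"
      using assms by (intro tendsto_intros) auto
    then show "((\<lambda>x. - exp (- e * x) / e) \<longlongrightarrow> 0) at_top" by simp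
    show "((\<lambda>x. - exp (- e * x) / e) has_real_derivative exp (- e * x)) (at x)" for x
      using assms by (auto intro!: derivative_eq_intros)
  qed auto
  moreover have "(\<integral>\<^sup>+x. ennreal (exp (- e * \<bar>x\<bar>)) * indicator {0..} x \<partial>lborel)
      = (\<integral>\<^sup>+x. ennreal (exp (- e * x)) * indicator {0..} x \<partial>lborel)"
    by (intro nn_integral_cong) (auto simp: indicator_def)
  ultimately show "(\<integral>\<^sup>+x. ennreal (exp (- e * \<bar>x\<bar>)) * indicator {0..} x \<partial>lborel) < \<infinity>" by simp
qed simp_all

text \<open>
  An integrable singularity at \<open>0\<close> and exponential tails. The singularity is the reason why all
  later identities between convolutions are stated for nonzero arguments only.
\<close>
definition tame :: "real \<Rightarrow> real \<Rightarrow> (real \<Rightarrow> ennreal) \<Rightarrow> bool" where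
  "tame p q f \<longleftrightarrow> f \<in> borel_measurable borel \<and>
     (\<forall>\<delta>>0. \<exists>C\<ge>0. \<forall>x. \<bar>x\<bar> \<ge> \<delta> \<longrightarrow> f x \<le> ennreal (C * decay p q x)) \<and>
     (\<exists>\<delta>>0. (\<integral>\<^sup>+x. f x * indicator {-\<delta><..<\<delta>} x \<partial>lborel) < \<infinity>)"

lemma tameI:
  assumes "f \<in> borel_measurable borel"
    and "\<And>\<delta>. \<delta> > 0 \<Longrightarrow> \<exists>C\<ge>0. \<forall>x. \<bar>x\<bar> \<ge> \<delta> \<longrightarrow> f x \<le> ennreal (C * decay p q x)"
    and "d > 0" "(\<integral>\<^sup>+x. f x * indicator {-d<..<d} x \<partial>lborel) < \<infinity>"
  shows "tame p q f"
  using assms unfolding tame_def by blast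

lemma tame_measurable: "tame p q f \<Longrightarrow> f \<in> borel_measurable borel"
  by (simp add: tame_def)

lemma tame_bound:
  assumes "tame p q f" "\<delta> > 0"
  obtains C where "C \<ge> 0" "\<And>x. \<bar>x\<bar> \<ge> \<delta> \<Longrightarrow> f x \<le> ennreal (C * decay p q x)"
proof -
  have "\<exists>C\<ge>0. \<forall>x. \<bar>x\<bar> \<ge> \<delta> \<longrightarrow> f x \<le> ennreal (C * decay p q x)"
    using assms by (simp add: tame_def)
  then obtain C where "C \<ge> 0" "\<forall>x. \<bar>x\<bar> \<ge> \<delta> \<longrightarrow> f x \<le> ennreal (C * decay p q x)" by (elim exE conjE)
  then show ?thesis by (intro that[of C]) simp_all
qed

lemma tame_local:
  assumes "tame p q f"
  obtains d where "d > 0" "(\<integral>\<^sup>+x. f x * indicator {-d<..<d} x \<partial>lborel) < \<infinity>"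
proof -
  have "\<exists>d>0. (\<integral>\<^sup>+x. f x * indicator {-d<..<d} x \<partial>lborel) < \<infinity>"
    using assms by (simp only: tame_def)
  then show ?thesis by (elim exE conjE) (rule that)
qed

lemma tame_mono:
  assumes "tame p q f" "p \<le> p'" "q' \<le> q"
  shows "tame p' q' f"
proof -
  obtain d where d: "d > 0" "(\<integral>\<^sup>+x. f x * indicator {-d<..<d} x \<partial>lborel) < \<infinity>"
    by (rule tame_local[OF assms(1)])
  show ?thesis
  proof (rule tameI[OF tame_measurable[OF assms(1)] _ d])
    fix \<delta> :: real assume "\<delta> > 0"
    then obtain C where C: "C \<ge> 0" "\<And>x. \<bar>x\<bar> \<ge> \<delta> \<Longrightarrow> f x \<le> ennreal (C * decay p q x)"
      by (rule tame_bound[OF assms(1)]) blast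
    have "f x \<le> ennreal (C * decay p' q' x)" if "\<bar>x\<bar> \<ge> \<delta>" for x
      using C(2)[OF that] by (rule order_trans) (intro ennreal_leI mult_left_mono decay_mono assms(2,3) C(1))
    with C(1) show "\<exists>C\<ge>0. \<forall>x. \<bar>x\<bar> \<ge> \<delta> \<longrightarrow> f x \<le> ennreal (C * decay p' q' x)" by (intro exI[of _ C]) simp
  qed
qed

lemma tame_finite:
  assumes "tame p q f" "x \<noteq> 0" shows "f x < \<infinity>"
proof -
  have "\<bar>x\<bar> > 0" using assms by simp
  from tame_bound[OF assms(1) this] obtain C where "f x \<le> ennreal (C * decay p q x)"
    by (metis order_refl)
  then show ?thesis by (rule le_less_trans) simp
qed

lemma decay_bounded: "decay p q x \<le> exp ((\<bar>p\<bar> + \<bar>q\<bar>) * \<bar>x\<bar>)"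
  using decay_shift[of p q 0 "-x"] by (simp add: decay_def)

text \<open>
  Each function splits into a part near \<open>0\<close> and a tail. Tails convolve to a tail by
  \<open>decay_mult_le\<close>; a tail convolved with an integrable function of compact support keeps its shape; and the
  two local parts give an integrable function supported in a small neighbourhood of \<open>0\<close>. Because the splitting
  radius is arbitrary, the bound away from \<open>0\<close> follows for every radius.
\<close>
lemma tame_nnconv:
  assumes f: "tame p1 q1 f" and g: "tame p2 q2 g"
    and pq: "p1 < p" "p2 < p" "q < q1" "q < q2" "p1 < q2" "p2 < q1"
  shows "tame p q (nnconv f g)"
proof -
  have [measurable]: "f \<in> borel_measurable borel" "g \<in> borel_measurable borel"
    using f g by (simp_all add: tame_measurable)
  obtain df where df: "df > 0" "(\<integral>\<^sup>+x. f x * indicator {-df<..<df} x \<partial>lborel) < \<infinity>"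
    by (rule tame_local[OF f]) blast
  obtain dg where dg: "dg > 0" "(\<integral>\<^sup>+x. g x * indicator {-dg<..<dg} x \<partial>lborel) < \<infinity>"
    by (rule tame_local[OF g]) blast
  \<comment> \<open>The smallest slack in all the strict inequalities between the rates.\<close>
  define e where "e = Min {p - p1, p - p2, q1 - q, q2 - q, q2 - p1, q1 - p2}"
  have "e > 0" using pq by (simp add: e_def)
  moreover have "e \<le> x" if "x \<in> {p - p1, p - p2, q1 - q, q2 - q, q2 - p1, q1 - p2}" for x
    unfolding e_def using that by (intro Min_le) auto
  note this[of "p - p1"] this[of "p - p2"] this[of "q1 - q"] this[of "q2 - q"] this[of "q2 - p1"] this[of "q1 - p2"]
  ultimately have e: "e > 0" "p1 + e \<le> p" "p2 + e \<le> p" "q \<le> q1 - e" "q \<le> q2 - e" "p1 + e \<le> q2" "p2 + e \<le> q1"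
    by simp_all
  obtain E where E: "E \<ge> 0" "(\<integral>\<^sup>+x. ennreal (exp (- e * \<bar>x\<bar>)) \<partial>lborel) = ennreal E"
    using nn_integral_exp_abs_finite[OF e(1)] by (auto simp: less_top_ennreal)
  have split: "\<exists>C\<ge>0. \<exists>l\<in>borel_measurable borel. (\<integral>\<^sup>+v. l v \<partial>lborel) < \<infinity> \<and>
      (\<forall>v. \<bar>v\<bar> \<ge> 2 * d \<longrightarrow> l v = 0) \<and> (\<forall>v. nnconv f g v \<le> ennreal (C * decay p q v) + l v)"
    if d: "d > 0" "d \<le> df" "d \<le> dg" for d
  proof -
    obtain Cf where Cf: "Cf \<ge> 0" "\<And>x. \<bar>x\<bar> \<ge> d \<Longrightarrow> f x \<le> ennreal (Cf * decay p1 q1 x)"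
      by (rule tame_bound[OF f d(1)]) blast
    obtain Cg where Cg: "Cg \<ge> 0" "\<And>x. \<bar>x\<bar> \<ge> d \<Longrightarrow> g x \<le> ennreal (Cg * decay p2 q2 x)"
      by (rule tame_bound[OF g d(1)]) blast
    define lf where "lf x = f x * indicator {-d<..<d} x" for x
    define lg where "lg x = g x * indicator {-d<..<d} x" for x
    define wf where "wf x = ennreal (Cf * decay p1 q1 x)" for x
    define wg where "wg x = ennreal (Cg * decay p2 q2 x)" for x
    have [measurable]: "lf \<in> borel_measurable borel" "lg \<in> borel_measurable borel"
      "wf \<in> borel_measurable borel" "wg \<in> borel_measurable borel"
      unfolding lf_def[abs_def] lg_def[abs_def] wf_def[abs_def] wg_def[abs_def] by measurable
    have "(\<integral>\<^sup>+x. lf x \<partial>lborel) \<le> (\<integral>\<^sup>+x. f x * indicator {-df<..<df} x \<partial>lborel)"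
      unfolding lf_def using d by (intro nn_integral_mono) (auto simp: indicator_def)
    with df(2) have "(\<integral>\<^sup>+x. lf x \<partial>lborel) < \<infinity>" by (meson order_le_less_trans)
    then obtain Lf where Lf: "Lf \<ge> 0" "(\<integral>\<^sup>+x. lf x \<partial>lborel) = ennreal Lf" by (auto simp: less_top_ennreal)
    have "(\<integral>\<^sup>+x. lg x \<partial>lborel) \<le> (\<integral>\<^sup>+x. g x * indicator {-dg<..<dg} x \<partial>lborel)"
      unfolding lg_def using d by (intro nn_integral_mono) (auto simp: indicator_def)
    with dg(2) have "(\<integral>\<^sup>+x. lg x \<partial>lborel) < \<infinity>" by (meson order_le_less_trans)
    then obtain Lg where Lg: "Lg \<ge> 0" "(\<integral>\<^sup>+x. lg x \<partial>lborel) = ennreal Lg" by (auto simp: less_top_ennreal)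
    have f_le: "f x \<le> wf x + lf x" for x
    proof (cases "\<bar>x\<bar> < d")
      case True
      then have "lf x = f x" by (simp add: lf_def indicator_def abs_less_iff)
      then show ?thesis by simp
    next
      case False
      then have "f x \<le> wf x" using Cf(2)[of x] by (simp add: wf_def)
      then show ?thesis by (simp add: add_increasing2)
    qed
    have g_le: "g x \<le> wg x + lg x" for x
    proof (cases "\<bar>x\<bar> < d")
      case True
      then have "lg x = g x" by (simp add: lg_def indicator_def abs_less_iff)
      then show ?thesis by simp
    next
      case False
      then have "g x \<le> wg x" using Cg(2)[of x] by (simp add: wg_def)
      then show ?thesis by (simp add: add_increasing2)
    qed
    have ww: "nnconv wf wg v \<le> ennreal (Cf * Cg * E * decay p q v)" for v
    proof -
      have "nnconv wf wg v \<le> (\<integral>\<^sup>+x. ennreal (Cf * Cg * decay p q v) * ennreal (exp (- e * \<bar>x\<bar>)) \<partial>lborel)"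
        unfolding nnconv_def
      proof (intro nn_integral_mono)
        fix x
        have "(Cf * Cg) * (decay p1 q1 x * decay p2 q2 (v - x)) \<le> (Cf * Cg) * (exp (- e * \<bar>x\<bar>) * decay p q v)"
          using e Cf Cg by (intro mult_left_mono decay_mult_le) auto
        then show "wf x * wg (v - x) \<le> ennreal (Cf * Cg * decay p q v) * ennreal (exp (- e * \<bar>x\<bar>))"
          using Cf(1) Cg(1) by (auto simp: wf_def wg_def mult_ac simp flip: ennreal_mult)
      qed
      also have "\<dots> = ennreal (Cf * Cg * decay p q v) * ennreal E"
        using E(2) by (simp add: nn_integral_cmult)
      finally show ?thesis using Cf(1) Cg(1) E(1) by (simp add: mult_ac flip: ennreal_mult)
    qed
    have lw: "nnconv l (\<lambda>x. ennreal (c * decay p' q' x)) v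
        \<le> ennreal (L * c * exp ((\<bar>p'\<bar> + \<bar>q'\<bar>) * d) * decay p q v)"
      if [measurable]: "l \<in> borel_measurable borel" and "(\<integral>\<^sup>+x. l x \<partial>lborel) = ennreal L"
        and "\<And>x. \<bar>x\<bar> \<ge> d \<Longrightarrow> l x = 0" and "c \<ge> 0" "L \<ge> 0" and "p' \<le> p" "q \<le> q'" for l L c p' q' v
    proof -
      let ?c = "c * exp ((\<bar>p'\<bar> + \<bar>q'\<bar>) * d) * decay p q v"
      have "nnconv l (\<lambda>x. ennreal (c * decay p' q' x)) v \<le> (\<integral>\<^sup>+x. l x * ennreal ?c \<partial>lborel)"
        unfolding nnconv_def
      proof (intro nn_integral_mono)
        fix x
        show "l x * ennreal (c * decay p' q' (v - x)) \<le> l x * ennreal ?c"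
        proof (cases "\<bar>x\<bar> \<ge> d")
          case False
          have "decay p' q' (v - x) \<le> exp ((\<bar>p'\<bar> + \<bar>q'\<bar>) * \<bar>x\<bar>) * decay p' q' v" by (rule decay_shift)
          also have "\<dots> \<le> exp ((\<bar>p'\<bar> + \<bar>q'\<bar>) * d) * decay p q v"
            using False that by (intro mult_mono decay_mono) (auto intro!: mult_left_mono)
          finally show ?thesis
            using that by (intro mult_left_mono ennreal_leI) (auto simp: mult.assoc intro!: mult_left_mono)
        qed (use that in auto)
      qed
      also have "\<dots> = ennreal L * ennreal ?c" by (simp add: nn_integral_multc that)
      finally show ?thesis using that by (simp add: mult_ac flip: ennreal_mult)
    qed
    have ll0: "nnconv lf lg v = 0" if "\<bar>v\<bar> \<ge> 2 * d" for v
    proof -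
      have "lf x * lg (v - x) = 0" for x
        using that by (auto simp: lf_def lg_def indicator_def abs_if split: if_splits)
      then show ?thesis unfolding nnconv_def by (simp only: nn_integral_const) simp
    qed
    have out: "lf x = 0" "lg x = 0" if "\<bar>x\<bar> \<ge> d" for x
      using that by (auto simp: lf_def lg_def indicator_def)
    have lgw: "nnconv lg wf v \<le> ennreal (Lg * Cf * exp ((\<bar>p1\<bar> + \<bar>q1\<bar>) * d) * decay p q v)" for v
      unfolding wf_def[abs_def] using Lg Cf(1) pq out by (intro lw) auto
    have lfw: "nnconv lf wg v \<le> ennreal (Lf * Cg * exp ((\<bar>p2\<bar> + \<bar>q2\<bar>) * d) * decay p q v)" for v
      unfolding wg_def[abs_def] using Lf Cg(1) pq out by (intro lw) auto
    let ?C1 = "Lf * Cg * exp ((\<bar>p2\<bar> + \<bar>q2\<bar>) * d)"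
    let ?C2 = "Lg * Cf * exp ((\<bar>p1\<bar> + \<bar>q1\<bar>) * d)"
    let ?C = "Cf * Cg * E + ?C1 + ?C2"
    have C: "?C \<ge> 0" using Cf Cg E Lf Lg by auto
    have "nnconv f g v \<le> ennreal (?C * decay p q v) + nnconv lf lg v" for v
    proof -
      have "nnconv f g v \<le> nnconv (\<lambda>x. wf x + lf x) (\<lambda>x. wg x + lg x) v"
        by (intro nnconv_mono f_le g_le)
      also have "\<dots> = (nnconv wf wg v + nnconv wf lg v) + (nnconv lf wg v + nnconv lf lg v)"
        by (simp add: nnconv_add)
      also have "nnconv wf lg v = nnconv lg wf v" by (rule nnconv_commute) measurable
      also have "nnconv wf wg v + nnconv lg wf v + (nnconv lf wg v + nnconv lf lg v)
        \<le> ennreal (Cf * Cg * E * decay p q v) + ennreal (?C2 * decay p q v)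
            + (ennreal (?C1 * decay p q v) + nnconv lf lg v)"
        using ww[of v] lgw[of v] lfw[of v] by (intro add_mono order_refl)
      also have "\<dots> = ennreal (?C * decay p q v) + nnconv lf lg v"
      proof -
        have "ennreal (?C * decay p q v)
            = ennreal (Cf * Cg * E * decay p q v + ?C2 * decay p q v + ?C1 * decay p q v)"
          by (rule arg_cong[of _ _ ennreal]) (simp only: distrib_right add_ac)
        also have "\<dots> = ennreal (Cf * Cg * E * decay p q v) + ennreal (?C2 * decay p q v)
            + ennreal (?C1 * decay p q v)"
          using Cf(1) Cg(1) E(1) Lf(1) Lg(1) by (subst ennreal_plus ennreal_plus, auto)+
        finally show ?thesis by (simp only: add.assoc)
      qed
      finally show ?thesis .
    qed
    moreover have "(\<integral>\<^sup>+v. nnconv lf lg v \<partial>lborel) < \<infinity>"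
      using Lf Lg by (simp add: nn_integral_nnconv ennreal_mult_less_top)
    moreover have "nnconv lf lg \<in> borel_measurable borel" by measurable
    ultimately show ?thesis using C ll0 by (intro exI[of _ ?C] conjI bexI[of _ "nnconv lf lg"]) auto
  qed
  have "\<exists>C\<ge>0. \<forall>v. \<bar>v\<bar> \<ge> \<delta> \<longrightarrow> nnconv f g v \<le> ennreal (C * decay p q v)" if "\<delta> > 0" for \<delta>
  proof -
    define d where "d = Min {df, dg, \<delta> / 2}"
    have d: "d > 0" "d \<le> df" "d \<le> dg" "2 * d \<le> \<delta>" using that df dg by (auto simp: d_def min_def)
    obtain C l where *: "C \<ge> 0" "\<forall>v. \<bar>v\<bar> \<ge> 2 * d \<longrightarrow> l v = 0"
      "\<forall>v. nnconv f g v \<le> ennreal (C * decay p q v) + l v"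
      using split[OF d(1-3)] by blast
    have "nnconv f g v \<le> ennreal (C * decay p q v)" if "\<bar>v\<bar> \<ge> \<delta>" for v
      using *(2,3) that d(4) by (metis add.right_neutral order_trans)
    then show ?thesis using *(1) by blast
  qed
  moreover have "(\<integral>\<^sup>+v. nnconv f g v * indicator {-1<..<1} v \<partial>lborel) < \<infinity>"
  proof -
    define d where "d = min df dg"
    have d: "d > 0" "d \<le> df" "d \<le> dg" using df dg by (auto simp: d_def min_def)
    obtain C l where *: "C \<ge> 0" "l \<in> borel_measurable borel" "(\<integral>\<^sup>+v. l v \<partial>lborel) < \<infinity>"
      "\<forall>v. nnconv f g v \<le> ennreal (C * decay p q v) + l v"
      using split[OF d] by blast
    note [measurable] = *(2)
    let ?C = "C * exp (\<bar>p\<bar> + \<bar>q\<bar>)"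
    have "(\<integral>\<^sup>+v. nnconv f g v * indicator {-1<..<1} v \<partial>lborel)
        \<le> (\<integral>\<^sup>+v. ennreal ?C * indicator {-1<..<1} v + l v \<partial>lborel)"
    proof (intro nn_integral_mono)
      fix v :: real
      have "decay p q v \<le> exp (\<bar>p\<bar> + \<bar>q\<bar>)" if "v \<in> {-1<..<1}"
      proof -
        have "(\<bar>p\<bar> + \<bar>q\<bar>) * \<bar>v\<bar> \<le> \<bar>p\<bar> + \<bar>q\<bar>"
          using that by (intro mult_left_le) auto
        then show ?thesis using decay_bounded[of p q v] by (meson exp_le_cancel_iff order_trans)
      qed
      then have "ennreal (C * decay p q v) \<le> ennreal ?C" if "v \<in> {-1<..<1}"
        using that *(1) by (intro ennreal_leI mult_left_mono) auto
      then have "nnconv f g v \<le> ennreal ?C + l v" if "v \<in> {-1<..<1}"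
        using *(4) that by (meson add_right_mono order_trans)
      then show "nnconv f g v * indicator {-1<..<1} v \<le> ennreal ?C * indicator {-1<..<1} v + l v"
        by (auto simp: indicator_def)
    qed
    also have "\<dots> = ennreal ?C * 2 + (\<integral>\<^sup>+v. l v \<partial>lborel)"
      by (simp add: nn_integral_add nn_integral_cmult)
    also have "\<dots> < \<infinity>" using *(3) by (simp add: ennreal_mult_less_top)
    finally show ?thesis .
  qed
  ultimately show ?thesis by (intro tameI[of _ _ _ 1]) simp_all
qed

section \<open>Convolutions of complex functions\<close>

definition conv :: "(real \<Rightarrow> complex) \<Rightarrow> (real \<Rightarrow> complex) \<Rightarrow> real \<Rightarrow> complex" where
  "conv f g v = (\<integral>x. f x * g (v - x) \<partial>lborel)"

lemma conv_measurable [measurable]: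
  assumes [measurable]: "f \<in> borel_measurable borel" "g \<in> borel_measurable borel"
  shows "conv f g \<in> borel_measurable borel"
  unfolding conv_def[abs_def] by measurable

text \<open>
  Reflection preserves integrability, so that both sides take the default value \<open>0\<close> in the same cases.
\<close>
lemma conv_commute: "conv f g v = conv g f v"
  unfolding conv_def
  by (subst lborel_integral_real_affine[where c = "-1" and t = v]) (auto simp: mult.commute)

lemma AE_lborel_neq: "AE x in lborel. x \<noteq> (c::real)"
  using AE_lborel_singleton .

lemma AE_reflect_neq: "AE x in lborel. v - x \<noteq> (0::real)"
  using AE_lborel_neq[of v] by eventually_elim auto

lemma conv_cong:
  assumes [measurable]: "f \<in> borel_measurable borel" "g \<in> borel_measurable borel" "g' \<in> borel_measurable borel"
    and "\<And>x. x \<noteq> 0 \<Longrightarrow> g x = g' x"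
  shows "conv f g v = conv f g' v"
  unfolding conv_def
proof (rule integral_cong_AE)
  show "AE x in lborel. f x * g (v - x) = f x * g' (v - x)"
    using AE_reflect_neq[of v] by eventually_elim (simp add: assms(4))
qed simp_all

text \<open>The value at \<open>0\<close> is left free, so that functions which agree off \<open>0\<close> have the same majorants.\<close>
definition majorized :: "(real \<Rightarrow> complex) \<Rightarrow> (real \<Rightarrow> ennreal) \<Rightarrow> bool" where
  "majorized f K \<longleftrightarrow> f \<in> borel_measurable borel \<and> K \<in> borel_measurable borel \<and>
     (\<forall>x. x \<noteq> 0 \<longrightarrow> ennreal (norm (f x)) \<le> K x)"

lemma majorizedD: "majorized f K \<Longrightarrow> f \<in> borel_measurable borel" "majorized f K \<Longrightarrow> K \<in> borel_measurable borel"
  by (auto simp: majorized_def)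

lemma nn_integral_norm_le_nnconv:
  assumes f: "majorized f Kf" and g: "majorized g Kg"
  shows "(\<integral>\<^sup>+x. ennreal (norm (f x * g (v - x))) \<partial>lborel) \<le> nnconv Kf Kg v"
  unfolding nnconv_def
proof (rule nn_integral_mono_AE)
  show "AE x in lborel. ennreal (norm (f x * g (v - x))) \<le> Kf x * Kg (v - x)"
    using AE_reflect_neq[of v] AE_lborel_neq[of 0]
  proof eventually_elim
    case (elim x)
    then show ?case using f g by (auto simp: majorized_def norm_mult ennreal_mult intro!: mult_mono)
  qed
qed

lemma conv_integrable:
  assumes f: "majorized f Kf" and g: "majorized g Kg" and "nnconv Kf Kg v < \<infinity>"
  shows "integrable lborel (\<lambda>x. f x * g (v - x))"
proof (rule integrableI_bounded)
  note [measurable] = majorizedD[OF f] majorizedD[OF g]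
  show "(\<lambda>x. f x * g (v - x)) \<in> borel_measurable lborel" by measurable
  show "(\<integral>\<^sup>+x. ennreal (norm (f x * g (v - x))) \<partial>lborel) < \<infinity>"
    using nn_integral_norm_le_nnconv[OF f g] assms(3) by (rule le_less_trans)
qed

lemma majorized_conv:
  assumes f: "majorized f Kf" and g: "majorized g Kg"
  shows "majorized (conv f g) (nnconv Kf Kg)"
  unfolding majorized_def
proof (intro conjI allI impI)
  note [measurable] = majorizedD[OF f] majorizedD[OF g]
  show "conv f g \<in> borel_measurable borel" "nnconv Kf Kg \<in> borel_measurable borel" by measurable
  fix v :: real
  show "ennreal (norm (conv f g v)) \<le> nnconv Kf Kg v"
  proof (cases "integrable lborel (\<lambda>x. f x * g (v - x))")
    case True
    from integral_norm_bound_ennreal[OF this]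
    show ?thesis unfolding conv_def using nn_integral_norm_le_nnconv[OF f g] by (rule order_trans)
  qed (simp add: conv_def not_integrable_integral_eq)
qed

lemma majorized_lincomb:
  assumes f: "majorized f (\<lambda>x. ennreal c * K x)" and g: "majorized g (\<lambda>x. ennreal d * K x)" and "c \<ge> 0" "d \<ge> 0"
  and [measurable]: "K \<in> borel_measurable borel"
  shows "majorized (\<lambda>x. a * f x + b * g x) (\<lambda>x. ennreal (norm a * c + norm b * d) * K x)"
  unfolding majorized_def
proof (intro conjI allI impI)
  note [measurable] = majorizedD[OF f] majorizedD[OF g]
  show "(\<lambda>x. a * f x + b * g x) \<in> borel_measurable borel" by measurable
  show "(\<lambda>x. ennreal (norm a * c + norm b * d) * K x) \<in> borel_measurable borel" by measurable
  fix x :: real assume x: "x \<noteq> 0"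
  have "ennreal (norm (a * f x + b * g x)) \<le> ennreal (norm a * norm (f x) + norm b * norm (g x))"
    by (intro ennreal_leI norm_triangle_le) (simp add: norm_mult)
  also have "\<dots> = ennreal (norm a) * ennreal (norm (f x)) + ennreal (norm b) * ennreal (norm (g x))"
    by (simp add: ennreal_mult)
  also have "\<dots> \<le> ennreal (norm a) * (ennreal c * K x) + ennreal (norm b) * (ennreal d * K x)"
    using f g x by (intro add_mono mult_left_mono) (auto simp: majorized_def)
  also have "\<dots> = ennreal (norm a * c + norm b * d) * K x"
    using assms by (simp add: ennreal_mult distrib_right mult.assoc)
  finally show "ennreal (norm (a * f x + b * g x)) \<le> ennreal (norm a * c + norm b * d) * K x" .
qed

text \<open>
  Both sides are iterated integrals of the same function of two variables, so this is Fubini's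
  theorem. Finiteness at the single point \<open>v\<close> makes that function integrable on the plane.
\<close>
lemma conv_left_commute:
  assumes f: "majorized f Kf" and g: "majorized g Kg" and h: "majorized h Kh" and fin: "nnconv Kf (nnconv Kg Kh) v < \<infinity>"
  shows "conv f (conv g h) v = conv g (conv f h) v"
proof -
  note [measurable] = majorizedD[OF f] majorizedD[OF g] majorizedD[OF h]
  have "(\<integral>\<^sup>+x. \<integral>\<^sup>+y. ennreal (norm (f x * (g y * h (v - x - y)))) \<partial>lborel \<partial>lborel) \<le> nnconv Kf (nnconv Kg Kh) v"
    unfolding nnconv_def[of Kf]
  proof (rule nn_integral_mono_AE)
    show "AE x in lborel. (\<integral>\<^sup>+y. ennreal (norm (f x * (g y * h (v - x - y)))) \<partial>lborel) \<le> Kf x * nnconv Kg Kh (v - x)"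
      using AE_lborel_neq[of 0]
    proof eventually_elim
      case (elim x)
      have "(\<integral>\<^sup>+y. ennreal (norm (f x * (g y * h (v - x - y)))) \<partial>lborel)
          = ennreal (norm (f x)) * (\<integral>\<^sup>+y. ennreal (norm (g y * h (v - x - y))) \<partial>lborel)"
        by (subst nn_integral_cmult[symmetric]) (auto simp: norm_mult ennreal_mult)
      also have "\<dots> \<le> Kf x * nnconv Kg Kh (v - x)"
        using elim f by (intro mult_mono nn_integral_norm_le_nnconv g h) (auto simp: majorized_def)
      finally show ?case .
    qed
  qed
  with fin have "(\<integral>\<^sup>+x. \<integral>\<^sup>+y. ennreal (norm (f x * (g y * h (v - x - y)))) \<partial>lborel \<partial>lborel) < \<infinity>"
    by (rule le_less_trans[rotated])
  then have "integrable (lborel \<Otimes>\<^sub>M lborel) (\<lambda>(x, y). f x * (g y * h (v - x - y)))"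
    by (intro integrableI_bounded) (simp_all add: lborel.nn_integral_fst[symmetric] split_beta)
  from lborel_pair.Fubini_integral[OF this]
  have "(\<integral>y. \<integral>x. f x * (g y * h (v - x - y)) \<partial>lborel \<partial>lborel)
      = (\<integral>x. \<integral>y. f x * (g y * h (v - x - y)) \<partial>lborel \<partial>lborel)" .
  also have "\<dots> = conv f (conv g h) v" unfolding conv_def by simp
  also have "(\<integral>y. \<integral>x. f x * (g y * h (v - x - y)) \<partial>lborel \<partial>lborel)
      = (\<integral>y. \<integral>x. g y * (f x * h (v - y - x)) \<partial>lborel \<partial>lborel)"
    by (intro Bochner_Integration.integral_cong refl) (simp add: algebra_simps)
  also have "\<dots> = conv g (conv f h) v" unfolding conv_def by simp
  finally show ?thesis by (rule sym)
qed

text \<open>Commutativity turns left commutativity into associativity.\<close>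
lemma conv_assoc:
  assumes f: "majorized f Kf" and g: "majorized g Kg" and h: "majorized h Kh" and fin: "nnconv Kf (nnconv Kg Kh) v < \<infinity>"
  shows "conv (conv f g) h v = conv f (conv g h) v"
proof -
  note [measurable] = majorizedD[OF f] majorizedD[OF g] majorizedD[OF h]
  have fin': "nnconv Kh (nnconv Kf Kg) v < \<infinity>"
  proof -
    have "nnconv Kh (nnconv Kf Kg) v = nnconv Kf (nnconv Kh Kg) v" by (intro nnconv_left_commute) measurable
    also have "nnconv Kh Kg = nnconv Kg Kh" by (intro ext nnconv_commute) measurable
    finally show ?thesis using fin by simp
  qed
  have "conv (conv f g) h v = conv h (conv f g) v" by (rule conv_commute)
  also have "\<dots> = conv f (conv h g) v" using f g h fin' by (intro conv_left_commute)
  also have "conv h g = conv g h" by (intro ext conv_commute)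
  finally show ?thesis .
qed

lemma conv_lincomb_right:
  assumes "majorized h Kh" "majorized f Kf" "majorized g Kg" "nnconv Kh Kf v < \<infinity>" "nnconv Kh Kg v < \<infinity>"
  shows "conv h (\<lambda>x. a * f x + b * g x) v = a * conv h f v + b * conv h g v"
proof -
  have "conv h (\<lambda>x. a * f x + b * g x) v = (\<integral>x. a * (h x * f (v - x)) + b * (h x * g (v - x)) \<partial>lborel)"
    unfolding conv_def by (simp add: algebra_simps)
  also have "\<dots> = a * conv h f v + b * conv h g v"
    using assms by (simp add: conv_integrable conv_def)
  finally show ?thesis .
qed

lemma nnconv_cmult_right:
  assumes [measurable]: "f \<in> borel_measurable borel" "g \<in> borel_measurable borel"
  shows "nnconv f (\<lambda>x. c * g x) v = c * nnconv f g v"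
  unfolding nnconv_def by (subst nn_integral_cmult[symmetric]) (auto simp: mult.left_commute)

text \<open>The convolution has no unit among functions, whence the separate clause for singletons; the value for the
  empty list is a default.\<close>
fun iconv :: "('k \<Rightarrow> real \<Rightarrow> complex) \<Rightarrow> 'k list \<Rightarrow> real \<Rightarrow> complex" where
  "iconv f [] = (\<lambda>_. 0)"
| "iconv f [k] = f k"
| "iconv f (k # l # ks) = conv (f k) (iconv f (l # ks))"

fun iconv_nn :: "('k \<Rightarrow> real \<Rightarrow> ennreal) \<Rightarrow> 'k list \<Rightarrow> real \<Rightarrow> ennreal" where
  "iconv_nn f [] = (\<lambda>_. 0)"
| "iconv_nn f [k] = f k"
| "iconv_nn f (k # l # ks) = nnconv (f k) (iconv_nn f (l # ks))"

lemma iconv_Cons: "ks \<noteq> [] \<Longrightarrow> iconv f (k # ks) = conv (f k) (iconv f ks)"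
  by (cases ks) auto

lemma iconv_nn_Cons: "ks \<noteq> [] \<Longrightarrow> iconv_nn f (k # ks) = nnconv (f k) (iconv_nn f ks)"
  by (cases ks) auto

lemma majorized_iconv: "(\<And>k. k \<in> set ks \<Longrightarrow> majorized (f k) (K k)) \<Longrightarrow> majorized (iconv f ks) (iconv_nn K ks)"
  by (induction f ks rule: iconv.induct) (auto intro: majorized_conv simp: majorized_def[of "\<lambda>_. 0"])

lemma iconv_cong: "(\<And>k. k \<in> set ks \<Longrightarrow> f k = g k) \<Longrightarrow> iconv f ks = iconv g ks"
  by (induction f ks rule: iconv.induct) auto

text \<open>
  The separation condition relates different members only: in the application \<open>A k \<le> b k\<close> may
  happen for one \<open>k\<close>.
\<close>
locale tame_family =
  fixes I :: "'k set" and K :: "'k \<Rightarrow> real \<Rightarrow> ennreal" and b A :: "'k \<Rightarrow> real"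
  assumes tame_K: "k \<in> I \<Longrightarrow> tame (b k) (A k) (K k)"
    and b_less_A: "i \<in> I \<Longrightarrow> j \<in> I \<Longrightarrow> i \<noteq> j \<Longrightarrow> b i < A j"
begin

text \<open>
  The rates of an iterated convolution are the worst ones of its members, up to an arbitrarily small
  loss. Quantifying over all strictly worse rates \<open>p\<close> and \<open>q\<close> makes the induction pass: the rates for
  the shorter list can be chosen between its worst rate and the conditions imposed by the next member.
\<close>
lemma tame_iconv_nn:
  assumes "distinct ks" "ks \<noteq> []" "set ks \<subseteq> I" "\<And>k. k \<in> set ks \<Longrightarrow> b k < p" "\<And>k. k \<in> set ks \<Longrightarrow> q < A k"
  shows "tame p q (iconv_nn K ks)"
  using assms
proof (induction ks arbitrary: p q)
  case (Cons k ks)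
  show ?case
  proof (cases "ks = []")
    case True
    with Cons.prems tame_K[of k] show ?thesis by (auto intro: tame_mono)
  next
    case False
    have "Max (b ` set ks) < min p (A k)" using False Cons.prems by (auto intro!: b_less_A)
    then obtain p' where p': "Max (b ` set ks) < p'" "p' < min p (A k)" using dense by blast
    have "max q (b k) < Min (A ` set ks)" using False Cons.prems by (auto intro!: b_less_A)
    then obtain q' where q': "max q (b k) < q'" "q' < Min (A ` set ks)" using dense by blast
    have ks: "tame p' q' (iconv_nn K ks)" using p' q' False Cons.prems by (intro Cons.IH) auto
    have k: "tame (b k) (A k) (K k)" using Cons.prems by (auto intro: tame_K)
    have "tame p q (nnconv (K k) (iconv_nn K ks))"
      using p' q' Cons.prems by (intro tame_nnconv[OF k ks]) auto
    then show ?thesis using False by (simp add: iconv_nn_Cons)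
  qed
qed simp

lemma iconv_nn_finite:
  assumes "distinct ks" "set ks \<subseteq> I" "v \<noteq> 0"
  shows "iconv_nn K ks v < \<infinity>"
proof (cases "ks = []")
  case False
  define p where "p = Max (b ` set ks) + 1"
  define q where "q = Min (A ` set ks) - 1"
  have "b k < p" if "k \<in> set ks" for k
  proof -
    have "b k \<le> Max (b ` set ks)" using that by (intro Max_ge) auto
    then show ?thesis by (simp add: p_def)
  qed
  moreover have "q < A k" if "k \<in> set ks" for k
  proof -
    have "Min (A ` set ks) \<le> A k" using that by (intro Min_le) auto
    then show ?thesis by (simp add: q_def)
  qed
  ultimately have "tame p q (iconv_nn K ks)" using assms False by (intro tame_iconv_nn)
  then show ?thesis using assms(3) by (rule tame_finite)
qed simp

text \<open>
  Reordering is valid pointwise, not just almost everywhere, because all the convolutions of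
  majorants are finite away from \<open>0\<close>.
\<close>
lemma iconv_front:
  assumes f: "\<And>k. k \<in> I \<Longrightarrow> majorized (f k) (K k)"
    and "distinct (xs @ k # ys)" "set (xs @ k # ys) \<subseteq> I" "v \<noteq> 0"
  shows "iconv f (xs @ k # ys) v = iconv f (k # xs @ ys) v"
  using assms(2-)
proof (induction xs arbitrary: v)
  case (Cons x xs)
  have m: "majorized (iconv f zs) (iconv_nn K zs)" if "set zs \<subseteq> I" for zs
    using that f by (intro majorized_iconv) auto
  have mx: "majorized (f x) (K x)" and mk: "majorized (f k) (K k)" using Cons.prems f by auto
  have "iconv f ((x # xs) @ k # ys) v = conv (f x) (iconv f (xs @ k # ys)) v"
    by (simp add: iconv_Cons)
  also have "\<dots> = conv (f x) (iconv f (k # xs @ ys)) v"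
    using Cons mx m[of "xs @ k # ys"] m[of "k # xs @ ys"]
    by (intro conv_cong Cons.IH) (auto simp: majorizedD)
  also have "\<dots> = iconv f (k # (x # xs) @ ys) v"
  proof (cases "xs @ ys = []")
    case True
    then show ?thesis by (simp add: conv_commute)
  next
    case False
    have "iconv_nn K (x # k # xs @ ys) v < \<infinity>" using Cons.prems by (intro iconv_nn_finite) auto
    then have "conv (f x) (conv (f k) (iconv f (xs @ ys))) v = conv (f k) (conv (f x) (iconv f (xs @ ys))) v"
      using False Cons.prems by (intro conv_left_commute[OF mx mk m]) (auto simp: iconv_nn_Cons)
    then show ?thesis using False by (simp add: iconv_Cons)
  qed
  finally show ?case .
qed simp

lemma iconv_perm:
  assumes f: "\<And>k. k \<in> I \<Longrightarrow> majorized (f k) (K k)"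
    and "mset xs = mset ys" "distinct xs" "set xs \<subseteq> I" "v \<noteq> 0"
  shows "iconv f xs v = iconv f ys v"
  using assms(2-)
proof (induction xs arbitrary: ys v)
  case (Cons x xs)
  then have "x \<in> set ys" by (metis list.set_intros(1) mset_eq_setD)
  then obtain ys1 ys2 where ys: "ys = ys1 @ x # ys2" by (meson split_list)
  have eq: "mset xs = mset (ys1 @ ys2)" using Cons.prems ys by simp
  have d: "distinct ys" "set ys \<subseteq> I"
    using Cons.prems by (metis mset_eq_imp_distinct_iff, metis mset_eq_setD)
  have "iconv f ys v = iconv f (x # ys1 @ ys2) v"
    unfolding ys using d Cons.prems f unfolding ys by (intro iconv_front) auto
  also have "\<dots> = iconv f (x # xs) v"
  proof (cases "xs = []")
    case True
    then show ?thesis using eq by simp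
  next
    case False
    then have "ys1 @ ys2 \<noteq> []" using eq by (metis mset_zero_iff)
    moreover have "conv (f x) (iconv f (ys1 @ ys2)) v = conv (f x) (iconv f xs) v"
    proof (intro conv_cong)
      show "iconv f (ys1 @ ys2) y = iconv f xs y" if "y \<noteq> 0" for y
        using Cons eq that by (intro Cons.IH[symmetric]) auto
      show "f x \<in> borel_measurable borel" using Cons.prems by (intro majorizedD(1)[OF f]) auto
      show "iconv f xs \<in> borel_measurable borel"
        using Cons.prems f by (intro majorizedD(1)[OF majorized_iconv[of xs f K]]) auto
      show "iconv f (ys1 @ ys2) \<in> borel_measurable borel"
        using d f by (intro majorizedD(1)[OF majorized_iconv[of "ys1 @ ys2" f K]]) (auto simp: ys)
    qed
    ultimately show ?thesis using False by (simp add: iconv_Cons)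
  qed
  finally show ?case by simp
qed simp

end

section \<open>The kernels in logarithmic coordinates\<close>

text \<open>
  The three components of the line without the points \<open>0\<close> and \<open>1\<close>, in which the ratio of two
  consecutive coordinates can lie.
\<close>
datatype piece = Inner | Outer | Negative

fun piece_sign :: "piece \<Rightarrow> real" where
  "piece_sign Inner = 1" | "piece_sign Outer = 1" | "piece_sign Negative = -1"

fun region :: "piece \<Rightarrow> real set" where
  "region Inner = {0<..<1}" | "region Outer = {1<..}" | "region Negative = {..<0}"

text \<open>
  The function \<open>\<bar>r\<bar> powr (- b) * \<bar>1 - r\<bar> powr (b - a - 1)\<close> of a ratio \<open>r\<close>, restricted to one component
  and written in the coordinate \<open>y = ln \<bar>r\<bar>\<close>.
\<close>
definition ker :: "piece \<Rightarrow> complex \<Rightarrow> complex \<Rightarrow> real \<Rightarrow> complex" where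
  "ker L a b y = (if piece_sign L * exp y \<in> region L
     then exp (- b * of_real y + (b - a - 1) * of_real (ln \<bar>1 - piece_sign L * exp y\<bar>)) else 0)"

text \<open>
  One bound serves for all pieces and, in addition, for the analytic continuation to the strip
  \<open>\<bar>Im y\<bar> \<le> \<pi>\<close>: there \<open>\<bar>1 - exp y\<bar>\<close> lies between \<open>\<bar>1 - exp x\<bar>\<close> and \<open>1 + exp x\<close>, which covers both signs of
  the exponent, while the first factor bounds the contribution of the arguments.
\<close>
definition ker_bound :: "complex \<Rightarrow> complex \<Rightarrow> real \<Rightarrow> real" where
  "ker_bound a b x = exp (pi * \<bar>Im b\<bar> + pi * \<bar>Im (b - a)\<bar>) *
     (exp (- Re b * x) * (exp ((Re (b - a) - 1) * ln \<bar>1 - exp x\<bar>) + exp ((Re (b - a) - 1) * ln (1 + exp x))))"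

lemma ker_bound_nonneg [simp]: "ker_bound a b x \<ge> 0"
  by (simp add: ker_bound_def)

lemma ker_bound_measurable [measurable]: "ker_bound a b \<in> borel_measurable borel"
  unfolding ker_bound_def[abs_def] by measurable

lemma region_measurable [measurable]: "region L \<in> sets borel"
  by (cases L) auto

lemma ker_measurable [measurable]: "ker L a b \<in> borel_measurable borel"
  unfolding ker_def[abs_def] by measurable

lemma norm_ker_le: "norm (ker L a b x) \<le> ker_bound a b x"
proof (cases "piece_sign L * exp x \<in> region L")
  case True
  let ?m = "Re (b - a) - 1"
  let ?s = "exp (?m * ln \<bar>1 - exp x\<bar>) + exp (?m * ln (1 + exp x))"
  have "norm (ker L a b x) = exp (- Re b * x) * exp (?m * ln \<bar>1 - piece_sign L * exp x\<bar>)"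
    using True by (simp add: ker_def flip: exp_add)
  also have "exp (?m * ln \<bar>1 - piece_sign L * exp x\<bar>) \<le> ?s"
  proof (cases L)
    case Negative
    have "\<bar>1 + exp x\<bar> = 1 + exp x" by (simp add: add_pos_pos abs_of_pos)
    then show ?thesis using Negative by simp
  qed simp_all
  also have "exp (- Re b * x) * ?s \<le> ker_bound a b x"
  proof -
    have "1 * (exp (- Re b * x) * ?s) \<le> exp (pi * \<bar>Im b\<bar> + pi * \<bar>Im (b - a)\<bar>) * (exp (- Re b * x) * ?s)"
      by (intro mult_right_mono) (auto simp: add_nonneg_nonneg)
    then show ?thesis unfolding ker_bound_def by (simp only: mult_1)
  qed
  finally show ?thesis by (simp add: mult_left_mono)
qed (simp add: ker_def)

lemma majorized_ker: "majorized (ker L a b) (\<lambda>x. ennreal (ker_bound a b x))"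
  using norm_ker_le by (auto simp: majorized_def ennreal_leI)

text \<open>What remains of the bound after its exponential rates are split off; it depends on \<open>\<bar>x\<bar>\<close> only.\<close>
definition profile :: "real \<Rightarrow> real \<Rightarrow> real" where
  "profile m t = exp (m * ln (1 - exp (- t))) + exp (m * ln (1 + exp (- t)))"

lemma ker_bound_eq:
  assumes "x \<noteq> 0"
  shows "ker_bound a b x = exp (pi * \<bar>Im b\<bar> + pi * \<bar>Im (b - a)\<bar>) * (decay (Re b) (Re a + 1) x * profile (Re (b - a) - 1) \<bar>x\<bar>)"
proof (cases "x < 0")
  case True
  then show ?thesis by (simp add: ker_bound_def decay_def profile_def)
next
  case False
  then have x: "x > 0" using assms by simp
  have "\<bar>1 - exp x\<bar> = exp x * (1 - exp (- x))" "1 + exp x = exp x * (1 + exp (- x))"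
    using x by (simp_all add: algebra_simps flip: exp_add)
  moreover have "ln (exp x * (1 - exp (- x))) = x + ln (1 - exp (- x))"
    "ln (exp x * (1 + exp (- x))) = x + ln (1 + exp (- x))"
    using x by (simp_all add: ln_mult_pos add_pos_pos)
  ultimately have ln: "ln \<bar>1 - exp x\<bar> = x + ln (1 - exp (- x))" "ln (1 + exp x) = x + ln (1 + exp (- x))"
    by simp_all
  have "decay (Re b) (Re a + 1) x = exp (- Re b * x) * exp ((Re (b - a) - 1) * x)"
    using x by (simp add: decay_def algebra_simps flip: exp_add)
  moreover have "exp ((Re (b - a) - 1) * (x + l)) = exp ((Re (b - a) - 1) * x) * exp ((Re (b - a) - 1) * l)" for l
    by (simp only: distrib_left exp_add)
  moreover have "\<bar>x\<bar> = x" using x by simp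
  ultimately show ?thesis unfolding ker_bound_def ln profile_def by (simp only: distrib_left mult.assoc)
qed

lemma profile_bound:
  assumes "0 < d" "d \<le> t"
  shows "profile m t \<le> exp (\<bar>m\<bar> * \<bar>ln (1 - exp (- d))\<bar>) + exp (\<bar>m\<bar> * ln 2)"
proof -
  have 1: "\<bar>ln (1 - exp (- t))\<bar> \<le> \<bar>ln (1 - exp (- d))\<bar>"
  proof -
    have "ln (1 - exp (- d)) \<le> ln (1 - exp (- t))" using assms by (intro ln_mono) auto
    moreover have "ln (1 - exp (- t)) \<le> 0" using assms by simp
    ultimately show ?thesis by simp
  qed
  have 2: "\<bar>ln (1 + exp (- t))\<bar> \<le> ln 2"
  proof -
    have "ln (1 + exp (- t)) \<le> ln 2" using assms by (intro ln_mono) (auto simp: add_pos_pos)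
    moreover have "ln (1 + exp (- t)) \<ge> 0" by (simp add: ln_ge_zero)
    ultimately show ?thesis by simp
  qed
  have "m * ln (1 - exp (- t)) \<le> \<bar>m\<bar> * \<bar>ln (1 - exp (- d))\<bar>"
    using mult_left_mono[OF 1, of "\<bar>m\<bar>"] abs_ge_self[of "m * ln (1 - exp (- t))"] by (simp add: abs_mult)
  moreover have "m * ln (1 + exp (- t)) \<le> \<bar>m\<bar> * ln 2"
    using mult_left_mono[OF 2, of "\<bar>m\<bar>"] abs_ge_self[of "m * ln (1 + exp (- t))"] by (simp add: abs_mult)
  ultimately show ?thesis unfolding profile_def by (intro add_mono) simp_all
qed

lemma profile_bound_0:
  assumes "0 < t" "t < 1"
  shows "profile m t \<le> 1 + exp \<bar>m\<bar> + exp \<bar>m\<bar> * t powr m"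
proof -
  have 2: "\<bar>ln (1 + exp (- t))\<bar> \<le> 1"
  proof -
    have "ln (1 + exp (- t)) \<le> exp (- t)" by (rule ln_add_one_self_le_self) simp
    also have "\<dots> \<le> 1" using assms by simp
    finally have "ln (1 + exp (- t)) \<le> 1" .
    moreover have "ln (1 + exp (- t)) \<ge> 0" by (simp add: ln_ge_zero)
    ultimately show ?thesis by simp
  qed
  have "m * ln (1 + exp (- t)) \<le> \<bar>m\<bar>"
    using mult_left_mono[OF 2, of "\<bar>m\<bar>"] abs_ge_self[of "m * ln (1 + exp (- t))"] by (simp add: abs_mult)
  then have A: "exp (m * ln (1 + exp (- t))) \<le> exp \<bar>m\<bar>" by simp
  have B: "exp (m * ln (1 - exp (- t))) \<le> 1 + exp \<bar>m\<bar> * t powr m"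
  proof (cases "m \<ge> 0")
    case True
    have "ln (1 - exp (- t)) \<le> 0" using assms by simp
    then have "m * ln (1 - exp (- t)) \<le> 0" using True by (simp add: mult_nonneg_nonpos)
    then have "exp (m * ln (1 - exp (- t))) \<le> 1" by simp
    then show ?thesis by (simp add: add_increasing2)
  next
    case False
    have "t \<le> exp t - 1" using exp_ge_add_one_self[of t] by linarith
    then have "exp (- t) * t \<le> exp (- t) * (exp t - 1)" by (intro mult_left_mono) auto
    also have "\<dots> = 1 - exp (- t)" by (simp add: algebra_simps flip: exp_add)
    finally have "ln (exp (- t) * t) \<le> ln (1 - exp (- t))" using assms by (intro ln_mono) auto
    then have "ln t - 1 \<le> ln (1 - exp (- t))" using assms by (simp add: ln_mult_pos)
    then have "m * ln (1 - exp (- t)) \<le> m * (ln t - 1)" using False by (intro mult_left_mono_neg) auto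
    then have "exp (m * ln (1 - exp (- t))) \<le> exp (\<bar>m\<bar> + m * ln t)" using False by (simp add: algebra_simps)
    also have "\<dots> = exp \<bar>m\<bar> * t powr m" using assms by (simp add: exp_add powr_def)
    finally show ?thesis by simp
  qed
  show ?thesis unfolding profile_def using add_mono[OF B A] by simp
qed

lemma nn_integral_powr_local:
  assumes "m > (-1::real)"
  shows "(\<integral>\<^sup>+x. ennreal (\<bar>x\<bar> powr m) * indicator {-1<..<1} x \<partial>lborel) < \<infinity>"
proof (rule nn_integral_even_finite)
  have "((\<lambda>x. x powr m) has_integral (1 powr (m + 1) / (m + 1))) {0..1::real}"
    using has_integral_powr_from_0[of m 1] assms by simp
  from nn_integral_has_integral_lebesgue'[OF _ this]
  have "(\<integral>\<^sup>+x. ennreal (x powr m) * indicator {0..1} x \<partial>lborel) < \<infinity>" by simp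
  moreover have "(\<integral>\<^sup>+x. ennreal (\<bar>x\<bar> powr m) * indicator {-1<..<1} x * indicator {0..} x \<partial>lborel)
      \<le> (\<integral>\<^sup>+x. ennreal (x powr m) * indicator {0..1} x \<partial>lborel)"
    by (intro nn_integral_mono) (auto simp: indicator_def)
  ultimately show "(\<integral>\<^sup>+x. ennreal (\<bar>x\<bar> powr m) * indicator {-1<..<1} x * indicator {0..} x \<partial>lborel) < \<infinity>"
    by (rule le_less_trans[rotated])
qed (auto simp: indicator_def)

text \<open>The hypothesis says that the exponent of \<open>\<bar>1 - r\<bar>\<close> exceeds \<open>-1\<close>.\<close>
lemma tame_ker_bound:
  assumes "Re (b - a) > 0"
  shows "tame (Re b) (Re a + 1) (\<lambda>x. ennreal (ker_bound a b x))"
proof (rule tameI)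
  define m where "m = Re (b - a) - 1"
  define c where "c = exp (pi * \<bar>Im b\<bar> + pi * \<bar>Im (b - a)\<bar>)"
  have c: "c > 0" by (simp add: c_def)
  have m: "m > -1" using assms by (simp add: m_def)
  have eq: "ker_bound a b x = c * (decay (Re b) (Re a + 1) x * profile m \<bar>x\<bar>)" if "x \<noteq> 0" for x
    unfolding c_def m_def using that by (rule ker_bound_eq)
  show "(\<lambda>x. ennreal (ker_bound a b x)) \<in> borel_measurable borel" by measurable
  show "\<exists>C\<ge>0. \<forall>x. \<bar>x\<bar> \<ge> d \<longrightarrow> ennreal (ker_bound a b x) \<le> ennreal (C * decay (Re b) (Re a + 1) x)"
    if d: "d > 0" for d
  proof (intro exI conjI allI impI)
    let ?C = "c * (exp (\<bar>m\<bar> * \<bar>ln (1 - exp (- d))\<bar>) + exp (\<bar>m\<bar> * ln 2))"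
    show "?C \<ge> 0" using c by (intro mult_nonneg_nonneg) (auto simp: add_nonneg_nonneg)
    fix x assume x: "\<bar>x\<bar> \<ge> d"
    then have "ker_bound a b x = c * (decay (Re b) (Re a + 1) x * profile m \<bar>x\<bar>)" using d by (intro eq) auto
    also have "\<dots> \<le> c * (decay (Re b) (Re a + 1) x * (exp (\<bar>m\<bar> * \<bar>ln (1 - exp (- d))\<bar>) + exp (\<bar>m\<bar> * ln 2)))"
      using c d x by (intro mult_left_mono profile_bound) auto
    finally show "ennreal (ker_bound a b x) \<le> ennreal (?C * decay (Re b) (Re a + 1) x)"
      by (intro ennreal_leI) (simp add: mult_ac)
  qed
  show "(0::real) < 1" by simp
  let ?W = "exp (\<bar>Re b\<bar> + \<bar>Re a + 1\<bar>)"
  let ?D = "c * ?W * (1 + exp \<bar>m\<bar>)" and ?E = "c * ?W * exp \<bar>m\<bar>"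
  have "(\<integral>\<^sup>+x. ennreal (ker_bound a b x) * indicator {-1<..<1} x \<partial>lborel)
      \<le> (\<integral>\<^sup>+x. ennreal ?D * indicator {-1<..<1} x + ennreal ?E * (ennreal (\<bar>x\<bar> powr m) * indicator {-1<..<1} x) \<partial>lborel)"
  proof (rule nn_integral_mono_AE)
    show "AE x in lborel. ennreal (ker_bound a b x) * indicator {-1<..<1} x
      \<le> ennreal ?D * indicator {-1<..<1} x + ennreal ?E * (ennreal (\<bar>x\<bar> powr m) * indicator {-1<..<1} x)"
      using AE_lborel_neq[of 0]
    proof eventually_elim
      case (elim x)
      show ?case
      proof (cases "x \<in> {-1<..<1}")
        case True
        then have x: "0 < \<bar>x\<bar>" "\<bar>x\<bar> < 1" using elim by auto
        have "decay (Re b) (Re a + 1) x \<le> exp ((\<bar>Re b\<bar> + \<bar>Re a + 1\<bar>) * \<bar>x\<bar>)" by (rule decay_bounded)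
        also have "\<dots> \<le> ?W" using x by (simp add: mult_left_le)
        finally have W: "decay (Re b) (Re a + 1) x \<le> ?W" .
        have pnn: "profile m \<bar>x\<bar> \<ge> 0" by (simp add: profile_def add_nonneg_nonneg)
        have "ker_bound a b x = c * (decay (Re b) (Re a + 1) x * profile m \<bar>x\<bar>)" using elim by (rule eq)
        also have "\<dots> \<le> c * (?W * (1 + exp \<bar>m\<bar> + exp \<bar>m\<bar> * \<bar>x\<bar> powr m))"
          using c W x pnn by (intro mult_left_mono mult_mono profile_bound_0) auto
        also have "\<dots> = ?D + ?E * \<bar>x\<bar> powr m" by (simp add: algebra_simps)
        finally have "ennreal (ker_bound a b x) \<le> ennreal (?D + ?E * \<bar>x\<bar> powr m)" by (rule ennreal_leI)
        also have "\<dots> = ennreal ?D + ennreal ?E * ennreal (\<bar>x\<bar> powr m)"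
          using c by (subst ennreal_plus) (auto simp: ennreal_mult add_nonneg_nonneg)
        finally show ?thesis using True by simp
      qed simp
    qed
  qed
  also have "\<dots> = ennreal ?D * 2 + ennreal ?E * (\<integral>\<^sup>+x. ennreal (\<bar>x\<bar> powr m) * indicator {-1<..<1} x \<partial>lborel)"
    by (simp add: nn_integral_add nn_integral_cmult)
  also have "\<dots> < \<infinity>" using nn_integral_powr_local[OF m] by (simp add: ennreal_mult_less_top)
  finally show "(\<integral>\<^sup>+x. ennreal (ker_bound a b x) * indicator {-1<..<1} x \<partial>lborel) < \<infinity>" .
qed

section \<open>Moving the line of integration across a strip\<close>

text \<open>
  On the strips \<open>0 < Im y < \<pi>\<close> and \<open>- \<pi> < Im y < 0\<close> the number \<open>1 - exp y\<close> avoids the branch cut, so that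
  the principal logarithm gives a holomorphic continuation of the kernel from negative \<open>y\<close>.
\<close>
definition strip_ker :: "complex \<Rightarrow> complex \<Rightarrow> complex \<Rightarrow> complex" where
  "strip_ker a b y = exp (- b * y + (b - a - 1) * Ln (1 - exp y))"

lemma strip_ker_norm_le:
  assumes "x \<noteq> 0" "\<bar>\<eta>\<bar> \<le> pi"
  shows "norm (strip_ker a b (Complex x \<eta>)) \<le> ker_bound a b x"
proof -
  define w where "w = 1 - exp (Complex x \<eta>)"
  define m where "m = Re (b - a) - 1"
  have nx: "norm (exp (Complex x \<eta>)) = exp x" by simp
  have low: "\<bar>1 - exp x\<bar> \<le> norm w"
    using norm_triangle_ineq3[of 1 "exp (Complex x \<eta>)"] nx by (simp add: w_def)
  have up: "norm w \<le> 1 + exp x"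
    using norm_triangle_ineq4[of 1 "exp (Complex x \<eta>)"] nx by (simp add: w_def)
  have pos: "\<bar>1 - exp x\<bar> > 0" using assms(1) by simp
  then have w0: "w \<noteq> 0" using low by auto
  have "Re (Ln w) = ln (norm w)" using w0 by simp
  moreover have "\<bar>Im (Ln w)\<bar> \<le> pi" using mpi_less_Im_Ln[OF w0] Im_Ln_le_pi[OF w0] by simp
  ultimately have ReL: "Re ((b - a - 1) * Ln w) \<le> m * ln (norm w) + pi * \<bar>Im (b - a)\<bar>"
  proof -
    assume L: "Re (Ln w) = ln (norm w)" "\<bar>Im (Ln w)\<bar> \<le> pi"
    have "- (Im (b - a) * Im (Ln w)) \<le> \<bar>Im (b - a)\<bar> * pi"
      using abs_ge_minus_self[of "Im (b - a) * Im (Ln w)"] mult_left_mono[OF L(2), of "\<bar>Im (b - a)\<bar>"]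
      by (simp add: abs_mult)
    then show ?thesis by (simp add: L(1) m_def algebra_simps)
  qed
  have "exp (m * ln (norm w)) \<le> exp (m * ln \<bar>1 - exp x\<bar>) + exp (m * ln (1 + exp x))"
  proof (cases "m \<ge> 0")
    case True
    then have "m * ln (norm w) \<le> m * ln (1 + exp x)" using w0 up by (intro mult_left_mono ln_mono) (auto simp: add_pos_pos)
    then have "exp (m * ln (norm w)) \<le> exp (m * ln (1 + exp x))" by simp
    then show ?thesis by (simp add: add_increasing)
  next
    case False
    then have "m * ln (norm w) \<le> m * ln \<bar>1 - exp x\<bar>" using pos low by (intro mult_left_mono_neg ln_mono) auto
    then have "exp (m * ln (norm w)) \<le> exp (m * ln \<bar>1 - exp x\<bar>)" by simp
    then show ?thesis by (simp add: add_increasing2)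
  qed
  note S = this
  have "Im b * \<eta> \<le> pi * \<bar>Im b\<bar>"
    using abs_ge_self[of "Im b * \<eta>"] mult_left_mono[OF assms(2), of "\<bar>Im b\<bar>"] by (simp add: abs_mult mult.commute)
  then have "norm (strip_ker a b (Complex x \<eta>)) \<le> exp (pi * \<bar>Im b\<bar> + pi * \<bar>Im (b - a)\<bar> + (- Re b * x + m * ln (norm w)))"
    using ReL by (simp add: strip_ker_def w_def)
  also have "\<dots> = exp (pi * \<bar>Im b\<bar> + pi * \<bar>Im (b - a)\<bar>) * (exp (- Re b * x) * exp (m * ln (norm w)))"
    by (simp only: exp_add)
  also have "\<dots> \<le> ker_bound a b x"
    unfolding ker_bound_def m_def[symmetric] using S by (intro mult_left_mono) auto
  finally show ?thesis .
qed

lemma one_minus_exp_notin: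
  assumes "sin (Im y) \<noteq> 0" shows "1 - exp y \<notin> \<real>\<^sub>\<le>\<^sub>0"
  using assms by (auto simp: complex_nonpos_Reals_iff Im_exp)

lemma strip_ker_holomorphic: "strip_ker a b holomorphic_on {y. sin (Im y) \<noteq> 0}"
  unfolding strip_ker_def[abs_def] by (intro holomorphic_intros) (auto dest: one_minus_exp_notin)

text \<open>
  For \<open>x > 0\<close> the number \<open>1 - exp y\<close> tends to the branch cut from the side opposite to \<open>Im y\<close>,
  which produces the phase in front of the outer kernel.
\<close>
lemma strip_ker_lim_0:
  assumes "\<sigma> \<in> {1, -1::real}" "e \<longlonglongrightarrow> 0" "\<And>k. 0 < e k" "\<And>k. e k < pi" "x \<noteq> 0"
  shows "(\<lambda>k. strip_ker a b (Complex x (\<sigma> * e k))) \<longlonglongrightarrow>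
    ker Inner a b x + exp (- of_real \<sigma> * \<i> * pi * (b - a - 1)) * ker Outer a b x"
proof -
  have cl: "(\<lambda>k. Complex x (\<sigma> * e k)) \<longlonglongrightarrow> complex_of_real x"
    using tendsto_Complex[OF tendsto_const tendsto_mult[OF tendsto_const assms(2)], of x \<sigma>]
    by (simp add: complex_of_real_def)
  show ?thesis
  proof (cases "x < 0")
    case True
    have "1 - exp (complex_of_real x) \<notin> \<real>\<^sub>\<le>\<^sub>0"
      using True by (simp add: complex_nonpos_Reals_iff Re_exp)
    then have "(\<lambda>k. strip_ker a b (Complex x (\<sigma> * e k))) \<longlonglongrightarrow> strip_ker a b (complex_of_real x)"
      unfolding strip_ker_def by (intro tendsto_intros cl)
    moreover have "strip_ker a b (complex_of_real x) = ker Inner a b x"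
    proof -
      have "1 - exp (complex_of_real x) = complex_of_real (1 - exp x)" by (simp flip: exp_of_real)
      moreover have "1 - exp x > 0" using True by simp
      ultimately have "Ln (1 - exp (complex_of_real x)) = complex_of_real (ln (1 - exp x))"
        by (simp only: Ln_of_real)
      then show ?thesis using True by (simp add: strip_ker_def ker_def)
    qed
    ultimately show ?thesis using True by (simp add: ker_def)
  next
    case False
    then have x: "x > 0" using assms by simp
    have Ln: "Ln (1 - exp (Complex x (\<sigma> * e k))) = Ln (exp (Complex x (\<sigma> * e k)) - 1) - of_real \<sigma> * \<i> * pi" for k
    proof -
      let ?z = "exp (Complex x (\<sigma> * e k)) - 1"
      have "sin (e k) > 0" using assms by (intro sin_gt_zero) auto
      then have "\<sigma> * Im ?z > 0" using assms(1) by (auto simp: Im_exp)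
      moreover from this have "?z \<noteq> 0" by auto
      ultimately have "Ln (- ?z) = Ln ?z - of_real \<sigma> * \<i> * pi"
        using assms(1) by (subst Ln_minus) auto
      then show ?thesis by simp
    qed
    have "exp (complex_of_real x) - 1 \<notin> \<real>\<^sub>\<le>\<^sub>0"
      using x by (simp add: complex_nonpos_Reals_iff Re_exp)
    then have "(\<lambda>k. strip_ker a b (Complex x (\<sigma> * e k))) \<longlonglongrightarrow>
      exp (- b * complex_of_real x + (b - a - 1) * (Ln (exp (complex_of_real x) - 1) - of_real \<sigma> * \<i> * pi))"
      unfolding strip_ker_def Ln by (intro tendsto_intros cl)
    also have "Ln (exp (complex_of_real x) - 1) = complex_of_real (ln (exp x - 1))"
    proof -
      have "exp (complex_of_real x) - 1 = complex_of_real (exp x - 1)" by (simp flip: exp_of_real)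
      moreover have "exp x - 1 > 0" using x by simp
      ultimately show ?thesis by (simp only: Ln_of_real)
    qed
    also have "exp (- b * complex_of_real x + (b - a - 1) * (complex_of_real (ln (exp x - 1)) - of_real \<sigma> * \<i> * pi))
      = exp (- of_real \<sigma> * \<i> * pi * (b - a - 1)) * ker Outer a b x"
      using x by (simp add: ker_def algebra_simps flip: exp_add)
    finally show ?thesis using x by (simp add: ker_def)
  qed
qed

text \<open>Here \<open>exp y\<close> tends to a negative number, so the boundary value is the kernel for negative ratios.\<close>
lemma strip_ker_lim_pi:
  assumes "\<sigma> \<in> {1, -1::real}" "e \<longlonglongrightarrow> pi"
  shows "(\<lambda>k. strip_ker a b (Complex x (\<sigma> * e k))) \<longlonglongrightarrow> exp (- of_real \<sigma> * \<i> * pi * b) * ker Negative a b x"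
proof -
  have cl: "(\<lambda>k. Complex x (\<sigma> * e k)) \<longlonglongrightarrow> Complex x (\<sigma> * pi)"
    by (intro tendsto_intros assms)
  have E: "exp (Complex x (\<sigma> * pi)) = - complex_of_real (exp x)"
    using assms(1) by (auto simp: exp_eq_polar cis.ctr complex_eq_iff)
  have "1 - exp (Complex x (\<sigma> * pi)) = complex_of_real (1 + exp x)" using E by simp
  moreover have "1 + exp x > 0" by (simp add: add_pos_pos)
  ultimately have 1: "Ln (1 - exp (Complex x (\<sigma> * pi))) = complex_of_real (ln (1 + exp x))"
    and 2: "1 - exp (Complex x (\<sigma> * pi)) \<notin> \<real>\<^sub>\<le>\<^sub>0"
    by (simp_all only: Ln_of_real) (simp add: complex_nonpos_Reals_iff)
  have "(\<lambda>k. strip_ker a b (Complex x (\<sigma> * e k))) \<longlonglongrightarrow> strip_ker a b (Complex x (\<sigma> * pi))"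
    unfolding strip_ker_def using 2 by (intro tendsto_intros cl)
  also have "strip_ker a b (Complex x (\<sigma> * pi)) = exp (- of_real \<sigma> * \<i> * pi * b) * ker Negative a b x"
  proof -
    have "Complex x (\<sigma> * pi) = of_real x + \<sigma> * pi * \<i>" by (simp add: complex_eq_iff)
    moreover have "\<bar>1 + exp x\<bar> = 1 + exp x" by (simp add: add_pos_pos abs_of_pos)
    ultimately show ?thesis unfolding strip_ker_def 1 by (simp add: ker_def algebra_simps flip: exp_add)
  qed
  finally show ?thesis .
qed

lemma strip_ker_continuous_line:
  assumes "sin \<eta> \<noteq> 0"
  shows "continuous_on UNIV (\<lambda>x. strip_ker a b (Complex (c + d * x) (\<eta>)))"
proof (rule continuous_on_compose2[OF holomorphic_on_imp_continuous_on[OF strip_ker_holomorphic]])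
  show "continuous_on UNIV (\<lambda>x. Complex (c + d * x) \<eta>)" by (intro continuous_intros)
qed (use assms in auto)

text \<open>
  The parameters of a pair of kernels, under conditions which make every convolution of a
  piece of the first with a piece of the second converge.
\<close>
locale two_kernels =
  fixes a b c d :: complex
  assumes ab: "Re (b - a) > 0" and cd: "Re (d - c) > 0"
    and bc: "Re b < Re c + 1" and da: "Re d < Re a + 1"
begin

definition "gap = min (Re c + 1 - Re b) (Re a + 1 - Re d)"
definition "rate1 = max (Re b) (Re d) + gap"
definition "rate2 = min (Re a + 1) (Re c + 1) - gap"

lemma gap_pos: "gap > 0" using bc da by (simp add: gap_def)

lemma nnconv_ker_bound_finite:
  assumes "v \<noteq> 0"
  shows "nnconv (\<lambda>x. ennreal (ker_bound a b x)) (\<lambda>x. ennreal (ker_bound c d x)) v < \<infinity>"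
proof (rule tame_finite[OF _ assms])
  show "tame rate1 rate2 (nnconv (\<lambda>x. ennreal (ker_bound a b x)) (\<lambda>x. ennreal (ker_bound c d x)))"
    using gap_pos bc da by (intro tame_nnconv[OF tame_ker_bound[OF ab] tame_ker_bound[OF cd]])
      (auto simp: rate1_def rate2_def)
qed

lemma integrable_ker:
  "v \<noteq> 0 \<Longrightarrow> integrable lborel (\<lambda>x. ker L a b x * ker M c d (v - x))"
  by (rule conv_integrable[OF majorized_ker majorized_ker nnconv_ker_bound_finite])

lemma integrable_ker_bound:
  assumes "v \<noteq> 0"
  shows "integrable lborel (\<lambda>x. ker_bound a b x * ker_bound c d (v - x))"
proof (rule integrableI_bounded)
  show "(\<integral>\<^sup>+x. ennreal (norm (ker_bound a b x * ker_bound c d (v - x))) \<partial>lborel) < \<infinity>"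
    using nnconv_ker_bound_finite[OF assms] by (simp add: nnconv_def ennreal_mult)
qed simp

lemma ker_bound_mult_tendsto_0:
  "((\<lambda>x. ker_bound a b x * ker_bound c d (v - x)) \<longlongrightarrow> 0) at_infinity"
proof -
  obtain C where C: "C \<ge> 0" "\<And>x. \<bar>x\<bar> \<ge> 1 \<Longrightarrow> ennreal (ker_bound a b x) \<le> ennreal (C * decay (Re b) (Re a + 1) x)"
    by (rule tame_bound[OF tame_ker_bound[OF ab], of 1]) auto
  obtain D where D: "D \<ge> 0" "\<And>x. \<bar>x\<bar> \<ge> 1 \<Longrightarrow> ennreal (ker_bound c d x) \<le> ennreal (D * decay (Re d) (Re c + 1) x)"
    by (rule tame_bound[OF tame_ker_bound[OF cd], of 1]) auto
  have bound: "norm (ker_bound a b x * ker_bound c d (v - x)) \<le> C * D * decay rate1 rate2 v * exp (- gap * norm x)"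
    if "norm x \<ge> 1 + \<bar>v\<bar>" for x
  proof -
    have "ker_bound a b x \<le> C * decay (Re b) (Re a + 1) x"
      using C(2)[of x] C(1) that by (simp add: ennreal_le_iff)
    moreover have "ker_bound c d (v - x) \<le> D * decay (Re d) (Re c + 1) (v - x)"
      using D(2)[of "v - x"] D(1) that by (simp add: ennreal_le_iff)
    ultimately have "ker_bound a b x * ker_bound c d (v - x)
        \<le> (C * decay (Re b) (Re a + 1) x) * (D * decay (Re d) (Re c + 1) (v - x))"
      using C(1) by (intro mult_mono) auto
    also have "\<dots> = C * D * (decay (Re b) (Re a + 1) x * decay (Re d) (Re c + 1) (v - x))" by simp
    also have "\<dots> \<le> C * D * (exp (- gap * \<bar>x\<bar>) * decay rate1 rate2 v)"
      using C(1) D(1) gap_pos by (intro mult_left_mono decay_mult_le) (auto simp: rate1_def rate2_def gap_def)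
    finally show ?thesis by (simp add: mult_ac abs_mult)
  qed
  have lim: "((\<lambda>x::real. C * D * decay rate1 rate2 v * exp (- gap * norm x)) \<longlongrightarrow> 0) at_infinity"
  proof -
    have "filterlim (\<lambda>x::real. - gap * norm x) at_bot at_infinity"
      using gap_pos by (intro filterlim_tendsto_neg_mult_at_bot[OF tendsto_const _ filterlim_norm_at_top]) auto
    from filterlim_compose[OF exp_at_bot this]
    have "((\<lambda>x::real. C * D * decay rate1 rate2 v * exp (- gap * norm x)) \<longlongrightarrow> C * D * decay rate1 rate2 v * 0) at_infinity"
      by (intro tendsto_intros)
    then show ?thesis by simp
  qed
  show ?thesis
  proof (rule Lim_null_comparison[OF _ lim])
    show "\<forall>\<^sub>F x in at_infinity. norm (ker_bound a b x * ker_bound c d (v - x)) \<le> C * D * decay rate1 rate2 v * exp (- gap * norm x)"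
      unfolding eventually_at_infinity using bound by blast
  qed
qed

text \<open>When \<open>y\<close> lies in the upper strip, \<open>v - y\<close> lies in the lower one, and the product is holomorphic.\<close>
definition strip_fun :: "real \<Rightarrow> complex \<Rightarrow> complex" where
  "strip_fun v y = strip_ker a b y * strip_ker c d (of_real v - y)"

lemma strip_fun_Complex: "strip_fun v (Complex x \<eta>) = strip_ker a b (Complex x \<eta>) * strip_ker c d (Complex (v - x) (- \<eta>))"
proof -
  have "of_real v - Complex x \<eta> = Complex (v - x) (- \<eta>)" by (simp add: complex_eq_iff)
  then show ?thesis by (simp add: strip_fun_def)
qed

lemma strip_fun_norm_le:
  assumes "x \<noteq> 0" "x \<noteq> v" "\<bar>\<eta>\<bar> \<le> pi"
  shows "norm (strip_fun v (Complex x \<eta>)) \<le> ker_bound a b x * ker_bound c d (v - x)"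
  unfolding strip_fun_Complex norm_mult using assms by (intro mult_mono strip_ker_norm_le) auto

lemma strip_fun_continuous: "sin \<eta> \<noteq> 0 \<Longrightarrow> continuous_on S (\<lambda>x. strip_fun v (Complex x \<eta>))"
  unfolding strip_fun_Complex
  using strip_ker_continuous_line[of \<eta> a b 0 1] strip_ker_continuous_line[of "- \<eta>" c d v "- 1"]
  by (intro continuous_on_mult) (auto intro: continuous_on_subset)

lemma strip_fun_measurable: "sin \<eta> \<noteq> 0 \<Longrightarrow> (\<lambda>x. strip_fun v (Complex x \<eta>)) \<in> borel_measurable borel"
  by (intro borel_measurable_continuous_onI strip_fun_continuous)

lemma AE_neq_0_neq: "AE x in lborel. x \<noteq> 0 \<and> x \<noteq> (v::real)"
  using AE_lborel_neq[of 0] AE_lborel_neq[of v] by eventually_elim simp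

lemma strip_fun_integrable:
  assumes "v \<noteq> 0" "0 < \<eta>" "\<eta> < pi"
  shows "integrable lborel (\<lambda>x. strip_fun v (Complex x \<eta>))"
proof (rule Bochner_Integration.integrable_bound[OF integrable_ker_bound[OF assms(1)]])
  show "(\<lambda>x. strip_fun v (Complex x \<eta>)) \<in> borel_measurable lborel"
    using strip_fun_measurable[of \<eta> v] sin_gt_zero[OF assms(2,3)] by simp
  show "AE x in lborel. norm (strip_fun v (Complex x \<eta>)) \<le> norm (ker_bound a b x * ker_bound c d (v - x))"
    using AE_neq_0_neq[of v] by eventually_elim (use assms strip_fun_norm_le in \<open>auto simp: abs_mult\<close>)
qed

text \<open>
  Cauchy's theorem for the rectangle between the two lines, expressed through a primitive: the
  difference of the two integrals over \<open>[- k, k]\<close> is a difference of increments of the primitive along the short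
  vertical sides, and these vanish in the limit by exponential decay.
\<close>
lemma line_integral_const:
  assumes v: "v \<noteq> 0" and "0 < \<eta>" "\<eta> < pi" "0 < \<theta>" "\<theta> < pi"
  shows "(\<integral>x. strip_fun v (Complex x \<eta>) \<partial>lborel) = (\<integral>x. strip_fun v (Complex x \<theta>) \<partial>lborel)"
proof -
  define S where "S = {y. 0 < Im y} \<inter> {y. Im y < pi}"
  have S: "open S" "convex S"
    unfolding S_def by (auto intro!: open_Int convex_Int open_halfspace_Im_gt open_halfspace_Im_lt
        convex_halfspace_Im_gt convex_halfspace_Im_lt)
  have sin: "sin (Im y) > 0" if "y \<in> S" for y
    using that sin_gt_zero[of "Im y"] by (simp add: S_def)
  have "strip_fun v holomorphic_on S"
  proof -
    have 1: "strip_ker a b holomorphic_on S"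
      using sin by (intro holomorphic_on_subset[OF strip_ker_holomorphic]) force
    have "(strip_ker c d \<circ> (\<lambda>y. of_real v - y)) holomorphic_on S"
      using sin by (intro holomorphic_on_compose_gen[OF _ strip_ker_holomorphic] holomorphic_intros) force
    with 1 show ?thesis unfolding strip_fun_def[abs_def] by (intro holomorphic_intros) (auto simp: o_def)
  qed
  then obtain P where P: "\<And>y. y \<in> S \<Longrightarrow> (P has_field_derivative strip_fun v y) (at y within S)"
    using holomorphic_convex_primitive'[OF S(2,1)] by blast
  then have P': "(P has_field_derivative strip_fun v y) (at y)" if "y \<in> S" for y
    using that at_within_open[OF that S(1)] by metis
  define p where "p k \<zeta> = P (Complex (real k) \<zeta>) - P (Complex (- real k) \<zeta>)" for k \<zeta>
  have seg: "(\<integral>x. indicator {- real k..real k} x *\<^sub>R strip_fun v (Complex x \<zeta>) \<partial>lborel)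
      = p k \<zeta>" if z: "0 < \<zeta>" "\<zeta> < pi" for k \<zeta>
    unfolding p_def
  proof (rule integral_FTC_atLeastAtMost)
    fix x
    have "((\<lambda>x. Complex x \<zeta>) has_vector_derivative 1) (at x within {- real k..real k})"
      unfolding complex_eq_iff Complex_eq by (auto intro!: derivative_eq_intros)
    moreover have "(P has_field_derivative strip_fun v (Complex x \<zeta>)) (at (Complex x \<zeta>))"
      using z by (intro P') (auto simp: S_def)
    ultimately show "((\<lambda>x. P (Complex x \<zeta>)) has_vector_derivative strip_fun v (Complex x \<zeta>)) (at x within {- real k..real k})"
      using field_vector_diff_chain_within[of "\<lambda>x. Complex x \<zeta>" 1 x "{- real k..real k}" P "strip_fun v (Complex x \<zeta>)"]
      by (simp add: o_def has_field_derivative_at_within)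
  next
    show "continuous_on {- real k..real k} (\<lambda>x. strip_fun v (Complex x \<zeta>))"
      using sin_gt_zero[OF z] by (intro strip_fun_continuous) auto
  qed simp
  have lim: "(\<lambda>k. p k \<zeta>) \<longlonglongrightarrow> (\<integral>x. strip_fun v (Complex x \<zeta>) \<partial>lborel)"
    if z: "0 < \<zeta>" "\<zeta> < pi" for \<zeta>
    unfolding seg[OF z, symmetric]
  proof (rule integral_dominated_convergence[where w = "\<lambda>x. norm (strip_fun v (Complex x \<zeta>))"])
    have [measurable]: "(\<lambda>x. strip_fun v (Complex x \<zeta>)) \<in> borel_measurable borel"
      using sin_gt_zero[OF z] by (intro strip_fun_measurable) auto
    show "(\<lambda>x. strip_fun v (Complex x \<zeta>)) \<in> borel_measurable lborel"
      "\<And>k. (\<lambda>x. indicator {- real k..real k} x *\<^sub>R strip_fun v (Complex x \<zeta>)) \<in> borel_measurable lborel" by measurable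
    show "integrable lborel (\<lambda>x. norm (strip_fun v (Complex x \<zeta>)))"
      using strip_fun_integrable[OF v z] by (rule integrable_norm)
    show "AE x in lborel. (\<lambda>k. indicator {- real k..real k} x *\<^sub>R strip_fun v (Complex x \<zeta>)) \<longlonglongrightarrow> strip_fun v (Complex x \<zeta>)"
    proof (rule AE_I2)
      fix x :: real
      obtain N where N: "\<bar>x\<bar> \<le> real N" using real_arch_simple by blast
      have "\<forall>\<^sub>F k in sequentially. indicator {- real k..real k} x *\<^sub>R strip_fun v (Complex x \<zeta>) = strip_fun v (Complex x \<zeta>)"
        using eventually_ge_at_top[of N] by eventually_elim (use N in \<open>auto simp: indicator_def\<close>)
      then show "(\<lambda>k. indicator {- real k..real k} x *\<^sub>R strip_fun v (Complex x \<zeta>)) \<longlonglongrightarrow> strip_fun v (Complex x \<zeta>)"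
        by (rule tendsto_eventually)
    qed
  qed (auto simp: indicator_def)
  have vert: "norm (P (Complex x \<eta>) - P (Complex x \<theta>)) \<le> ker_bound a b x * ker_bound c d (v - x) * norm (Complex x \<eta> - Complex x \<theta>)"
    if "x \<noteq> 0" "x \<noteq> v" for x
  proof (rule field_differentiable_bound)
    let ?T = "S \<inter> {y. Re y = x}"
    have "convex ({y. Re y \<le> x} \<inter> {y. Re y \<ge> x})"
      by (intro convex_Int convex_halfspace_Re_le convex_halfspace_Re_ge)
    also have "{y. Re y \<le> x} \<inter> {y. Re y \<ge> x} = {y. Re y = x}" by auto
    finally have "convex {y. Re y = x}" .
    then show "convex ?T" using S(2) by (intro convex_Int)
    show "(P has_field_derivative strip_fun v y) (at y within ?T)" if "y \<in> ?T" for y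
      using that by (intro has_field_derivative_at_within[OF P']) simp
    show "norm (strip_fun v y) \<le> ker_bound a b x * ker_bound c d (v - x)" if "y \<in> ?T" for y
      using strip_fun_norm_le[of "Re y" v "Im y"] that \<open>x \<noteq> 0\<close> \<open>x \<noteq> v\<close> by (auto simp: S_def)
  qed (use assms in \<open>auto simp: S_def\<close>)
  have vert0: "(\<lambda>k. P (Complex (f k) \<eta>) - P (Complex (f k) \<theta>)) \<longlonglongrightarrow> 0"
    if f: "filterlim f at_infinity sequentially" for f :: "nat \<Rightarrow> real"
  proof (rule Lim_null_comparison)
    \<comment> \<open>The bound on the vertical sides is available off \<open>0\<close> and \<open>v\<close> only.\<close>
    have "\<forall>\<^sub>F x::real in at_infinity. norm x \<ge> 1 + \<bar>v\<bar>" unfolding eventually_at_infinity by blast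
    from eventually_compose_filterlim[OF this f]
    show "\<forall>\<^sub>F k in sequentially. norm (P (Complex (f k) \<eta>) - P (Complex (f k) \<theta>))
        \<le> ker_bound a b (f k) * ker_bound c d (v - f k) * \<bar>\<eta> - \<theta>\<bar>"
    proof eventually_elim
      case (elim k)
      then have "f k \<noteq> 0" "f k \<noteq> v" by auto
      from vert[OF this] show ?case by (simp add: complex_diff cmod_def)
    qed
    have "(\<lambda>k. ker_bound a b (f k) * ker_bound c d (v - f k) * \<bar>\<eta> - \<theta>\<bar>) \<longlonglongrightarrow> 0 * \<bar>\<eta> - \<theta>\<bar>"
      by (intro tendsto_mult_right filterlim_compose[OF ker_bound_mult_tendsto_0 f])
    then show "(\<lambda>k. ker_bound a b (f k) * ker_bound c d (v - f k) * \<bar>\<eta> - \<theta>\<bar>) \<longlonglongrightarrow> 0" by simp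
  qed
  have "filterlim real at_infinity sequentially"
    by (rule tendsto_of_nat)
  moreover from this have "filterlim (\<lambda>k. - real k) at_infinity sequentially"
    by (simp add: filterlim_at_infinity_conv_norm_at_top)
  ultimately have "(\<lambda>k. (P (Complex (real k) \<eta>) - P (Complex (real k) \<theta>))
      - (P (Complex (- real k) \<eta>) - P (Complex (- real k) \<theta>))) \<longlonglongrightarrow> 0 - 0"
    by (intro tendsto_diff vert0)
  also have "(\<lambda>k. (P (Complex (real k) \<eta>) - P (Complex (real k) \<theta>))
      - (P (Complex (- real k) \<eta>) - P (Complex (- real k) \<theta>))) = (\<lambda>k. p k \<eta> - p k \<theta>)"
    by (rule ext) (simp add: p_def)
  finally have "0 - 0 = (\<integral>x. strip_fun v (Complex x \<eta>) \<partial>lborel) - (\<integral>x. strip_fun v (Complex x \<theta>) \<partial>lborel)"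
    by (rule LIMSEQ_unique[OF _ tendsto_diff[OF lim[OF assms(2,3)] lim[OF assms(4,5)]]])
  then show ?thesis by simp
qed

lemma line_integral_limit:
  assumes v: "v \<noteq> 0" and e: "\<And>k. 0 < e k" "\<And>k. e k < pi" and [measurable]: "B \<in> borel_measurable borel"
    and lim: "\<And>x. x \<noteq> 0 \<Longrightarrow> x \<noteq> v \<Longrightarrow> (\<lambda>k. strip_fun v (Complex x (e k))) \<longlonglongrightarrow> B x"
  shows "(\<lambda>k. \<integral>x. strip_fun v (Complex x (e k)) \<partial>lborel) \<longlonglongrightarrow> (\<integral>x. B x \<partial>lborel)"
proof (rule integral_dominated_convergence[OF _ _ integrable_ker_bound[OF v]])
  show "AE x in lborel. (\<lambda>k. strip_fun v (Complex x (e k))) \<longlonglongrightarrow> B x"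
    using AE_neq_0_neq[of v] by eventually_elim (use lim in auto)
  show "AE x in lborel. norm (strip_fun v (Complex x (e k))) \<le> ker_bound a b x * ker_bound c d (v - x)" for k
    using AE_neq_0_neq[of v] by eventually_elim (use e[of k] strip_fun_norm_le in auto)
  show "(\<lambda>x. strip_fun v (Complex x (e k))) \<in> borel_measurable lborel" for k
    using sin_gt_zero[OF e(1,2)[of k]] strip_fun_measurable[of "e k" v] by simp
qed simp

text \<open>
  Let one line tend to the lower and the other to the upper boundary of the strip. In terms of the
  ratios this is the vanishing of an integral over the real line shifted into the upper half-plane.
\<close>
lemma strip_relation:
  assumes v: "v \<noteq> 0"
  shows "(\<integral>x. (ker Inner a b x + exp (- \<i> * pi * (b - a - 1)) * ker Outer a b x) *
      (ker Inner c d (v - x) + exp (\<i> * pi * (d - c - 1)) * ker Outer c d (v - x)) \<partial>lborel)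
    = exp (\<i> * pi * (d - b)) * conv (ker Negative a b) (ker Negative c d) v"
    (is "?L = ?R")
proof -
  \<comment> \<open>Heights tending to the lower boundary; \<open>pi - e k\<close> tends to the upper one.\<close>
  define e where "e k = inverse (real (Suc k))" for k
  have e0: "e \<longlonglongrightarrow> 0" unfolding e_def by (rule LIMSEQ_inverse_real_of_nat)
  have e: "0 < e k" "e k < pi" for k
  proof -
    show "0 < e k" by (simp add: e_def)
    have "e k \<le> 1" by (simp add: e_def inverse_le_1_iff)
    then show "e k < pi" using pi_gt3 by simp
  qed
  have epi: "(\<lambda>k. pi - e k) \<longlonglongrightarrow> pi" using tendsto_diff[OF tendsto_const e0, of pi] by simp
  have L0: "(\<lambda>k. \<integral>x. strip_fun v (Complex x (e k)) \<partial>lborel) \<longlonglongrightarrow> ?L"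
  proof (rule line_integral_limit[OF v e])
    fix x assume x: "x \<noteq> 0" "x \<noteq> v"
    have "(\<lambda>k. strip_ker a b (Complex x (1 * e k)) * strip_ker c d (Complex (v - x) ((-1) * e k))) \<longlonglongrightarrow>
      (ker Inner a b x + exp (- of_real 1 * \<i> * pi * (b - a - 1)) * ker Outer a b x) *
      (ker Inner c d (v - x) + exp (- of_real (-1) * \<i> * pi * (d - c - 1)) * ker Outer c d (v - x))"
      using x e by (intro tendsto_mult strip_ker_lim_0[OF _ e0]) auto
    then show "(\<lambda>k. strip_fun v (Complex x (e k))) \<longlonglongrightarrow>
      (ker Inner a b x + exp (- \<i> * pi * (b - a - 1)) * ker Outer a b x) *
      (ker Inner c d (v - x) + exp (\<i> * pi * (d - c - 1)) * ker Outer c d (v - x))"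
      by (simp add: strip_fun_Complex)
  qed simp
  have Lpi: "(\<lambda>k. \<integral>x. strip_fun v (Complex x (pi - e k)) \<partial>lborel) \<longlonglongrightarrow>
      (\<integral>x. exp (\<i> * pi * (d - b)) * (ker Negative a b x * ker Negative c d (v - x)) \<partial>lborel)"
  proof (rule line_integral_limit[OF v])
    fix x assume x: "x \<noteq> 0" "x \<noteq> v"
    have "(\<lambda>k. strip_ker a b (Complex x (1 * (pi - e k))) * strip_ker c d (Complex (v - x) ((-1) * (pi - e k)))) \<longlonglongrightarrow>
      (exp (- of_real 1 * \<i> * pi * b) * ker Negative a b x) *
      (exp (- of_real (-1) * \<i> * pi * d) * ker Negative c d (v - x))"
      by (intro tendsto_mult strip_ker_lim_pi[OF _ epi]) auto
    also have "(exp (- of_real 1 * \<i> * pi * b) * ker Negative a b x) *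
      (exp (- of_real (-1) * \<i> * pi * d) * ker Negative c d (v - x))
      = exp (\<i> * pi * (d - b)) * (ker Negative a b x * ker Negative c d (v - x))"
    proof -
      have "exp (- \<i> * pi * b) * exp (\<i> * pi * d) = exp (\<i> * pi * (d - b))"
        by (simp add: algebra_simps flip: exp_add)
      then show ?thesis by (simp add: mult_ac)
    qed
    finally show "(\<lambda>k. strip_fun v (Complex x (pi - e k))) \<longlonglongrightarrow> \<dots>"
      by (simp add: strip_fun_Complex)
  qed (use e in auto)
  have "(\<integral>x. strip_fun v (Complex x (e k)) \<partial>lborel) = (\<integral>x. strip_fun v (Complex x (pi - e k)) \<partial>lborel)" for k
    using e by (intro line_integral_const v) auto
  with L0 Lpi have "?L = (\<integral>x. exp (\<i> * pi * (d - b)) * (ker Negative a b x * ker Negative c d (v - x)) \<partial>lborel)"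
    by (intro LIMSEQ_unique[of _ ?L]) (simp_all only:)
  then show ?thesis by (simp add: conv_def)
qed

end

section \<open>Relations between words of two letters\<close>

lemma conv_lincomb4:
  assumes "majorized h Kh" "majorized f1 K1" "majorized f2 K2" "majorized f3 K3" "majorized f4 K4"
    "nnconv Kh K1 v < \<infinity>" "nnconv Kh K2 v < \<infinity>" "nnconv Kh K3 v < \<infinity>" "nnconv Kh K4 v < \<infinity>"
  shows "conv h (\<lambda>x. k1 * f1 x + k2 * f2 x + k3 * f3 x + k4 * f4 x) v
    = k1 * conv h f1 v + k2 * conv h f2 v + k3 * conv h f3 v + k4 * conv h f4 v"
proof -
  have "conv h (\<lambda>x. k1 * f1 x + k2 * f2 x + k3 * f3 x + k4 * f4 x) v
    = (\<integral>x. k1 * (h x * f1 (v - x)) + k2 * (h x * f2 (v - x)) + k3 * (h x * f3 (v - x)) + k4 * (h x * f4 (v - x)) \<partial>lborel)"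
    unfolding conv_def by (simp add: algebra_simps)
  also have "\<dots> = k1 * conv h f1 v + k2 * conv h f2 v + k3 * conv h f3 v + k4 * conv h f4 v"
    using assms by (simp add: conv_integrable conv_def)
  finally show ?thesis .
qed

definition expi :: "complex \<Rightarrow> complex" where "expi x = exp (\<i> * pi * x)"

lemma expi_nonzero [simp]: "expi x \<noteq> 0" by (simp add: expi_def)
lemma expi_add: "expi (x + y) = expi x * expi y" by (simp add: expi_def distrib_left exp_add)
lemma expi_minus: "expi (- x) = inverse (expi x)" by (simp add: expi_def exp_minus)
lemma expi_diff: "expi (x - y) = expi x / expi y" by (simp add: expi_def right_diff_distrib exp_diff)
lemma expi_1: "expi 1 = -1" by (simp add: expi_def)

lemma s_eq_expi: "s x = (expi x - inverse (expi x)) / (2 * \<i>)"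
  by (simp add: s_def expi_def sin_exp_eq exp_minus mult_ac)

lemma s_minus: "s (- x) = - s x" by (simp add: s_def)

lemma s_one_minus: "s (1 - x) = s x"
proof -
  have "expi (1 - x) = - inverse (expi x)" by (simp add: expi_diff expi_1 divide_inverse)
  then show ?thesis by (simp add: s_eq_expi)
qed

lemma divide_lincomb3:
  fixes k :: complex
  assumes "k \<noteq> 0" "k * x = a * p + b * q + c * r"
  shows "x = a / k * p + b / k * q + c / k * r"
proof -
  have "x = (a * p + b * q + c * r) / k" using assms by (simp add: eq_divide_eq mult.commute)
  then show ?thesis by (simp add: add_divide_distrib)
qed

text \<open>
  A normal form in which the sine identities below become polynomial identities in the squares of the
  exponentials.
\<close>
lemma s_diff:
  "s (x - y) = ((expi x)\<^sup>2 - (expi y)\<^sup>2) * inverse (expi x) * inverse (expi y) * (1 / (2 * \<i>))"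
  by (simp add: s_eq_expi expi_diff field_simps power2_eq_square)

text \<open>The counterpart for symbols of the relation \<open>Inner_Inner\<close> below.\<close>
lemma s_identity_Inner_Inner:
  "s (b - d) * s (x - a) * s (x - c) = s (b - c) * s (x - a) * s (x - d)
    + s (a - d) * s (x - b) * s (x - c) - s (a - c) * s (x - b) * s (x - d)"
  unfolding s_diff by algebra

text \<open>The counterpart for symbols of the relation \<open>Negative_Negative\<close> below.\<close>
lemma s_identity_Negative_Negative:
  "s (b - d) * s (b - a) * s (d - c) = s (a - b) * s (x - b) * s (x - c)
    - s (c - d) * s (x - a) * s (x - d) - s (a - b - c + d) * s (x - b) * s (x - d)"
proof -
  have sum: "s (a - b - c + d) = ((expi a)\<^sup>2 * (expi d)\<^sup>2 - (expi b)\<^sup>2 * (expi c)\<^sup>2)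
      * inverse (expi a) * inverse (expi b) * inverse (expi c) * inverse (expi d) * (1 / (2 * \<i>))"
    using s_diff[of "a + d" "b + c"] by (simp add: expi_add power_mult_distrib algebra_simps)
  have "(expi t)\<^sup>2 * (inverse (expi t))\<^sup>2 = 1" for t by (simp flip: power_mult_distrib)
  from this[of b] this[of d] this[of x] show ?thesis unfolding s_diff sum by algebra
qed

lemma expi_diff_expi_minus: "expi x - expi (- x) = 2 * \<i> * s x"
  by (simp add: s_eq_expi expi_minus)

context two_kernels begin

definition "pair_conv L M v = conv (ker L a b) (ker M c d) v"

lemma upper_strip_relation:
  assumes v: "v \<noteq> 0"
  shows "pair_conv Inner Inner v - expi (d - c) * pair_conv Inner Outer v - expi (a - b) * pair_conv Outer Inner v
    + expi (a - b + d - c) * pair_conv Outer Outer v = expi (d - b) * pair_conv Negative Negative v"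
proof -
  let ?p = "exp (- \<i> * pi * (b - a - 1))" and ?q = "exp (\<i> * pi * (d - c - 1))"
  have p: "?p = - expi (a - b)"
  proof -
    have "?p = expi (a - b + 1)" by (simp add: expi_def algebra_simps)
    then show ?thesis by (simp add: expi_add expi_1)
  qed
  have q: "?q = - expi (d - c)"
  proof -
    have "?q = expi (d - c - 1)" by (simp add: expi_def)
    then show ?thesis by (simp add: expi_diff expi_1)
  qed
  have pq: "expi (a - b + d - c) = expi (a - b) * expi (d - c)" by (simp add: expi_add expi_diff)
  have "(\<integral>x. (ker Inner a b x + ?p * ker Outer a b x) * (ker Inner c d (v - x) + ?q * ker Outer c d (v - x)) \<partial>lborel)
      = (\<integral>x. ker Inner a b x * ker Inner c d (v - x) + ?q * (ker Inner a b x * ker Outer c d (v - x))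
        + ?p * (ker Outer a b x * ker Inner c d (v - x)) + (?p * ?q) * (ker Outer a b x * ker Outer c d (v - x)) \<partial>lborel)"
    by (intro Bochner_Integration.integral_cong refl) (simp only: distrib_left distrib_right mult_ac add_ac)
  also have "\<dots> = pair_conv Inner Inner v + ?q * pair_conv Inner Outer v + ?p * pair_conv Outer Inner v + (?p * ?q) * pair_conv Outer Outer v"
    using integrable_ker[OF v] by (simp add: pair_conv_def conv_def)
  finally have "pair_conv Inner Inner v + ?q * pair_conv Inner Outer v + ?p * pair_conv Outer Inner v + (?p * ?q) * pair_conv Outer Outer v
      = expi (d - b) * pair_conv Negative Negative v"
    using strip_relation[OF v] by (simp only: expi_def pair_conv_def)
  then show ?thesis unfolding p q by (simp add: pq)
qed

end

lemma two_kernels_swap: "two_kernels a b c d \<Longrightarrow> two_kernels c d a b"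
  by (auto simp: two_kernels_def)

context two_kernels begin

text \<open>Exchanging the two kernels conjugates all phases, so that a second relation comes for free.\<close>
lemma lower_strip_relation:
  assumes v: "v \<noteq> 0"
  shows "pair_conv Inner Inner v - expi (b - a) * pair_conv Outer Inner v - expi (c - d) * pair_conv Inner Outer v
    + expi (c - d + b - a) * pair_conv Outer Outer v = expi (b - d) * pair_conv Negative Negative v"
proof -
  interpret swap: two_kernels c d a b by (rule two_kernels_swap) unfold_locales
  have "swap.pair_conv L M v = pair_conv M L v" for L M by (simp add: swap.pair_conv_def pair_conv_def conv_commute)
  with swap.upper_strip_relation[OF v] show ?thesis by simp
qed

text \<open>Eliminate the pair of negative pieces from the two relations.\<close>
lemma Inner_Inner:
  assumes v: "v \<noteq> 0"
  shows "s (b - d) * pair_conv Inner Inner v = s (b - c) * pair_conv Inner Outer v + s (a - d) * pair_conv Outer Inner v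
    - s (a - c) * pair_conv Outer Outer v"
proof -
  have e: "expi (b - d) * expi (d - c) = expi (b - c)" "expi (d - b) * expi (c - d) = expi (- (b - c))"
    "expi (b - d) * expi (a - b) = expi (a - d)" "expi (d - b) * expi (b - a) = expi (- (a - d))"
    "expi (b - d) * expi (a - b + d - c) = expi (a - c)" "expi (d - b) * expi (c - d + b - a) = expi (- (a - c))"
    "expi (d - b) = expi (- (b - d))"
    by (simp_all flip: expi_add)
  have "0 = expi (b - d) * (expi (d - b) * pair_conv Negative Negative v) - expi (d - b) * (expi (b - d) * pair_conv Negative Negative v)"
    by simp
  also have "\<dots> = (expi (b - d) - expi (d - b)) * pair_conv Inner Inner v
      - (expi (b - d) * expi (d - c) - expi (d - b) * expi (c - d)) * pair_conv Inner Outer v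
      - (expi (b - d) * expi (a - b) - expi (d - b) * expi (b - a)) * pair_conv Outer Inner v
      + (expi (b - d) * expi (a - b + d - c) - expi (d - b) * expi (c - d + b - a)) * pair_conv Outer Outer v"
    unfolding upper_strip_relation[OF v, symmetric] lower_strip_relation[OF v, symmetric]
    by (simp only: ring_distribs mult_ac) simp
  also have "\<dots> = 2 * \<i> * (s (b - d) * pair_conv Inner Inner v - s (b - c) * pair_conv Inner Outer v
      - s (a - d) * pair_conv Outer Inner v + s (a - c) * pair_conv Outer Outer v)"
    unfolding e(1-6) unfolding e(7) expi_diff_expi_minus by (simp add: right_diff_distrib distrib_left)
  finally have "s (b - d) * pair_conv Inner Inner v - s (b - c) * pair_conv Inner Outer v
      - s (a - d) * pair_conv Outer Inner v + s (a - c) * pair_conv Outer Outer v = 0" by simp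
  then show ?thesis by (simp add: algebra_simps)
qed

text \<open>Eliminate the pair of inner pieces from the two relations.\<close>
lemma Negative_Negative:
  assumes v: "v \<noteq> 0"
  shows "s (b - d) * pair_conv Negative Negative v = s (a - b) * pair_conv Outer Inner v - s (c - d) * pair_conv Inner Outer v
    - s (a - b - c + d) * pair_conv Outer Outer v"
proof -
  have e: "expi (d - b) = expi (- (b - d))" "expi (b - a) = expi (- (a - b))" "expi (d - c) = expi (- (c - d))"
    "expi (a - b + d - c) = expi (a - b - c + d)" "expi (c - d + b - a) = expi (- (a - b - c + d))"
    by (simp_all add: algebra_simps)
  have "2 * \<i> * (s (b - d) * pair_conv Negative Negative v)
      = expi (b - d) * pair_conv Negative Negative v - expi (d - b) * pair_conv Negative Negative v"
    unfolding e mult.assoc[symmetric] expi_diff_expi_minus[symmetric] by (simp add: algebra_simps)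
  also have "\<dots> = (expi (a - b) - expi (b - a)) * pair_conv Outer Inner v - (expi (c - d) - expi (d - c)) * pair_conv Inner Outer v
      - (expi (a - b + d - c) - expi (c - d + b - a)) * pair_conv Outer Outer v"
    unfolding upper_strip_relation[OF v, symmetric] lower_strip_relation[OF v, symmetric]
    by (simp add: left_diff_distrib)
  also have "\<dots> = 2 * \<i> * (s (a - b) * pair_conv Outer Inner v - s (c - d) * pair_conv Inner Outer v
      - s (a - b - c + d) * pair_conv Outer Outer v)"
    unfolding e expi_diff_expi_minus by (simp add: right_diff_distrib)
  finally show ?thesis by simp
qed

end

section \<open>Reducing words to a basis\<close>

locale exponents =
  fixes I :: "nat set" and \<alpha> \<beta> :: "nat \<Rightarrow> complex"
  assumes positive: "k \<in> I \<Longrightarrow> Re (\<beta> k - \<alpha> k) > 0"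
    and separated: "i \<in> I \<Longrightarrow> j \<in> I \<Longrightarrow> i \<noteq> j \<Longrightarrow> Re (\<beta> i) < Re (\<alpha> j) + 1"
    and beta_nonresonant: "i \<in> I \<Longrightarrow> j \<in> I \<Longrightarrow> i \<noteq> j \<Longrightarrow> \<beta> i - \<beta> j \<notin> \<int>"
    and alpha_nonresonant: "i \<in> I \<Longrightarrow> j \<in> I \<Longrightarrow> \<beta> i - \<alpha> j \<notin> \<int>"
begin

sublocale tame_family I "\<lambda>k x. ennreal (ker_bound (\<alpha> k) (\<beta> k) x)" "\<lambda>k. Re (\<beta> k)" "\<lambda>k. Re (\<alpha> k) + 1"
  using positive separated by unfold_locales (auto intro!: tame_ker_bound)

abbreviation majorant :: "nat list \<Rightarrow> real \<Rightarrow> ennreal" where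
  "majorant \<equiv> iconv_nn (\<lambda>k x. ennreal (ker_bound (\<alpha> k) (\<beta> k) x))"

definition letter :: "piece \<Rightarrow> nat \<Rightarrow> real \<Rightarrow> complex" where
  "letter L k = ker L (\<alpha> k) (\<beta> k)"

text \<open>
  A word selects a piece for every kernel; in terms of ratios it is the integral over all ratios with
  a given product, each ratio staying in its piece.
\<close>
definition word :: "(nat \<Rightarrow> piece) \<Rightarrow> nat list \<Rightarrow> real \<Rightarrow> complex" where
  "word w S = iconv (\<lambda>k. letter (w k) k) S"

text \<open>
  Up to a factor common to all pieces, this is the Mellin transform of a letter: for the outer
  and the inner piece the transforms are Beta functions whose quotient is \<open>s (x - \<beta> k) / s (x - \<alpha> k)\<close>. Symbols are
  used only algebraically, as the transforms of the letters of a word need not have a common domain of convergence.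
  The value for a negative letter is a default: only a pair of negative letters has a symbol, a constant.
\<close>
definition letter_symbol :: "piece \<Rightarrow> nat \<Rightarrow> complex \<Rightarrow> complex" where
  "letter_symbol L k x = (if L = Inner then s (x - \<alpha> k) else s (x - \<beta> k))"

definition symbol :: "(nat \<Rightarrow> piece) \<Rightarrow> nat list \<Rightarrow> complex \<Rightarrow> complex" where
  "symbol w S x = (\<Prod>k\<in>set S. letter_symbol (w k) k x)"

definition one_inner :: "nat \<Rightarrow> nat \<Rightarrow> piece" where
  "one_inner j = (\<lambda>_. Outer)(j := Inner)"

lemma one_inner_apply: "one_inner j k = (if k = j then Inner else Outer)"
  by (simp add: one_inner_def)

lemma s_nonzero: "x \<notin> \<int> \<Longrightarrow> s x \<noteq> 0"
proof
  assume x: "x \<notin> \<int>" and "s x = 0"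
  then have "sin (complex_of_real pi * x) = 0" by (simp add: s_def)
  then obtain n :: int where "complex_of_real pi * x = of_real (of_int n * pi)"
    using sin_eq_0 by blast
  then have "x = of_int n" by (simp add: mult.commute)
  with x show False by simp
qed

lemma majorized_letter: "majorized (letter L k) (\<lambda>x. ennreal (ker_bound (\<alpha> k) (\<beta> k) x))"
  unfolding letter_def by (rule majorized_ker)

lemma letter_measurable [measurable]: "letter L k \<in> borel_measurable borel"
  by (rule majorizedD(1)[OF majorized_letter])

lemma majorized_word: "majorized (word w S) (majorant S)"
  unfolding word_def by (intro majorized_iconv majorized_letter)

lemma word_measurable [measurable]: "word w S \<in> borel_measurable borel"
  by (rule majorizedD(1)[OF majorized_word])

lemma majorant_measurable [measurable]: "majorant S \<in> borel_measurable borel"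
  by (rule majorizedD(2)[OF majorized_word])

lemma word_cong: "(\<And>k. k \<in> set S \<Longrightarrow> w k = w' k) \<Longrightarrow> word w S = word w' S"
  unfolding word_def by (intro iconv_cong) simp

lemma word_Cons: "S \<noteq> [] \<Longrightarrow> word w (k # S) = conv (letter (w k) k) (word w S)"
  by (simp add: word_def iconv_Cons)

lemma word_perm:
  "mset xs = mset ys \<Longrightarrow> distinct xs \<Longrightarrow> set xs \<subseteq> I \<Longrightarrow> v \<noteq> 0 \<Longrightarrow> word w xs v = word w ys v"
  unfolding word_def by (rule iconv_perm[OF majorized_letter])

text \<open>A product of ratios greater than \<open>1\<close> is greater than \<open>1\<close>.\<close>
lemma word_Outer_eq_0: "v \<le> 0 \<Longrightarrow> word (\<lambda>_. Outer) S v = 0"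
proof (induction S arbitrary: v)
  case (Cons k S)
  have A: "letter Outer k x = 0" if "x \<le> 0" for x using that by (simp add: letter_def ker_def)
  show ?case
  proof (cases "S = []")
    case True
    then show ?thesis using A Cons.prems by (simp add: word_def)
  next
    case False
    have "(\<lambda>x. letter Outer k x * word (\<lambda>_. Outer) S (v - x)) = (\<lambda>_. 0)"
    proof
      show "letter Outer k x * word (\<lambda>_. Outer) S (v - x) = 0" for x
        using A[of x] Cons.IH[of "v - x"] Cons.prems by (cases "x \<le> 0") auto
    qed
    then have "conv (letter Outer k) (word (\<lambda>_. Outer) S) v = 0" unfolding conv_def by simp
    then show ?thesis using False by (simp add: word_Cons)
  qed
qed (simp add: word_def)

lemma two_kernels: "i \<in> I \<Longrightarrow> j \<in> I \<Longrightarrow> i \<noteq> j \<Longrightarrow> two_kernels (\<alpha> i) (\<beta> i) (\<alpha> j) (\<beta> j)"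
  using positive separated by unfold_locales auto

text \<open>
  A linear relation between words of two letters persists after appending further letters, because
  convolution is associative and bilinear.
\<close>
lemma relation_append:
  assumes ij: "i \<in> I" "j \<in> I" "i \<noteq> j" and R: "distinct R" "set R \<subseteq> I" "i \<notin> set R" "j \<notin> set R"
    and rel: "\<And>x. x \<noteq> 0 \<Longrightarrow> k1 * conv (letter L1 i) (letter M1 j) x + k2 * conv (letter L2 i) (letter M2 j) x
      + k3 * conv (letter L3 i) (letter M3 j) x + k4 * conv (letter L4 i) (letter M4 j) x = 0"
    and v: "v \<noteq> 0"
  shows "k1 * word (w(i := L1, j := M1)) (i # j # R) v + k2 * word (w(i := L2, j := M2)) (i # j # R) v
    + k3 * word (w(i := L3, j := M3)) (i # j # R) v + k4 * word (w(i := L4, j := M4)) (i # j # R) v = 0"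
proof (cases "R = []")
  case True
  then show ?thesis using rel[OF v] ij by (simp add: word_def)
next
  case False
  define p where "p L M = conv (letter L i) (letter M j)" for L M
  let ?Ki = "\<lambda>x. ennreal (ker_bound (\<alpha> i) (\<beta> i) x)" and ?Kj = "\<lambda>x. ennreal (ker_bound (\<alpha> j) (\<beta> j) x)"
  have fin: "nnconv ?Ki (nnconv ?Kj (majorant R)) v < \<infinity>"
    using iconv_nn_finite[of "i # j # R" v] ij R v False by (simp add: iconv_nn_Cons)
  have fin': "nnconv (majorant R) (nnconv ?Ki ?Kj) v < \<infinity>"
  proof -
    have "nnconv (majorant R) (nnconv ?Ki ?Kj) v = nnconv ?Ki (nnconv (majorant R) ?Kj) v"
      by (intro nnconv_left_commute) measurable
    also have "nnconv (majorant R) ?Kj = nnconv ?Kj (majorant R)"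
      by (intro ext nnconv_commute) measurable
    finally show ?thesis using fin by simp
  qed
  have W: "word (w(i := L, j := M)) (i # j # R) v = conv (word w R) (p L M) v" for L M
  proof -
    have "word (w(i := L, j := M)) R = word w R" using R by (intro word_cong) auto
    then have "word (w(i := L, j := M)) (i # j # R) v = conv (letter L i) (conv (letter M j) (word w R)) v"
      using False ij by (simp add: word_Cons)
    also have "\<dots> = conv (p L M) (word w R) v"
      unfolding p_def by (rule conv_assoc[OF majorized_letter majorized_letter majorized_word fin, symmetric])
    also have "\<dots> = conv (word w R) (p L M) v" by (rule conv_commute)
    finally show ?thesis .
  qed
  have mp: "majorized (p L M) (nnconv ?Ki ?Kj)" for L M
    unfolding p_def by (intro majorized_conv majorized_letter)
  have [measurable]: "p L M \<in> borel_measurable borel" for L M unfolding p_def by measurable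
  have "k1 * conv (word w R) (p L1 M1) v + k2 * conv (word w R) (p L2 M2) v
      + k3 * conv (word w R) (p L3 M3) v + k4 * conv (word w R) (p L4 M4) v
    = conv (word w R) (\<lambda>x. k1 * p L1 M1 x + k2 * p L2 M2 x + k3 * p L3 M3 x + k4 * p L4 M4 x) v"
    by (rule conv_lincomb4[OF majorized_word mp mp mp mp fin' fin' fin' fin', symmetric])
  also have "\<dots> = conv (word w R) (\<lambda>_. 0) v"
    by (intro conv_cong) (use rel in \<open>auto simp: p_def\<close>)
  also have "\<dots> = 0" by (simp add: conv_def)
  finally show ?thesis unfolding W .
qed

text \<open>
  The functions spanned by the words with at most one inner letter, the others being outer, each
  recorded with a symbol. The two components undergo the same linear operations, so that the coefficients of a function
  can later be read off from its symbol without being computed. Equality at \<open>0\<close> is ignored because convolutions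
  may diverge there.
\<close>
inductive reducible :: "nat list \<Rightarrow> (real \<Rightarrow> complex) \<Rightarrow> (complex \<Rightarrow> complex) \<Rightarrow> bool" for S where
  one_inner: "j \<in> set S \<Longrightarrow> reducible S (word (one_inner j) S) (symbol (one_inner j) S)"
| all_outer: "reducible S (word (\<lambda>_. Outer) S) (symbol (\<lambda>_. Outer) S)"
| lin: "reducible S f \<sigma> \<Longrightarrow> reducible S g \<tau> \<Longrightarrow> reducible S (\<lambda>v. x * f v + y * g v) (\<lambda>t. x * \<sigma> t + y * \<tau> t)"
| off_zero: "reducible S f \<sigma> \<Longrightarrow> g \<in> borel_measurable borel \<Longrightarrow> (\<And>v. v \<noteq> 0 \<Longrightarrow> f v = g v) \<Longrightarrow> reducible S g \<sigma>"

lemma reducible_majorized: "reducible S f \<sigma> \<Longrightarrow> \<exists>c\<ge>0. majorized f (\<lambda>x. ennreal c * majorant S x)"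
proof (induction rule: reducible.induct)
  case (one_inner j)
  then show ?case using majorized_word[of "one_inner j" S] by (intro exI[of _ 1]) simp
next
  case all_outer
  then show ?case using majorized_word[of "\<lambda>_. Outer" S] by (intro exI[of _ 1]) simp
next
  case (lin f \<sigma> g \<tau> x y)
  then obtain c d where cd: "c \<ge> 0" "d \<ge> 0" and f: "majorized f (\<lambda>x. ennreal c * majorant S x)"
    and g: "majorized g (\<lambda>x. ennreal d * majorant S x)" by blast
  have "majorized (\<lambda>v. x * f v + y * g v) (\<lambda>v. ennreal (norm x * c + norm y * d) * majorant S v)"
    by (rule majorized_lincomb[OF f g cd majorant_measurable])
  then show ?case using cd by (intro exI[of _ "norm x * c + norm y * d"]) auto
next
  case (off_zero f \<sigma> g)
  then show ?case by (auto simp: majorized_def)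
qed

lemma reducible_measurable: "reducible S f \<sigma> \<Longrightarrow> f \<in> borel_measurable borel"
  using reducible_majorized majorizedD(1) by blast

lemma reducible_lin3:
  assumes "reducible S f1 s1" "reducible S f2 s2" "reducible S f3 s3" "g \<in> borel_measurable borel"
    and "\<And>v. v \<noteq> 0 \<Longrightarrow> g v = kf * f1 v + kg * f2 v + kh * f3 v"
    and "\<And>t. \<sigma> t = kf * s1 t + kg * s2 t + kh * s3 t"
  shows "reducible S g \<sigma>"
proof -
  have "reducible S (\<lambda>v. 1 * (kf * f1 v + kg * f2 v) + kh * f3 v) (\<lambda>t. 1 * (kf * s1 t + kg * s2 t) + kh * s3 t)"
    by (intro reducible.lin assms)
  moreover have "(\<lambda>t. 1 * (kf * s1 t + kg * s2 t) + kh * s3 t) = \<sigma>" using assms(6) by auto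
  ultimately have "reducible S (\<lambda>v. 1 * (kf * f1 v + kg * f2 v) + kh * f3 v) \<sigma>" by simp
  then show ?thesis using assms(4) by (rule reducible.off_zero) (simp add: assms(5))
qed

lemma symbol_Cons: "b \<notin> set S \<Longrightarrow> symbol w (b # S) x = letter_symbol (w b) b x * symbol w S x"
  by (simp add: symbol_def)

lemma symbol_cong: "(\<And>k. k \<in> set S \<Longrightarrow> w k = w' k) \<Longrightarrow> symbol w S = symbol w' S"
  unfolding symbol_def by (intro ext prod.cong) auto

text \<open>
  Prepending an inner letter to a word with one inner letter creates a pair of inner letters, which
  the relation \<open>Inner_Inner\<close> replaces by pairs with at most one inner letter. The sine identity says that the symbols
  obey the same relation.
\<close>
lemma reducible_step:
  assumes "reducible S f \<sigma>" and b: "b \<in> I" "b \<notin> set S" and S: "S \<noteq> []" "distinct S" "set S \<subseteq> I"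
  shows "reducible (b # S) (conv (letter Inner b) f) (\<lambda>t. s (t - \<alpha> b) * \<sigma> t)"
  using assms(1)
proof (induction rule: reducible.induct)
  case (one_inner j)
  then obtain xs ys where Sj: "S = xs @ j # ys" by (meson split_list)
  define R where "R = xs @ ys"
  have jb: "j \<in> I" "j \<noteq> b" using one_inner S b by auto
  have R: "distinct R" "set R \<subseteq> I" "b \<notin> set R" "j \<notin> set R"
    using S b by (auto simp: Sj R_def)
  have perm: "word w (b # S) v = word w (b # j # R) v" if "v \<noteq> 0" for w v
    using b S that by (intro word_perm) (auto simp: Sj R_def)
  interpret bj: two_kernels "\<alpha> b" "\<beta> b" "\<alpha> j" "\<beta> j" using b jb by (intro two_kernels) auto
  have rel: "s (\<beta> b - \<beta> j) * conv (letter Inner b) (letter Inner j) x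
      + (- s (\<beta> b - \<alpha> j)) * conv (letter Inner b) (letter Outer j) x
      + (- s (\<alpha> b - \<beta> j)) * conv (letter Outer b) (letter Inner j) x
      + s (\<alpha> b - \<alpha> j) * conv (letter Outer b) (letter Outer j) x = 0" if "x \<noteq> 0" for x
    using bj.Inner_Inner[OF that] by (simp add: bj.pair_conv_def letter_def)
  let ?w = "\<lambda>_::nat. Outer"
  have nz: "s (\<beta> b - \<beta> j) \<noteq> 0" using b jb by (intro s_nonzero beta_nonresonant) auto
  have w1: "?w(b := Inner, j := Outer) = one_inner b" "?w(b := Outer, j := Inner) = one_inner j"
    "?w(b := Outer, j := Outer) = ?w" using jb by (auto simp: one_inner_def)
  have w2: "conv (letter Inner b) (word (one_inner j) S) = word (?w(b := Inner, j := Inner)) (b # S)"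
  proof -
    have "word (?w(b := Inner, j := Inner)) S = word (one_inner j) S"
      using b by (intro word_cong) (auto simp: one_inner_def)
    then show ?thesis using S jb by (simp add: word_Cons)
  qed
  show ?case
  proof (rule reducible_lin3[where kf = "s (\<beta> b - \<alpha> j) / s (\<beta> b - \<beta> j)" and kg = "s (\<alpha> b - \<beta> j) / s (\<beta> b - \<beta> j)"
        and kh = "- s (\<alpha> b - \<alpha> j) / s (\<beta> b - \<beta> j)"])
    show "reducible (b # S) (word (one_inner b) (b # S)) (symbol (one_inner b) (b # S))" by (rule reducible.one_inner) simp
    show "reducible (b # S) (word (one_inner j) (b # S)) (symbol (one_inner j) (b # S))"
      using one_inner by (intro reducible.one_inner) simp
    show "reducible (b # S) (word ?w (b # S)) (symbol ?w (b # S))" by (rule reducible.all_outer)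
    show "conv (letter Inner b) (word (one_inner j) S) \<in> borel_measurable borel" by measurable
    show "conv (letter Inner b) (word (one_inner j) S) v
        = s (\<beta> b - \<alpha> j) / s (\<beta> b - \<beta> j) * word (one_inner b) (b # S) v
        + s (\<alpha> b - \<beta> j) / s (\<beta> b - \<beta> j) * word (one_inner j) (b # S) v
        + - s (\<alpha> b - \<alpha> j) / s (\<beta> b - \<beta> j) * word ?w (b # S) v" if v: "v \<noteq> 0" for v
    proof (rule divide_lincomb3[OF nz])
      show "s (\<beta> b - \<beta> j) * conv (letter Inner b) (word (one_inner j) S) v
        = s (\<beta> b - \<alpha> j) * word (one_inner b) (b # S) v + s (\<alpha> b - \<beta> j) * word (one_inner j) (b # S) v
          + - s (\<alpha> b - \<alpha> j) * word ?w (b # S) v"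
        using relation_append[OF b(1) jb(1) jb(2)[symmetric] R rel v, of ?w]
        unfolding w2 w1 perm[OF v] by (simp add: algebra_simps)
    qed
    show "s (t - \<alpha> b) * symbol (one_inner j) S t
        = s (\<beta> b - \<alpha> j) / s (\<beta> b - \<beta> j) * symbol (one_inner b) (b # S) t
        + s (\<alpha> b - \<beta> j) / s (\<beta> b - \<beta> j) * symbol (one_inner j) (b # S) t
        + - s (\<alpha> b - \<alpha> j) / s (\<beta> b - \<beta> j) * symbol ?w (b # S) t" for t
    proof -
      have y: "symbol w S t = letter_symbol (w j) j t * symbol w R t" for w
        using S by (simp add: symbol_def Sj R_def)
      have "symbol (one_inner j) R = symbol ?w R" "symbol (one_inner b) R = symbol ?w R"
        using R by (auto intro!: symbol_cong simp: one_inner_def)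
      note y = this y
      have "s (\<beta> b - \<beta> j) * (s (t - \<alpha> b) * s (t - \<alpha> j)) * symbol ?w R t
        = (s (\<beta> b - \<alpha> j) * s (t - \<alpha> b) * s (t - \<beta> j) + s (\<alpha> b - \<beta> j) * s (t - \<beta> b) * s (t - \<alpha> j)
          - s (\<alpha> b - \<alpha> j) * s (t - \<beta> b) * s (t - \<beta> j)) * symbol ?w R t"
        using s_identity_Inner_Inner[of "\<beta> b" "\<beta> j" t "\<alpha> b" "\<alpha> j"] by (simp add: mult.assoc)
      then show ?thesis
        using b jb by (intro divide_lincomb3[OF nz]) (simp add: symbol_Cons y letter_symbol_def one_inner_apply algebra_simps)
    qed
  qed
next
  case all_outer
  have "word (one_inner b) S = word (\<lambda>_. Outer) S" "symbol (one_inner b) S = symbol (\<lambda>_. Outer) S"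
    using b by (auto intro!: word_cong symbol_cong simp: one_inner_def)
  then have "conv (letter Inner b) (word (\<lambda>_. Outer) S) = word (one_inner b) (b # S)"
    "(\<lambda>t. s (t - \<alpha> b) * symbol (\<lambda>_. Outer) S t) = symbol (one_inner b) (b # S)"
    using S b by (auto simp: word_Cons symbol_Cons one_inner_def letter_symbol_def)
  then show ?case using reducible.one_inner[of b "b # S"] by simp
next
  case (lin f \<sigma> g \<tau> x y)
  obtain c where f: "majorized f (\<lambda>v. ennreal c * majorant S v)" using reducible_majorized[OF lin(1)] by blast
  obtain d where g: "majorized g (\<lambda>v. ennreal d * majorant S v)" using reducible_majorized[OF lin(2)] by blast
  have [measurable]: "f \<in> borel_measurable borel" "g \<in> borel_measurable borel"
    using lin reducible_measurable by blast+
  have "reducible (b # S) (\<lambda>v. x * conv (letter Inner b) f v + y * conv (letter Inner b) g v)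
    (\<lambda>t. x * (s (t - \<alpha> b) * \<sigma> t) + y * (s (t - \<alpha> b) * \<tau> t))"
    by (intro reducible.lin lin)
  moreover have "(\<lambda>t. x * (s (t - \<alpha> b) * \<sigma> t) + y * (s (t - \<alpha> b) * \<tau> t)) = (\<lambda>t. s (t - \<alpha> b) * (x * \<sigma> t + y * \<tau> t))"
    by (simp add: algebra_simps)
  ultimately have "reducible (b # S) (\<lambda>v. x * conv (letter Inner b) f v + y * conv (letter Inner b) g v)
    (\<lambda>t. s (t - \<alpha> b) * (x * \<sigma> t + y * \<tau> t))" by simp
  then show ?case
  proof (rule reducible.off_zero)
    fix v :: real assume "v \<noteq> 0"
    then have "majorant (b # S) v < \<infinity>" using b S by (intro iconv_nn_finite) auto
    then have fin: "nnconv (\<lambda>x. ennreal (ker_bound (\<alpha> b) (\<beta> b) x)) (\<lambda>v. ennreal k * majorant S v) v < \<infinity>" for k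
      using S by (simp add: nnconv_cmult_right iconv_nn_Cons ennreal_mult_less_top)
    show "x * conv (letter Inner b) f v + y * conv (letter Inner b) g v
        = conv (letter Inner b) (\<lambda>v. x * f v + y * g v) v"
      by (rule conv_lincomb_right[OF majorized_letter f g fin fin, symmetric])
  qed measurable
next
  case (off_zero f \<sigma> g)
  have "conv (letter Inner b) g = conv (letter Inner b) f"
    using off_zero reducible_measurable[OF off_zero(1)] by (intro ext conv_cong) auto
  then show ?case using off_zero by simp
qed

lemma reducible_Negative_Negative:
  assumes "i \<in> I" "m \<in> I" "i \<noteq> m"
  shows "reducible [i, m] (conv (letter Negative i) (letter Negative m)) (\<lambda>_. s (\<beta> i - \<alpha> i) * s (\<beta> m - \<alpha> m))"
proof -
  interpret im: two_kernels "\<alpha> i" "\<beta> i" "\<alpha> m" "\<beta> m" using assms by (intro two_kernels)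
  have nz: "s (\<beta> i - \<beta> m) \<noteq> 0" using assms by (intro s_nonzero beta_nonresonant) auto
  show ?thesis
  proof (rule reducible_lin3[where kf = "s (\<alpha> i - \<beta> i) / s (\<beta> i - \<beta> m)" and kg = "- s (\<alpha> m - \<beta> m) / s (\<beta> i - \<beta> m)"
        and kh = "- s (\<alpha> i - \<beta> i - \<alpha> m + \<beta> m) / s (\<beta> i - \<beta> m)"])
    show "reducible [i, m] (word (one_inner m) [i, m]) (symbol (one_inner m) [i, m])" by (rule reducible.one_inner) simp
    show "reducible [i, m] (word (one_inner i) [i, m]) (symbol (one_inner i) [i, m])" by (rule reducible.one_inner) simp
    show "reducible [i, m] (word (\<lambda>_. Outer) [i, m]) (symbol (\<lambda>_. Outer) [i, m])" by (rule reducible.all_outer)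
    show "conv (letter Negative i) (letter Negative m) \<in> borel_measurable borel" by measurable
    show "conv (letter Negative i) (letter Negative m) v
        = s (\<alpha> i - \<beta> i) / s (\<beta> i - \<beta> m) * word (one_inner m) [i, m] v
        + - s (\<alpha> m - \<beta> m) / s (\<beta> i - \<beta> m) * word (one_inner i) [i, m] v
        + - s (\<alpha> i - \<beta> i - \<alpha> m + \<beta> m) / s (\<beta> i - \<beta> m) * word (\<lambda>_. Outer) [i, m] v" if "v \<noteq> 0" for v
      using im.Negative_Negative[OF that] assms(3)
      by (intro divide_lincomb3[OF nz]) (simp add: word_def one_inner_def im.pair_conv_def letter_def algebra_simps)
    show "s (\<beta> i - \<alpha> i) * s (\<beta> m - \<alpha> m)
        = s (\<alpha> i - \<beta> i) / s (\<beta> i - \<beta> m) * symbol (one_inner m) [i, m] t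
        + - s (\<alpha> m - \<beta> m) / s (\<beta> i - \<beta> m) * symbol (one_inner i) [i, m] t
        + - s (\<alpha> i - \<beta> i - \<alpha> m + \<beta> m) / s (\<beta> i - \<beta> m) * symbol (\<lambda>_. Outer) [i, m] t" for t
      using s_identity_Negative_Negative[of "\<beta> i" "\<beta> m" "\<alpha> i" "\<alpha> m" t] assms(3)
      by (intro divide_lincomb3[OF nz]) (simp add: symbol_def letter_symbol_def one_inner_def mult.assoc)
  qed
qed

text \<open>
  At \<open>\<beta> j\<close> the factor of an outer letter \<open>j\<close> vanishes. So among the symbols of the spanning words
  only the one with inner letter \<open>j\<close> survives there, and its coefficient is a quotient of symbols. The word
  without inner letters is missing since it vanishes for \<open>v < 0\<close>.
\<close>
lemma reducible_expand:
  assumes "reducible S f \<sigma>" and S: "distinct S" "set S \<subseteq> I" and v: "v < 0"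
  shows "f v = (\<Sum>j\<in>set S. \<sigma> (\<beta> j) / symbol (one_inner j) S (\<beta> j) * word (one_inner j) S v)"
  using assms(1)
proof (induction rule: reducible.induct)
  case (one_inner i)
  have "symbol (one_inner i) S (\<beta> j) = 0" if "j \<in> set S" "j \<noteq> i" for j
    unfolding symbol_def using that by (intro prod_zero) (auto simp: letter_symbol_def one_inner_def s_def intro!: bexI[of _ j])
  moreover have "symbol (one_inner i) S (\<beta> i) \<noteq> 0"
    unfolding symbol_def using one_inner S
    by (auto simp: letter_symbol_def one_inner_def intro!: s_nonzero dest: beta_nonresonant alpha_nonresonant split: if_splits)
  ultimately have "(\<Sum>j\<in>set S. symbol (one_inner i) S (\<beta> j) / symbol (one_inner j) S (\<beta> j) * word (one_inner j) S v)
    = (\<Sum>j\<in>set S. if j = i then word (one_inner i) S v else 0)"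
    by (intro sum.cong) auto
  then show ?case using one_inner by simp
next
  case all_outer
  have "symbol (\<lambda>_. Outer) S (\<beta> j) = 0" if "j \<in> set S" for j
    unfolding symbol_def using that by (intro prod_zero) (auto simp: letter_symbol_def s_def intro!: bexI[of _ j])
  then show ?case using word_Outer_eq_0[of v S] v by simp
next
  case (lin f \<sigma> g \<tau> x y)
  show ?case unfolding lin.IH
    by (simp add: sum_distrib_left sum.distrib[symmetric] add_divide_distrib distrib_right mult.assoc)
next
  case (off_zero f \<sigma> g)
  then show ?case using v by auto
qed

end

section \<open>Integrals of chains of kernels\<close>

text \<open>The substitution rule on \<open>[- k - 1, k + 1]\<close> and monotone convergence.\<close>
lemma nn_integral_exp_substitution_pos:
  fixes h :: "real \<Rightarrow> ennreal"
  assumes [measurable]: "h \<in> borel_measurable borel"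
  shows "(\<integral>\<^sup>+t. h t * indicator {0<..} t \<partial>lborel) = (\<integral>\<^sup>+x. h (exp x) * ennreal (exp x) \<partial>lborel)"
proof -
  let ?a = "\<lambda>k::nat. real k + 1"
  have sub: "(\<integral>\<^sup>+t. h t * indicator {exp (- ?a k)..exp (?a k)} t \<partial>lborel)
      = (\<integral>\<^sup>+x. h (exp x) * ennreal (exp x) * indicator {- ?a k..?a k} x \<partial>lborel)" for k
    by (rule nn_integral_substitution_aux[of h "- ?a k" "?a k" exp exp])
       (auto intro!: continuous_intros derivative_eq_intros)
  have "(\<integral>\<^sup>+t. h t * indicator {0<..} t \<partial>lborel)
      = (\<integral>\<^sup>+t. (SUP k. h t * indicator {exp (- ?a k)..exp (?a k)} t) \<partial>lborel)"
  proof (rule nn_integral_cong)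
    fix t :: real
    show "h t * indicator {0<..} t = (SUP k. h t * indicator {exp (- ?a k)..exp (?a k)} t)"
    proof (cases "t > 0")
      case True
      obtain k :: nat where "\<bar>ln t\<bar> \<le> real k" using real_arch_simple by blast
      then have "- ?a k \<le> ln t" "ln t \<le> ?a k" by auto
      then have "exp (- ?a k) \<le> exp (ln t)" "exp (ln t) \<le> exp (?a k)" by (simp_all only: exp_le_cancel_iff)
      then have k: "exp (- ?a k) \<le> t" "t \<le> exp (?a k)" using True by simp_all
      show ?thesis
      proof (rule antisym)
        show "h t * indicator {0<..} t \<le> (SUP k. h t * indicator {exp (- ?a k)..exp (?a k)} t)"
          using k True by (intro SUP_upper2[of k]) auto
      qed (use True in \<open>auto intro!: SUP_least simp: indicator_def\<close>)
    next
      case False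
      then have "t \<notin> {exp (- ?a k)..exp (?a k)}" for k
        using order_less_le_trans[of 0 "exp (- ?a k)" t] by auto
      then show ?thesis using False by simp
    qed
  qed
  also have "\<dots> = (SUP k. \<integral>\<^sup>+t. h t * indicator {exp (- ?a k)..exp (?a k)} t \<partial>lborel)"
  proof (intro nn_integral_monotone_convergence_SUP)
    have "{exp (- ?a m)..exp (?a m)} \<subseteq> {exp (- ?a n)..exp (?a n)}" if "m \<le> n" for m n
      using that by (simp add: atLeastatMost_subset_iff)
    then show "incseq (\<lambda>k t. h t * indicator {exp (- ?a k)..exp (?a k)} t)"
      unfolding incseq_def le_fun_def by (intro allI impI mult_left_mono indicator_leI) (blast, simp)
  qed simp
  also have "\<dots> = (SUP k. \<integral>\<^sup>+x. h (exp x) * ennreal (exp x) * indicator {- ?a k..?a k} x \<partial>lborel)"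
    by (simp only: sub)
  also have "\<dots> = (\<integral>\<^sup>+x. (SUP k. h (exp x) * ennreal (exp x) * indicator {- ?a k..?a k} x) \<partial>lborel)"
    by (intro nn_integral_monotone_convergence_SUP[symmetric])
       (auto simp: incseq_def le_fun_def intro!: mult_left_mono indicator_leI intro: order_trans)
  also have "\<dots> = (\<integral>\<^sup>+x. h (exp x) * ennreal (exp x) \<partial>lborel)"
  proof (rule nn_integral_cong)
    fix x :: real
    obtain k :: nat where k: "\<bar>x\<bar> \<le> real k" using real_arch_simple by blast
    show "(SUP k. h (exp x) * ennreal (exp x) * indicator {- ?a k..?a k} x) = h (exp x) * ennreal (exp x)"
    proof (rule antisym)
      show "h (exp x) * ennreal (exp x) \<le> (SUP k. h (exp x) * ennreal (exp x) * indicator {- ?a k..?a k} x)"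
        using k by (intro SUP_upper2[of k]) (auto simp: indicator_def abs_le_iff)
    qed (auto intro!: SUP_least simp: indicator_def)
  qed
  finally show ?thesis .
qed

lemma nn_integral_exp_substitution:
  fixes h :: "real \<Rightarrow> ennreal"
  assumes [measurable]: "h \<in> borel_measurable borel" and c: "c \<in> {1, -1::real}"
  shows "(\<integral>\<^sup>+t. h t * indicator {t. c * t > 0} t \<partial>lborel) = (\<integral>\<^sup>+x. h (c * exp x) * ennreal (exp x) \<partial>lborel)"
proof -
  have "(\<integral>\<^sup>+t. h t * indicator {t. c * t > 0} t \<partial>lborel) = (\<integral>\<^sup>+t. h (c * t) * indicator {0<..} t \<partial>lborel)"
    using c by (subst nn_integral_real_affine[where c = c and t = 0])
      (auto intro!: nn_integral_cong simp: indicator_def)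
  then show ?thesis using nn_integral_exp_substitution_pos[of "\<lambda>t. h (c * t)"] by simp
qed

text \<open>
  The rule for nonnegative functions is an equality of measures, which then gives the rule
  for complex functions.
\<close>
lemma integral_exp_substitution:
  fixes h :: "real \<Rightarrow> complex"
  assumes [measurable]: "h \<in> borel_measurable borel" and c: "c \<in> {1, -1::real}"
    and supp: "\<And>t. \<not> c * t > 0 \<Longrightarrow> h t = 0"
  shows "(\<integral>t. h t \<partial>lborel) = (\<integral>x. exp x *\<^sub>R h (c * exp x) \<partial>lborel)"
proof -
  have M: "density lborel (\<lambda>t. ennreal (indicat_real {t. c * t > 0} t)) = distr (density lborel (\<lambda>x. ennreal (exp x))) borel (\<lambda>x. c * exp x)"
    (is "?M = ?N")
  proof (rule measure_eqI)
    fix A assume "A \<in> sets ?M"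
    then have [measurable]: "A \<in> sets borel" by simp
    have "emeasure ?M A = (\<integral>\<^sup>+t. indicator A t * indicator {t. c * t > 0} t \<partial>lborel)"
      by (simp add: emeasure_density mult.commute ennreal_indicator)
    also have "\<dots> = (\<integral>\<^sup>+x. indicator A (c * exp x) * ennreal (exp x) \<partial>lborel)"
      using c by (intro nn_integral_exp_substitution) auto
    also have "\<dots> = (\<integral>\<^sup>+x. ennreal (exp x) * indicator ((\<lambda>x. c * exp x) -` A) x \<partial>lborel)"
      by (intro nn_integral_cong) (auto simp: indicator_def)
    also have "\<dots> = emeasure ?N A"
      using measurable_sets_borel[of "\<lambda>x. c * exp x" borel A]
      by (subst emeasure_distr) (auto simp: emeasure_density)
    finally show "emeasure ?M A = emeasure ?N A" .
  qed simp
  have "(\<integral>t. h t \<partial>lborel) = (\<integral>t. indicator {t. c * t > 0} t *\<^sub>R h t \<partial>lborel)"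
    using supp by (intro Bochner_Integration.integral_cong) (auto simp: indicator_def)
  also have "\<dots> = (\<integral>t. h t \<partial>?M)"
    by (rule integral_density[symmetric]) auto
  also have "\<dots> = (\<integral>x. h (c * exp x) \<partial>density lborel (\<lambda>x. ennreal (exp x)))"
    unfolding M by (intro integral_distr) auto
  also have "\<dots> = (\<integral>x. exp x *\<^sub>R h (c * exp x) \<partial>lborel)"
    by (rule integral_density) auto
  finally show ?thesis .
qed

text \<open>
  A product of kernels each of which links two consecutive coordinates; its integral can be computed
  one coordinate at a time, from the first to the last.
\<close>
definition chain :: "(nat \<Rightarrow> real \<Rightarrow> real \<Rightarrow> complex) \<Rightarrow> nat \<Rightarrow> real \<Rightarrow> (nat \<Rightarrow> real) \<Rightarrow> complex" where
  "chain g n z t = (\<Prod>i=1..n+1. g i (coord n z t (i - 1)) (coord n z t i))"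

primrec nested :: "(nat \<Rightarrow> real \<Rightarrow> real \<Rightarrow> complex) \<Rightarrow> nat \<Rightarrow> real \<Rightarrow> complex" where
  "nested g 0 = g 1 1"
| "nested g (Suc n) = (\<lambda>z. \<integral>t. nested g n t * g (n + 2) t z \<partial>lborel)"

primrec nested_nn :: "(nat \<Rightarrow> real \<Rightarrow> real \<Rightarrow> complex) \<Rightarrow> nat \<Rightarrow> real \<Rightarrow> ennreal" where
  "nested_nn g 0 = (\<lambda>z. ennreal (norm (g 1 1 z)))"
| "nested_nn g (Suc n) = (\<lambda>z. \<integral>\<^sup>+t. nested_nn g n t * ennreal (norm (g (n + 2) t z)) \<partial>lborel)"

interpretation product_lborel: product_sigma_finite "\<lambda>_::nat. lborel :: real measure"
  by standard

text \<open>The last free coordinate of a longer chain is the end point of a shorter one.\<close>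
lemma chain_Suc:
  "chain g (Suc n) z (t(Suc n := y)) = chain g n y t * g (n + 2) y z"
proof -
  have "chain g (Suc n) z (t(Suc n := y))
      = (\<Prod>i=1..n+1. g i (coord (Suc n) z (t(Suc n := y)) (i - 1)) (coord (Suc n) z (t(Suc n := y)) i)) * g (n + 2) y z"
    by (simp add: chain_def coord_def)
  also have "(\<Prod>i=1..n+1. g i (coord (Suc n) z (t(Suc n := y)) (i - 1)) (coord (Suc n) z (t(Suc n := y)) i)) = chain g n y t"
    unfolding chain_def by (intro prod.cong) (auto simp: coord_def)
  finally show ?thesis .
qed

lemma chain_measurable [measurable]:
  assumes g: "\<And>i. (\<lambda>(x, y). g i x y) \<in> borel_measurable (borel \<Otimes>\<^sub>M borel)"
  shows "chain g n z \<in> borel_measurable (\<Pi>\<^sub>M i\<in>{1..n}. lborel)"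
proof -
  have c: "(\<lambda>t. coord n z t i) \<in> borel_measurable (\<Pi>\<^sub>M i\<in>{1..n}. lborel)" if "i \<le> n + 1" for i
  proof (cases "i = 0 \<or> i = n + 1")
    case False
    then have "i \<in> {1..n}" using that by auto
    then have "(\<lambda>t. t i) \<in> borel_measurable (\<Pi>\<^sub>M i\<in>{1..n}. lborel)" by measurable
    then show ?thesis using False by (simp add: coord_def[abs_def])
  qed (auto simp: coord_def[abs_def])
  have "(\<lambda>t. g i (coord n z t (i - 1)) (coord n z t i)) \<in> borel_measurable (\<Pi>\<^sub>M i\<in>{1..n}. lborel)"
    if i: "i \<in> {1..n+1}" for i
  proof -
    have "i - 1 \<le> n + 1" "i \<le> n + 1" using i by auto
    from measurable_compose[OF measurable_Pair[OF c[OF this(1)] c[OF this(2)]] g[of i]]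
    show ?thesis by simp
  qed
  then show ?thesis unfolding chain_def[abs_def] by (intro borel_measurable_prod) simp
qed

lemma nn_integral_chain:
  assumes g: "\<And>i. (\<lambda>(x, y). g i x y) \<in> borel_measurable (borel \<Otimes>\<^sub>M borel)"
  shows "(\<integral>\<^sup>+t. ennreal (norm (chain g n z t)) \<partial>(\<Pi>\<^sub>M i\<in>{1..n}. lborel)) = nested_nn g n z"
proof (induction n arbitrary: z)
  case 0
  then show ?case by (simp add: chain_def coord_def PiM_empty nn_integral_count_space_finite)
next
  case (Suc n)
  note [measurable] = chain_measurable[of g, OF g]
  have ins: "{1..Suc n} = insert (Suc n) {1..n}" by auto
  have "(\<integral>\<^sup>+t. ennreal (norm (chain g (Suc n) z t)) \<partial>(\<Pi>\<^sub>M i\<in>{1..Suc n}. lborel))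
      = (\<integral>\<^sup>+y. \<integral>\<^sup>+t. ennreal (norm (chain g (Suc n) z (t(Suc n := y)))) \<partial>(\<Pi>\<^sub>M i\<in>{1..n}. lborel) \<partial>lborel)"
    unfolding ins using chain_measurable[of g "Suc n" z, OF g] unfolding ins
    by (intro product_lborel.product_nn_integral_insert_rev) auto
  also have "\<dots> = (\<integral>\<^sup>+y. (\<integral>\<^sup>+t. ennreal (norm (chain g n y t)) \<partial>(\<Pi>\<^sub>M i\<in>{1..n}. lborel)) * ennreal (norm (g (n + 2) y z)) \<partial>lborel)"
    unfolding chain_Suc by (intro nn_integral_cong) (simp add: norm_mult ennreal_mult nn_integral_multc del: One_nat_def)
  also have "\<dots> = nested_nn g (Suc n) z" by (simp only: Suc.IH nested_nn.simps)
  finally show ?case .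
qed

lemma nested_measurable:
  assumes g: "\<And>i. (\<lambda>(x, y). g i x y) \<in> borel_measurable (borel \<Otimes>\<^sub>M borel)"
  shows "nested g n \<in> borel_measurable borel" "nested_nn g n \<in> borel_measurable borel"
proof -
  have [measurable]: "(\<lambda>p. g i (f p) (h p)) \<in> borel_measurable M"
    if "f \<in> borel_measurable M" "h \<in> borel_measurable M" for i f h and M :: "'a measure"
    using measurable_compose[OF measurable_Pair[OF that] g[of i]] by simp
  have g': "(\<lambda>p. g i (snd p) (fst p)) \<in> borel_measurable (borel \<Otimes>\<^sub>M lborel)" for i
    using measurable_compose[OF measurable_Pair[OF measurable_snd measurable_fst] g[of i]] by simp
  have g1: "g 1 1 \<in> borel_measurable borel"
    using measurable_compose[OF measurable_Pair[OF measurable_const measurable_ident] g[of 1], of 1] by simp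
  show "nested g n \<in> borel_measurable borel"
  proof (induction n)
    case (Suc n)
    note [measurable] = Suc g'[of "n + 2"]
    have "(\<lambda>(z, t). nested g n t * g (n + 2) t z) \<in> borel_measurable (borel \<Otimes>\<^sub>M lborel)"
      unfolding split_beta by measurable
    then show ?case by (simp add: lborel.borel_measurable_lebesgue_integral)
  qed (use g1 in simp)
  show "nested_nn g n \<in> borel_measurable borel"
  proof (induction n)
    case (Suc n)
    note [measurable] = Suc g'[of "n + 2"]
    have "(\<lambda>(z, t). nested_nn g n t * ennreal (norm (g (n + 2) t z))) \<in> borel_measurable (borel \<Otimes>\<^sub>M lborel)"
      unfolding split_beta by measurable
    then show ?case by (simp add: lborel.borel_measurable_nn_integral)
  qed (use g1 in simp)
qed

text \<open>
  Fubini's theorem, with absolute convergence supplied by \<open>nn_integral_chain\<close>. The inner integral is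
  known to converge only for almost all values of the last coordinate.
\<close>
lemma integral_chain:
  assumes g: "\<And>i. (\<lambda>(x, y). g i x y) \<in> borel_measurable (borel \<Otimes>\<^sub>M borel)"
    and "nested_nn g n z < \<infinity>"
  shows "(\<integral>t. chain g n z t \<partial>(\<Pi>\<^sub>M i\<in>{1..n}. lborel)) = nested g n z"
  using assms(2)
proof (induction n arbitrary: z)
  case 0
  then show ?case by (simp add: chain_def coord_def PiM_empty lebesgue_integral_count_space_finite)
next
  case (Suc n)
  let ?P = "\<lambda>n. \<Pi>\<^sub>M i\<in>{1..n}. lborel :: (nat \<Rightarrow> real) measure"
  have ins: "{1..Suc n} = insert (Suc n) {1..n}" by auto
  have int: "integrable (?P (Suc n)) (chain g (Suc n) z)"
    using nn_integral_chain[of g "Suc n" z, OF g] Suc.prems chain_measurable[of g "Suc n" z, OF g]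
    by (intro integrableI_bounded) auto
  let ?f = "\<lambda>t y. chain g (Suc n) z (t(Suc n := y))"
  interpret P: sigma_finite_measure "?P n" by (rule product_lborel.sigma_finite) simp
  interpret pair: pair_sigma_finite "?P n" lborel ..
  have f [measurable]: "(\<lambda>(t, y). ?f t y) \<in> borel_measurable (?P n \<Otimes>\<^sub>M lborel)"
    using measurable_compose[OF measurable_add_dim[of "Suc n" "{1..n}" "\<lambda>_. lborel"], of "chain g (Suc n) z" borel]
      chain_measurable[of g "Suc n" z, OF g] unfolding ins by (simp add: split_beta del: One_nat_def)
  have "(\<integral>\<^sup>+p. ennreal (norm ((\<lambda>(t, y). ?f t y) p)) \<partial>(?P n \<Otimes>\<^sub>M lborel))
      = (\<integral>\<^sup>+t. ennreal (norm (chain g (Suc n) z t)) \<partial>?P (Suc n))"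
    unfolding ins using chain_measurable[of g "Suc n" z, OF g] unfolding ins
    by (subst product_lborel.product_nn_integral_insert) (auto simp: lborel.nn_integral_fst[symmetric] split_beta)
  also have "\<dots> < \<infinity>" using nn_integral_chain[of g "Suc n" z, OF g] Suc.prems by simp
  finally have intf: "integrable (?P n \<Otimes>\<^sub>M lborel) (\<lambda>(t, y). ?f t y)"
    using f by (intro integrableI_bounded) (simp_all del: One_nat_def)
  have "(\<integral>t. chain g (Suc n) z t \<partial>?P (Suc n)) = (\<integral>t. \<integral>y. ?f t y \<partial>lborel \<partial>?P n)"
    unfolding ins using int unfolding ins by (intro product_lborel.product_integral_insert) auto
  also have "\<dots> = (\<integral>y. \<integral>t. ?f t y \<partial>?P n \<partial>lborel)"
    by (rule pair.Fubini_integral[OF intf, symmetric])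
  also have "\<dots> = (\<integral>y. nested g n y * g (n + 2) y z \<partial>lborel)"
  proof (rule integral_cong_AE)
    have gm: "(\<lambda>y. g (n + 2) y z) \<in> borel_measurable borel"
      using measurable_compose[OF measurable_Pair[OF measurable_ident measurable_const] g[of "n + 2"], of z] by simp
    note [measurable] = nested_measurable[of g, OF g] gm
    show "(\<lambda>y. \<integral>t. ?f t y \<partial>?P n) \<in> borel_measurable lborel"
      using P.borel_measurable_lebesgue_integral[of "\<lambda>y t. ?f t y" lborel] measurable_pair_swap[OF f]
      by (simp add: split_beta del: One_nat_def)
    show "(\<lambda>y. nested g n y * g (n + 2) y z) \<in> borel_measurable lborel" by measurable
    have "AE y in lborel. nested_nn g n y * ennreal (norm (g (n + 2) y z)) \<noteq> \<infinity>"
    proof (rule nn_integral_PInf_AE)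
      show "(\<lambda>y. nested_nn g n y * ennreal (norm (g (n + 2) y z))) \<in> borel_measurable lborel" by measurable
    qed (use Suc.prems in auto)
    then show "AE y in lborel. (\<integral>t. ?f t y \<partial>?P n) = nested g n y * g (n + 2) y z"
    proof eventually_elim
      case (elim y)
      show ?case
      proof (cases "g (n + 2) y z = 0")
        case True
        then show ?thesis by (simp only: chain_Suc) simp
      next
        case False
        then have "nested_nn g n y < \<infinity>" using elim by (auto simp: ennreal_mult_eq_top_iff less_top)
        from Suc.IH[OF this] show ?thesis by (simp only: chain_Suc) simp
      qed
    qed
  qed
  finally show ?case by simp
qed

section \<open>The integrals over chambers as words\<close>

text \<open>
  One factor of the integrand for the step from \<open>x\<close> to \<open>y\<close>, with the condition on the ratio built in.
  Division by zero is harmless, as no piece contains \<open>0\<close>.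
\<close>
definition step_ker :: "piece \<Rightarrow> complex \<Rightarrow> complex \<Rightarrow> real \<Rightarrow> real \<Rightarrow> complex" where
  "step_ker L l m x y = (if y / x \<in> region L then exp (l * of_real (ln \<bar>y\<bar>)) * exp (m * of_real (ln \<bar>x - y\<bar>)) else 0)"

lemma step_ker_measurable: "(\<lambda>(x, y). step_ker L l m x y) \<in> borel_measurable (borel \<Otimes>\<^sub>M borel)"
  unfolding step_ker_def[abs_def] split_beta by measurable

lemma region_sign: "r \<in> region L \<Longrightarrow> piece_sign L * r > 0" "r \<in> region L \<Longrightarrow> r \<noteq> 1"
  by (cases L; simp)+

lemma piece_sign_cases: "piece_sign L \<in> {1, -1}" by (cases L) auto

lemma step_ker_support:
  assumes "c * x > 0" "\<not> c * piece_sign L * y > 0"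
  shows "step_ker L l m x y = 0"
proof -
  have "y / x \<notin> region L"
  proof
    assume "y / x \<in> region L"
    then have "piece_sign L * (y / x) > 0" by (rule region_sign)
    then have "(c * x) * (piece_sign L * (y / x)) > 0" using assms(1) by (rule mult_pos_pos[rotated])
    moreover have "(c * x) * (piece_sign L * (y / x)) = c * piece_sign L * y" using assms(1) by auto
    ultimately show False using assms(2) by simp
  qed
  then show ?thesis by (simp add: step_ker_def)
qed

text \<open>
  The powers of the absolute values of the two end points are split off; the Jacobian \<open>exp x\<close> of the
  substitution is accounted for. What remains depends on the ratio alone and is a kernel in the sense of \<open>ker\<close>.
\<close>
lemma step_ker_exp:
  assumes c: "c \<in> {1, -1::real}"
  shows "step_ker L (a' - b) (b - a - 1) (c * exp x) (c * piece_sign L * exp y) * exp (of_real x) * exp (a * of_real x)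
    = exp (a' * of_real y) * ker L a b (y - x)"
proof -
  have r: "c * piece_sign L * exp y / (c * exp x) = piece_sign L * exp (y - x)" using c by (auto simp: exp_diff)
  show ?thesis
  proof (cases "piece_sign L * exp (y - x) \<in> region L")
    case True
    have ly: "ln \<bar>c * piece_sign L * exp y\<bar> = y" using c piece_sign_cases[of L] by (auto simp: abs_mult)
    have ne: "\<bar>1 - piece_sign L * exp (y - x)\<bar> > 0" using region_sign(2)[OF True] by simp
    have "c * exp x - c * piece_sign L * exp y = c * exp x * (1 - piece_sign L * exp (y - x))"
      by (simp add: algebra_simps exp_diff)
    then have "\<bar>c * exp x - c * piece_sign L * exp y\<bar> = exp x * \<bar>1 - piece_sign L * exp (y - x)\<bar>"
      using c by (auto simp: abs_mult)
    then have lxy: "ln \<bar>c * exp x - c * piece_sign L * exp y\<bar> = x + ln \<bar>1 - piece_sign L * exp (y - x)\<bar>"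
      using ne by (simp add: ln_mult_pos)
    show ?thesis unfolding step_ker_def ker_def r ly lxy using True
      by (simp add: algebra_simps flip: exp_add)
  qed (simp add: step_ker_def ker_def r)
qed

context exponents begin

text \<open>The sign of the coordinate with index \<open>n\<close>, starting from \<open>1\<close> at index \<open>0\<close>.\<close>
definition chain_sign :: "(nat \<Rightarrow> piece) \<Rightarrow> nat \<Rightarrow> real" where "chain_sign w n = (\<Prod>i=1..n. piece_sign (w i))"

lemma chain_sign_Suc: "chain_sign w (Suc n) = chain_sign w n * piece_sign (w (Suc n))" by (simp add: chain_sign_def)
lemma chain_sign_cases: "chain_sign w n \<in> {1, -1}"
proof (induction n)
  case (Suc n)
  then show ?case using piece_sign_cases[of "w (Suc n)"] by (auto simp: chain_sign_Suc)
qed (simp add: chain_sign_def)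

definition step :: "(nat \<Rightarrow> piece) \<Rightarrow> nat \<Rightarrow> real \<Rightarrow> real \<Rightarrow> complex" where
  "step w i = step_ker (w i) (lam \<alpha> \<beta> i) (mu \<alpha> \<beta> i)"

lemma step_measurable: "(\<lambda>(x, y). step w i x y) \<in> borel_measurable (borel \<Otimes>\<^sub>M borel)"
  unfolding step_def by (rule step_ker_measurable)

lemma step_exp:
  "step w (Suc n) (chain_sign w n * exp x) (chain_sign w (Suc n) * exp y) * exp (of_real x) * exp (\<alpha> (Suc n) * of_real x)
    = exp (\<alpha> (n + 2) * of_real y) * letter (w (Suc n)) (Suc n) (y - x)"
  using step_ker_exp[OF chain_sign_cases[of w n], of "w (Suc n)" "\<alpha> (n + 2)" "\<beta> (Suc n)" "\<alpha> (Suc n)" x y]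
  by (simp add: step_def letter_def chain_sign_Suc lam_def mu_def)

lemma step_support: "chain_sign w n * x > 0 \<Longrightarrow> \<not> chain_sign w (Suc n) * y > 0 \<Longrightarrow> step w (Suc n) x y = 0"
  unfolding step_def chain_sign_Suc by (rule step_ker_support)

lemma nested_support: "\<not> chain_sign w (Suc n) * z > 0 \<Longrightarrow> nested (step w) n z = 0"
proof (induction n arbitrary: z)
  case 0
  then show ?case using step_support[of w 0 1 z] by (simp add: chain_sign_def[of w 0])
next
  case (Suc n)
  have "nested (step w) n t * step w (n + 2) t z = 0" for t
    using Suc.IH[of t] step_support[of w "Suc n" t z] Suc.prems by (cases "chain_sign w (Suc n) * t > 0") auto
  then have "(\<lambda>t. nested (step w) n t * step w (n + 2) t z) = (\<lambda>_. 0)" by blast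
  then show ?case by (simp only: nested.simps) simp
qed

text \<open>
  The powers split off at the two ends of consecutive steps telescope: the factor \<open>exp (\<alpha> (n + 2) y)\<close>
  at the end of one step is just what the next step consumes.
\<close>
lemma nested_eq_word:
  "nested (step w) n (chain_sign w (Suc n) * exp y) = exp (\<alpha> (n + 2) * of_real y) * word w (rev [1..<n+2]) y"
proof (induction n arbitrary: y)
  case 0
  show ?case using step_exp[of w 0 0 y] by (simp add: chain_sign_def[of w 0] word_def)
next
  case (Suc n)
  let ?z = "chain_sign w (Suc (Suc n)) * exp y"
  note [measurable] = nested_measurable(1)[OF step_measurable]
  have [measurable]: "(\<lambda>t. step w (n + 2) t z) \<in> borel_measurable borel" for z
    using measurable_compose[OF measurable_Pair[OF measurable_ident measurable_const] step_measurable[of w "n + 2"], of z] by simp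
  have "nested (step w) (Suc n) ?z = (\<integral>t. nested (step w) n t * step w (n + 2) t ?z \<partial>lborel)" by simp
  also have "\<dots> = (\<integral>x. exp x *\<^sub>R (nested (step w) n (chain_sign w (Suc n) * exp x) * step w (n + 2) (chain_sign w (Suc n) * exp x) ?z) \<partial>lborel)"
  proof (rule integral_exp_substitution[OF _ chain_sign_cases])
    show "nested (step w) n t * step w (n + 2) t ?z = 0" if "\<not> chain_sign w (Suc n) * t > 0" for t
      using nested_support[OF that] by simp
  qed measurable
  also have "\<dots> = (\<integral>x. exp (\<alpha> (n + 3) * of_real y) * (word w (rev [1..<n+2]) x * letter (w (n + 2)) (n + 2) (y - x)) \<partial>lborel)"
  proof (intro Bochner_Integration.integral_cong refl)
    fix x :: real
    have "exp x *\<^sub>R (nested (step w) n (chain_sign w (Suc n) * exp x) * step w (n + 2) (chain_sign w (Suc n) * exp x) ?z)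
      = word w (rev [1..<n+2]) x * (step w (n + 2) (chain_sign w (Suc n) * exp x) ?z * exp (of_real x) * exp (\<alpha> (n + 2) * of_real x))"
      unfolding Suc.IH by (simp add: scaleR_conv_of_real exp_of_real mult_ac)
    also have "step w (n + 2) (chain_sign w (Suc n) * exp x) ?z * exp (of_real x) * exp (\<alpha> (n + 2) * of_real x)
      = exp (\<alpha> (n + 3) * of_real y) * letter (w (n + 2)) (n + 2) (y - x)"
      using step_exp[of w "Suc n" x y] by (simp add: numeral_3_eq_3)
    finally show "exp x *\<^sub>R (nested (step w) n (chain_sign w (Suc n) * exp x) * step w (n + 2) (chain_sign w (Suc n) * exp x) ?z)
      = exp (\<alpha> (n + 3) * of_real y) * (word w (rev [1..<n+2]) x * letter (w (n + 2)) (n + 2) (y - x))"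
      by (simp only: mult_ac)
  qed
  also have "\<dots> = exp (\<alpha> (n + 3) * of_real y) * conv (word w (rev [1..<n+2])) (letter (w (n + 2)) (n + 2)) y"
    by (simp add: conv_def)
  also have "conv (word w (rev [1..<n+2])) (letter (w (n + 2)) (n + 2)) y = word w (rev [1..<Suc n + 2]) y"
    by (subst conv_commute) (simp add: word_Cons)
  finally show ?case by (simp add: numeral_3_eq_3)
qed

lemma nested_nn_support: "\<not> chain_sign w (Suc n) * z > 0 \<Longrightarrow> nested_nn (step w) n z = 0"
proof (induction n arbitrary: z)
  case 0
  then show ?case using step_support[of w 0 1 z] by (simp add: chain_sign_def[of w 0])
next
  case (Suc n)
  have "nested_nn (step w) n t * ennreal (norm (step w (n + 2) t z)) = 0" for t
    using Suc.IH[of t] step_support[of w "Suc n" t z] Suc.prems by (cases "chain_sign w (Suc n) * t > 0") auto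
  then have "(\<lambda>t. nested_nn (step w) n t * ennreal (norm (step w (n + 2) t z))) = (\<lambda>_. 0)" by blast
  then show ?case by (simp only: nested_nn.simps) simp
qed

text \<open>The computation of \<open>nested_eq_word\<close> with absolute values; it supplies the finiteness for Fubini's theorem.\<close>
lemma nested_nn_le:
  "nested_nn (step w) n (chain_sign w (Suc n) * exp y) \<le> ennreal (norm (exp (\<alpha> (n + 2) * of_real y))) * majorant (rev [1..<n+2]) y"
proof (induction n arbitrary: y)
  case 0
  show ?case using step_exp[of w 0 0 y] norm_ker_le[of "w 1" "\<alpha> 1" "\<beta> 1" y]
    by (simp add: chain_sign_def[of w 0] norm_mult letter_def del: norm_exp_eq_Re flip: ennreal_mult)
next
  case (Suc n)
  let ?K = "\<lambda>x. ennreal (ker_bound (\<alpha> (n + 2)) (\<beta> (n + 2)) x)"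
  note [measurable] = nested_measurable(2)[OF step_measurable]
  have [measurable]: "(\<lambda>t. step w (n + 2) t z) \<in> borel_measurable borel" for z
    using measurable_compose[OF measurable_Pair[OF measurable_ident measurable_const] step_measurable[of w "n + 2"], of z] by simp
  let ?z = "chain_sign w (Suc (Suc n)) * exp y"
  let ?h = "\<lambda>t. nested_nn (step w) n t * ennreal (norm (step w (n + 2) t ?z))"
  let ?E = "ennreal (norm (exp (\<alpha> (n + 3) * of_real y)))"
  have "nested_nn (step w) (Suc n) ?z = (\<integral>\<^sup>+t. ?h t * indicator {t. chain_sign w (Suc n) * t > 0} t \<partial>lborel)"
    using nested_nn_support by (auto intro!: nn_integral_cong simp: indicator_def)
  also have "\<dots> = (\<integral>\<^sup>+x. ?h (chain_sign w (Suc n) * exp x) * ennreal (exp x) \<partial>lborel)"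
    by (intro nn_integral_exp_substitution chain_sign_cases) measurable
  also have "\<dots> \<le> (\<integral>\<^sup>+x. ?E * (majorant (rev [1..<n+2]) x * ?K (y - x)) \<partial>lborel)"
  proof (rule nn_integral_mono)
    fix x :: real
    let ?g = "step w (n + 2) (chain_sign w (Suc n) * exp x) ?z"
    have "?h (chain_sign w (Suc n) * exp x) * ennreal (exp x)
      \<le> (ennreal (norm (exp (\<alpha> (n + 2) * of_real x))) * majorant (rev [1..<n+2]) x) * ennreal (norm ?g) * ennreal (exp x)"
      by (intro mult_right_mono Suc.IH) auto
    also have "\<dots> = majorant (rev [1..<n+2]) x * ennreal (norm (?g * exp (of_real x) * exp (\<alpha> (n + 2) * of_real x)))"
      by (simp add: norm_mult ennreal_mult mult_ac)
    also have "?g * exp (of_real x) * exp (\<alpha> (n + 2) * of_real x)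
      = exp (\<alpha> (n + 3) * of_real y) * letter (w (n + 2)) (n + 2) (y - x)"
      using step_exp[of w "Suc n" x y] by (simp add: numeral_3_eq_3)
    also have "majorant (rev [1..<n+2]) x * ennreal (norm (exp (\<alpha> (n + 3) * of_real y) * letter (w (n + 2)) (n + 2) (y - x)))
      = ?E * (majorant (rev [1..<n+2]) x * ennreal (norm (letter (w (n + 2)) (n + 2) (y - x))))"
      by (simp only: norm_mult ennreal_mult norm_ge_zero mult_ac)
    also have "\<dots> \<le> ?E * (majorant (rev [1..<n+2]) x * ?K (y - x))"
      unfolding letter_def by (intro mult_left_mono ennreal_leI norm_ker_le) auto
    finally show "?h (chain_sign w (Suc n) * exp x) * ennreal (exp x) \<le> ?E * (majorant (rev [1..<n+2]) x * ?K (y - x))" .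
  qed
  also have "\<dots> = ?E * nnconv (majorant (rev [1..<n+2])) ?K y"
    by (simp add: nnconv_def nn_integral_cmult)
  also have "nnconv (majorant (rev [1..<n+2])) ?K y = majorant (rev [1..<Suc n + 2]) y"
    by (subst nnconv_commute) (simp_all add: iconv_nn_Cons)
  finally show ?case by (simp add: numeral_3_eq_3)
qed

lemma integral_chain_step:
  assumes I: "{1..n+1} \<subseteq> I" and c: "chain_sign w (Suc n) = 1" and z: "z > 0" "z \<noteq> 1"
  shows "(\<integral>t. chain (step w) n z t \<partial>(\<Pi>\<^sub>M i\<in>{1..n}. lborel))
    = exp (\<alpha> (n + 2) * of_real (ln z)) * word w (rev [1..<n+2]) (ln z)"
proof -
  have "ln z \<noteq> 0" using z by simp
  then have fin: "majorant (rev [1..<n+2]) (ln z) < \<infinity>" using I by (intro iconv_nn_finite) auto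
  have "nested_nn (step w) n z \<le> ennreal (norm (exp (\<alpha> (n + 2) * of_real (ln z)))) * majorant (rev [1..<n+2]) (ln z)"
    using nested_nn_le[of w n "ln z"] c z by simp
  also have "\<dots> < \<infinity>" using fin by (simp add: ennreal_mult_less_top)
  finally have "(\<integral>t. chain (step w) n z t \<partial>(\<Pi>\<^sub>M i\<in>{1..n}. lborel)) = nested (step w) n z"
    by (intro integral_chain step_measurable)
  also have "\<dots> = exp (\<alpha> (n + 2) * of_real (ln z)) * word w (rev [1..<n+2]) (ln z)"
    using nested_eq_word[of w n "ln z"] c z by simp
  finally show ?thesis .
qed

end

lemma sign_on_eq:
  assumes "t \<in> D" "e \<in> {1, -1}" "\<And>x. x \<in> D \<Longrightarrow> e * f x > 0"
  shows "sign_on D f * f t = \<bar>f t\<bar>"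
proof -
  have "sign_on D f = e"
    unfolding sign_on_def
  proof (rule the_equality)
    fix e' assume "e' \<in> {1, -1} \<and> (\<forall>t\<in>D. e' * f t > 0)"
    then show "e' = e" using assms(2) assms(3)[OF assms(1)] assms(1) by force
  qed (use assms in auto)
  then show ?thesis using assms(2) assms(3)[OF assms(1)] by auto
qed

context exponents begin

text \<open>
  The conditions on the ratios fix the signs of all coordinates and of all differences, hence the signs
  chosen by \<open>sign_on\<close> turn every base into an absolute value. The integrand lacks the power of the last coordinate
  \<open>z\<close> that a chain has; this accounts for the change from \<open>\<alpha> (n + 2)\<close> to \<open>\<beta> (n + 1)\<close> in the exponent.
\<close>
lemma F_eq_word:
  assumes I: "{1..n+1} \<subseteq> I" and c: "chain_sign w (Suc n) = 1" and z: "z > 0" "z \<noteq> 1"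
    and D: "\<And>t. t \<in> {1..n} \<rightarrow>\<^sub>E UNIV \<Longrightarrow>
      t \<in> D \<longleftrightarrow> (\<forall>i\<in>{1..n+1}. coord n z t i / coord n z t (i - 1) \<in> region (w i))"
    and D': "D \<subseteq> {1..n} \<rightarrow>\<^sub>E UNIV"
  shows "F n \<alpha> \<beta> D z = exp (\<beta> (n + 1) * of_real (ln z)) * word w (rev [1..<n+2]) (ln z)"
proof -
  let ?P = "\<Pi>\<^sub>M i\<in>{1..n}. lborel :: (nat \<Rightarrow> real) measure"
  let ?c = "coord n z"
  have ratio: "?c t i / ?c t (i - 1) \<in> region (w i)" if "t \<in> D" "i \<in> {1..n+1}" for t i
    using D[of t] D' that by auto
  have pos: "chain_sign w i * ?c t i > 0" if t: "t \<in> D" and "i \<le> n + 1" for t i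
    using that(2)
  proof (induction i)
    case (Suc i)
    then have IH: "chain_sign w i * ?c t i > 0" by simp
    have "piece_sign (w (Suc i)) * (?c t (Suc i) / ?c t i) > 0"
      using region_sign(1)[OF ratio[OF t, of "Suc i"]] Suc.prems by simp
    then have "(chain_sign w i * ?c t i) * (piece_sign (w (Suc i)) * (?c t (Suc i) / ?c t i)) > 0"
      using IH by (rule mult_pos_pos[rotated])
    moreover have "(chain_sign w i * ?c t i) * (piece_sign (w (Suc i)) * (?c t (Suc i) / ?c t i)) = chain_sign w (Suc i) * ?c t (Suc i)"
      using IH by (auto simp: chain_sign_Suc)
    ultimately show ?case by simp
  qed (simp add: chain_sign_def coord_def)
  \<comment> \<open>The difference is the earlier coordinate times \<open>1 - r\<close>, which is negative for outer ratios \<open>r\<close> only.\<close>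
  define diff_sign where "diff_sign i = (if w i = Outer then -1 else 1 :: real) * chain_sign w (i - 1)" for i
  have dpos: "diff_sign i * (?c t (i - 1) - ?c t i) > 0" if t: "t \<in> D" and i: "i \<in> {1..n+1}" for t i
  proof -
    let ?r = "?c t i / ?c t (i - 1)"
    have p: "chain_sign w (i - 1) * ?c t (i - 1) > 0" using i by (intro pos[OF t]) auto
    have "(if w i = Outer then -1 else 1) * (1 - ?r) > 0"
      using ratio[OF t i] by (cases "w i") auto
    with p have "(chain_sign w (i - 1) * ?c t (i - 1)) * ((if w i = Outer then -1 else 1) * (1 - ?r)) > 0"
      by (rule mult_pos_pos)
    moreover have "(chain_sign w (i - 1) * ?c t (i - 1)) * ((if w i = Outer then -1 else 1) * (1 - ?r))
        = diff_sign i * (?c t (i - 1) - ?c t i)"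
    proof -
      have "?c t (i - 1) \<noteq> 0" using p by auto
      then have "?c t (i - 1) * (1 - ?r) = ?c t (i - 1) - ?c t i" by (simp add: right_diff_distrib)
      then have "diff_sign i * (?c t (i - 1) - ?c t i) = diff_sign i * (?c t (i - 1) * (1 - ?r))" by (simp only:)
      then show ?thesis unfolding diff_sign_def by (simp only: mult_ac)
    qed
    ultimately show ?thesis by simp
  qed
  have integrand: "indicator D t *\<^sub>R u n \<alpha> \<beta> z D t * exp (lam \<alpha> \<beta> (n + 1) * of_real (ln z)) = chain (step w) n z t"
    if t: "t \<in> space ?P" for t
  proof (cases "t \<in> D")
    case True
    have a: "complex_of_real (sign_on D (\<lambda>x. ?c x i) * ?c t i) powr lam \<alpha> \<beta> i
        = exp (lam \<alpha> \<beta> i * of_real (ln \<bar>?c t i\<bar>))" if "i \<in> {1..n}" for i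
    proof -
      have "sign_on D (\<lambda>x. ?c x i) * ?c t i = \<bar>?c t i\<bar>"
        using that by (intro sign_on_eq[OF True chain_sign_cases[of w i]] pos) auto
      moreover have "?c t i \<noteq> 0" using pos[OF True, of i] that by auto
      ultimately show ?thesis by (simp add: powr_def Ln_of_real)
    qed
    have b: "complex_of_real (sign_on D (\<lambda>x. ?c x (i - 1) - ?c x i) * (?c t (i - 1) - ?c t i)) powr mu \<alpha> \<beta> i
        = exp (mu \<alpha> \<beta> i * of_real (ln \<bar>?c t (i - 1) - ?c t i\<bar>))" if "i \<in> {1..n+1}" for i
    proof -
      have "diff_sign i \<in> {1, -1}" using chain_sign_cases[of w "i - 1"] by (auto simp: diff_sign_def)
      then have "sign_on D (\<lambda>x. ?c x (i - 1) - ?c x i) * (?c t (i - 1) - ?c t i) = \<bar>?c t (i - 1) - ?c t i\<bar>"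
        using that by (intro sign_on_eq[OF True _ dpos]) auto
      moreover have "?c t (i - 1) - ?c t i \<noteq> 0" using dpos[OF True that] by auto
      ultimately show ?thesis by (simp add: powr_def Ln_of_real)
    qed
    have "chain (step w) n z t = (\<Prod>i=1..n+1. exp (lam \<alpha> \<beta> i * of_real (ln \<bar>?c t i\<bar>))
        * exp (mu \<alpha> \<beta> i * of_real (ln \<bar>?c t (i - 1) - ?c t i\<bar>)))"
      unfolding chain_def step_def step_ker_def using ratio[OF True] by (intro prod.cong) auto
    also have "\<dots> = (\<Prod>i=1..n+1. exp (lam \<alpha> \<beta> i * of_real (ln \<bar>?c t i\<bar>)))
        * (\<Prod>i=1..n+1. exp (mu \<alpha> \<beta> i * of_real (ln \<bar>?c t (i - 1) - ?c t i\<bar>)))"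
      by (rule prod.distrib)
    also have "(\<Prod>i=1..n+1. exp (lam \<alpha> \<beta> i * of_real (ln \<bar>?c t i\<bar>)))
        = (\<Prod>i=1..n. exp (lam \<alpha> \<beta> i * of_real (ln \<bar>?c t i\<bar>))) * exp (lam \<alpha> \<beta> (n + 1) * of_real (ln z))"
      using z by (simp add: coord_def)
    also have "(\<Prod>i=1..n. exp (lam \<alpha> \<beta> i * of_real (ln \<bar>?c t i\<bar>)))
        = (\<Prod>i=1..n. complex_of_real (sign_on D (\<lambda>x. ?c x i) * ?c t i) powr lam \<alpha> \<beta> i)"
      by (intro prod.cong refl a[symmetric])
    also have "(\<Prod>i=1..n+1. exp (mu \<alpha> \<beta> i * of_real (ln \<bar>?c t (i - 1) - ?c t i\<bar>)))
        = (\<Prod>i=1..n+1. complex_of_real (sign_on D (\<lambda>x. ?c x (i - 1) - ?c x i) * (?c t (i - 1) - ?c t i)) powr mu \<alpha> \<beta> i)"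
      by (intro prod.cong refl b[symmetric])
    finally show ?thesis using True by (simp add: u_def mult_ac)
  next
    case False
    have "t \<in> {1..n} \<rightarrow>\<^sub>E UNIV" using t by (simp add: space_PiM)
    with False D obtain i where i: "i \<in> {1..n+1}" "?c t i / ?c t (i - 1) \<notin> region (w i)" by blast
    then have "step w i (?c t (i - 1)) (?c t i) = 0" by (simp add: step_def step_ker_def)
    then have "chain (step w) n z t = 0" unfolding chain_def using i(1) by (intro prod_zero) auto
    then show ?thesis using False by simp
  qed
  have "F n \<alpha> \<beta> D z * exp (lam \<alpha> \<beta> (n + 1) * of_real (ln z))
      = (\<integral>t. indicator D t *\<^sub>R u n \<alpha> \<beta> z D t * exp (lam \<alpha> \<beta> (n + 1) * of_real (ln z)) \<partial>?P)"
    unfolding F_def set_lebesgue_integral_def by (simp only: integral_mult_left_zero)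
  also have "\<dots> = (\<integral>t. chain (step w) n z t \<partial>?P)"
    by (intro Bochner_Integration.integral_cong refl integrand)
  also have "\<dots> = exp (\<alpha> (n + 2) * of_real (ln z)) * word w (rev [1..<n+2]) (ln z)"
    by (rule integral_chain_step[OF I c z])
  also have "exp (\<alpha> (n + 2) * of_real (ln z)) = exp (\<beta> (n + 1) * of_real (ln z)) * exp (lam \<alpha> \<beta> (n + 1) * of_real (ln z))"
    by (simp add: lam_def algebra_simps flip: exp_add)
  finally show ?thesis by (simp add: mult_ac)
qed

end

section \<open>The domains in terms of ratios\<close>

lemma sorted_map_upt:
  fixes f :: "nat \<Rightarrow> real"
  shows "sorted_wrt (<) (map f [a..<b]) \<longleftrightarrow> (\<forall>i. a \<le> i \<longrightarrow> Suc i < b \<longrightarrow> f i < f (Suc i))"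
    "sorted_wrt (>) (map f [a..<b]) \<longleftrightarrow> (\<forall>i. a \<le> i \<longrightarrow> Suc i < b \<longrightarrow> f (Suc i) < f i)"
proof -
  have *: "(\<forall>i. Suc i < b - a \<longrightarrow> R (f (a + i)) (f (a + Suc i))) \<longleftrightarrow> (\<forall>i. a \<le> i \<longrightarrow> Suc i < b \<longrightarrow> R (f i) (f (Suc i)))"
    for R :: "real \<Rightarrow> real \<Rightarrow> bool"
  proof (intro iffI allI impI)
    fix i assume h: "\<forall>i. Suc i < b - a \<longrightarrow> R (f (a + i)) (f (a + Suc i))" "a \<le> i" "Suc i < b"
    then show "R (f i) (f (Suc i))" using h(1)[rule_format, of "i - a"] by auto
  qed auto
  show "sorted_wrt (<) (map f [a..<b]) \<longleftrightarrow> (\<forall>i. a \<le> i \<longrightarrow> Suc i < b \<longrightarrow> f i < f (Suc i))"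
    using *[of "(<)"] by (subst sorted_wrt_iff_nth_Suc_transp) (auto simp: transp_on_def)
  show "sorted_wrt (>) (map f [a..<b]) \<longleftrightarrow> (\<forall>i. a \<le> i \<longrightarrow> Suc i < b \<longrightarrow> f (Suc i) < f i)"
    using *[of "(>)"] by (subst sorted_wrt_iff_nth_Suc_transp) (auto simp: transp_on_def)
qed

lemma ratio_less_1: "(x::real) > 0 \<Longrightarrow> y / x \<in> region Inner \<longleftrightarrow> 0 < y \<and> y < x"
  by (auto simp: divide_simps)

lemma ratio_greater_1: "(x::real) > 0 \<Longrightarrow> y / x \<in> region Outer \<longleftrightarrow> x < y"
  by (auto simp: divide_simps)

text \<open>
  The ratio with index \<open>j\<close> passes from a coordinate that is at least \<open>1\<close> to one that is at most \<open>z\<close>; all other ratios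
  exceed \<open>1\<close>. Conversely, positive ratios keep all coordinates positive, since the chain starts at \<open>1\<close>.
\<close>
lemma D0_iff:
  assumes z: "0 < z" "z < 1" and j: "j \<in> {1..n+1}" and t: "t \<in> {1..n} \<rightarrow>\<^sub>E UNIV"
  shows "t \<in> D0 n z j \<longleftrightarrow> (\<forall>i\<in>{1..n+1}. coord n z t i / coord n z t (i - 1) \<in> region (if i = j then Inner else Outer))"
    (is "_ \<longleftrightarrow> ?R")
proof -
  let ?c = "coord n z t"
  have c0: "?c 0 = 1" and cn: "?c (n + 1) = z" by (simp_all add: coord_def)
  have "map t [j..<n+1] @ [z] = map ?c [j..<n+2]" using j by (auto simp: coord_def)
  moreover have "[1] @ map t [1..<j] = map ?c [0..<j]"
    using j by (subst upt_conv_Cons) (auto simp: coord_def)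
  moreover have "t \<in> D0 n z j \<longleftrightarrow> sorted_wrt (<) (0 # (map t [j..<n+1] @ [z])) \<and> sorted_wrt (<) ([1] @ map t [1..<j])"
    unfolding D0_def using t by (simp only: mem_Collect_eq simp_thms append.simps)
  ultimately have "t \<in> D0 n z j \<longleftrightarrow> sorted_wrt (<) (0 # map ?c [j..<n+2]) \<and> sorted_wrt (<) (map ?c [0..<j])"
    by (simp only:)
  also have "sorted_wrt (<) (0 # map ?c [j..<n+2]) \<longleftrightarrow> 0 < ?c j \<and> sorted_wrt (<) (map ?c [j..<n+2])"
  proof -
    have "0 # map ?c [j..<n+2] = 0 # ?c j # map ?c [Suc j..<n+2]" "map ?c [j..<n+2] = ?c j # map ?c [Suc j..<n+2]"
      using j by (simp_all add: upt_conv_Cons del: upt_Suc)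
    then show ?thesis by (auto intro: less_trans simp del: upt_Suc)
  qed
  finally have D: "t \<in> D0 n z j \<longleftrightarrow> 0 < ?c j \<and> (\<forall>i. j \<le> i \<longrightarrow> Suc i < n + 2 \<longrightarrow> ?c i < ?c (Suc i))
      \<and> (\<forall>i. Suc i < j \<longrightarrow> ?c i < ?c (Suc i))"
    unfolding sorted_map_upt by simp
  show ?thesis
  proof
    assume "t \<in> D0 n z j"
    then have h: "0 < ?c j" "\<And>i. j \<le> i \<Longrightarrow> i < n + 1 \<Longrightarrow> ?c i < ?c (Suc i)" "\<And>i. Suc i < j \<Longrightarrow> ?c i < ?c (Suc i)"
      unfolding D by auto
    have lo: "?c i \<ge> 1" if "i < j" for i
      using that by (induction i) (use c0 h(3) in \<open>force intro: order_trans less_imp_le\<close>)+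
    have hi: "0 < ?c i" if "j \<le> i" "i \<le> n + 1" for i
      using that by (induction i rule: dec_induct) (use h(1,2) in \<open>force intro: less_trans\<close>)+
    have cj: "?c j \<le> z"
    proof -
      have "?c j \<le> ?c i" if "j \<le> i" "i \<le> n + 1" for i
        using that by (induction i rule: dec_induct) (use h(2) in \<open>force intro: order_trans less_imp_le\<close>)+
      from this[of "n + 1"] show ?thesis using j cn by simp
    qed
    show ?R
    proof
      fix i assume i: "i \<in> {1..n+1}"
      then obtain k where k: "i = Suc k" by (cases i) auto
      consider "i < j" | "i = j" | "i > j" by linarith
      then show "?c i / ?c (i - 1) \<in> region (if i = j then Inner else Outer)"
      proof cases
        case 1
        then show ?thesis using h(3)[of k] lo[of k] k ratio_greater_1[of "?c k" "?c i"] by auto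
      next
        case 2
        then show ?thesis using cj h(1) lo[of k] k z ratio_less_1[of "?c k" "?c i"] by auto
      next
        case 3
        then show ?thesis using h(2)[of k] hi[of k] k i ratio_greater_1[of "?c k" "?c i"] by auto
      qed
    qed
  next
    assume R: ?R
    have pos: "?c i > 0" if "i \<le> n + 1" for i
      using that
    proof (induction i)
      case (Suc i)
      then have "?c (Suc i) / ?c i \<in> region (if Suc i = j then Inner else Outer)" using R by force
      then have "?c (Suc i) / ?c i > 0" by (auto split: if_splits)
      then show ?case using Suc by (simp add: zero_less_divide_iff)
    qed (simp add: c0)
    have "?c i < ?c (Suc i)" if "Suc i \<le> n + 1" "Suc i \<noteq> j" for i
    proof -
      have "?c (Suc i) / ?c i \<in> region Outer" using R that by force
      then show ?thesis using pos[of i] that by (subst (asm) ratio_greater_1) auto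
    qed
    then show "t \<in> D0 n z j" unfolding D using pos j by auto
  qed
qed

lemma D1_last_iff:
  assumes z: "0 < z" "z < 1" and t: "t \<in> {1..n} \<rightarrow>\<^sub>E UNIV"
  shows "t \<in> D1 n z (n + 1) \<longleftrightarrow> (\<forall>i\<in>{1..n+1}. coord n z t i / coord n z t (i - 1) \<in> region Inner)"
    (is "_ \<longleftrightarrow> ?R")
proof -
  let ?c = "coord n z t"
  have c0: "?c 0 = 1" and cn: "?c (n + 1) = z" by (simp_all add: coord_def)
  have "[z] @ map t (rev [1..<n+1]) @ [1] = rev (map ?c [0..<n+2])"
  proof -
    have "[0..<n+2] = 0 # [1..<n+1] @ [n+1]" using upt_conv_Cons[of 0 "n + 2"] by simp
    then have "map ?c [0..<n+2] = 1 # map ?c [1..<n+1] @ [z]"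
      by (simp only: list.map map_append c0 cn)
    moreover have "map ?c [1..<n+1] = map t [1..<n+1]" by (auto simp: coord_def)
    ultimately show ?thesis by (simp add: rev_map del: upt_Suc)
  qed
  then have "t \<in> D1 n z (n + 1) \<longleftrightarrow> sorted_wrt (>) (map ?c [0..<n+2])"
    unfolding D1_def using t by (simp only: if_True mem_Collect_eq simp_thms sorted_wrt_rev)
  then have D: "t \<in> D1 n z (n + 1) \<longleftrightarrow> (\<forall>i. Suc i < n + 2 \<longrightarrow> ?c (Suc i) < ?c i)"
    unfolding sorted_map_upt by simp
  show ?thesis
  proof
    assume "t \<in> D1 n z (n + 1)"
    then have h: "\<And>i. i < n + 1 \<Longrightarrow> ?c (Suc i) < ?c i" unfolding D by auto
    have pos: "?c i > 0" if "i \<le> n + 1" for i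
      using that by (induction i rule: inc_induct) (use cn z h in \<open>force intro: less_trans\<close>)+
    show ?R
    proof
      fix i assume "i \<in> {1..n+1}"
      then obtain k where k: "i = Suc k" "k < n + 1" by (cases i) auto
      then show "?c i / ?c (i - 1) \<in> region Inner"
        using h[of k] pos[of k] pos[of i] ratio_less_1[of "?c k" "?c i"] by auto
    qed
  next
    assume R: ?R
    have pos: "?c i > 0" if "i \<le> n + 1" for i
      using that
    proof (induction i)
      case (Suc i)
      then have "?c (Suc i) / ?c i \<in> region Inner" using R by force
      then show ?case using Suc by (subst (asm) ratio_less_1) auto
    qed (simp add: c0)
    show "t \<in> D1 n z (n + 1)"
      unfolding D
    proof (intro allI impI)
      fix i assume i: "Suc i < n + 2"
      then have "?c (Suc i) / ?c i \<in> region Inner" using R by force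
      then show "?c (Suc i) < ?c i" using pos[of i] i by (subst (asm) ratio_less_1) auto
    qed
  qed
qed

text \<open>The coordinates change sign twice: at index \<open>j\<close>, and in the last step, which returns to \<open>z > 0\<close>.\<close>
lemma D1_iff:
  assumes z: "0 < z" and j: "j \<in> {1..n}" and t: "t \<in> {1..n} \<rightarrow>\<^sub>E UNIV"
  shows "t \<in> D1 n z j \<longleftrightarrow> (\<forall>i\<in>{1..n+1}. coord n z t i / coord n z t (i - 1)
    \<in> region (if i = j \<or> i = n + 1 then Negative else Inner))"
    (is "_ \<longleftrightarrow> ?R")
proof -
  let ?c = "coord n z t"
  have c0: "?c 0 = 1" and cn: "?c (n + 1) = z" by (simp_all add: coord_def)
  have A: "sorted_wrt (<) (map t [j..<n+1] @ [0]) \<longleftrightarrow> ?c n < 0 \<and> (\<forall>i. j \<le> i \<longrightarrow> Suc i < n + 1 \<longrightarrow> ?c i < ?c (Suc i))"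
  proof -
    \<comment> \<open>The bound \<open>0\<close> of the chain is treated as one more coordinate.\<close>
    define f where "f i = (if i \<le> n then ?c i else 0)" for i
    have "map t [j..<n+1] @ [0] = map f [j..<n+2]" using j by (auto simp: coord_def f_def)
    then have "sorted_wrt (<) (map t [j..<n+1] @ [0]) \<longleftrightarrow> (\<forall>i. j \<le> i \<longrightarrow> Suc i < n + 2 \<longrightarrow> f i < f (Suc i))"
      by (simp only: sorted_map_upt)
    also have "\<dots> \<longleftrightarrow> ?c n < 0 \<and> (\<forall>i. j \<le> i \<longrightarrow> Suc i < n + 1 \<longrightarrow> ?c i < ?c (Suc i))"
    proof (intro iffI conjI allI impI)
      assume h: "\<forall>i. j \<le> i \<longrightarrow> Suc i < n + 2 \<longrightarrow> f i < f (Suc i)"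
      show "?c n < 0" using h[rule_format, of n] j by (simp add: f_def)
      show "?c i < ?c (Suc i)" if "j \<le> i" "Suc i < n + 1" for i
        using h[rule_format, of i] that by (simp add: f_def)
    next
      fix i assume h: "?c n < 0 \<and> (\<forall>i. j \<le> i \<longrightarrow> Suc i < n + 1 \<longrightarrow> ?c i < ?c (Suc i))" "j \<le> i" "Suc i < n + 2"
      then show "f i < f (Suc i)" by (cases "i = n") (auto simp: f_def)
    qed
    finally show ?thesis .
  qed
  have B: "sorted_wrt (<) ([0] @ map t (rev [1..<j]) @ [1]) \<longleftrightarrow> 0 < ?c (j - 1) \<and> (\<forall>i. Suc i < j \<longrightarrow> ?c (Suc i) < ?c i)"
  proof -
    define f where "f i = (if i < j then ?c i else 0)" for i
    have "[0..<Suc j] = 0 # [1..<j] @ [j]" using j upt_conv_Cons[of 0 "Suc j"] by simp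
    then have "map f [0..<Suc j] = 1 # map f [1..<j] @ [0]" using j by (simp add: f_def coord_def)
    moreover have "map f [1..<j] = map t [1..<j]" using j by (auto simp: coord_def f_def)
    ultimately have "[0] @ map t (rev [1..<j]) @ [1] = rev (map f [0..<Suc j])" by (simp add: rev_map del: upt_Suc)
    then have "sorted_wrt (<) ([0] @ map t (rev [1..<j]) @ [1]) \<longleftrightarrow> sorted_wrt (>) (map f [0..<Suc j])"
      by (simp only: sorted_wrt_rev)
    then have "sorted_wrt (<) ([0] @ map t (rev [1..<j]) @ [1]) \<longleftrightarrow> (\<forall>i. Suc i < Suc j \<longrightarrow> f (Suc i) < f i)"
      unfolding sorted_map_upt by simp
    also have "\<dots> \<longleftrightarrow> 0 < ?c (j - 1) \<and> (\<forall>i. Suc i < j \<longrightarrow> ?c (Suc i) < ?c i)"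
    proof (intro iffI conjI allI impI)
      assume h: "\<forall>i. Suc i < Suc j \<longrightarrow> f (Suc i) < f i"
      show "0 < ?c (j - 1)" using h[rule_format, of "j - 1"] j by (simp add: f_def)
      show "?c (Suc i) < ?c i" if "Suc i < j" for i using h[rule_format, of i] that by (simp add: f_def)
    next
      fix i assume h: "0 < ?c (j - 1) \<and> (\<forall>i. Suc i < j \<longrightarrow> ?c (Suc i) < ?c i)" "Suc i < Suc j"
      then show "f (Suc i) < f i" by (cases "i = j - 1") (auto simp: f_def)
    qed
    finally show ?thesis .
  qed
  have D: "t \<in> D1 n z j \<longleftrightarrow> (?c n < 0 \<and> (\<forall>i. j \<le> i \<longrightarrow> Suc i < n + 1 \<longrightarrow> ?c i < ?c (Suc i)))
      \<and> 0 < ?c (j - 1) \<and> (\<forall>i. Suc i < j \<longrightarrow> ?c (Suc i) < ?c i)"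
    using t j A B by (simp add: D1_def)
  have ratio_neg: "y / x \<in> region Inner \<longleftrightarrow> x < y \<and> y < 0" if "x < 0" for x y :: real
    using that by (auto simp: divide_simps)
  show ?thesis
  proof
    assume "t \<in> D1 n z j"
    then have h: "?c n < 0" "\<And>i. j \<le> i \<Longrightarrow> i < n \<Longrightarrow> ?c i < ?c (Suc i)" "0 < ?c (j - 1)" "\<And>i. Suc i < j \<Longrightarrow> ?c (Suc i) < ?c i"
      unfolding D by auto
    have neg: "?c i < 0" if "j \<le> i" "i \<le> n" for i
      using that(2,1) by (induction i rule: inc_induct) (use h(1,2) in \<open>force intro: less_trans\<close>)+
    have pos: "0 < ?c i" if "i \<le> j - 1" for i
      using that by (induction i rule: inc_induct) (use h(3,4) in \<open>force intro: less_trans\<close>)+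
    show ?R
    proof
      fix i assume i: "i \<in> {1..n+1}"
      then obtain k where k: "i = Suc k" by (cases i) auto
      consider "i < j" | "i = j" | "j < i" "i < n + 1" | "i = n + 1" using i by fastforce
      then show "?c i / ?c (i - 1) \<in> region (if i = j \<or> i = n + 1 then Negative else Inner)"
      proof cases
        case 1
        then show ?thesis using h(4)[of k] pos[of k] pos[of i] k j ratio_less_1[of "?c k" "?c i"] by auto
      next
        case 2
        then show ?thesis using h(3) neg[of j] j by (simp add: divide_neg_pos)
      next
        case 3
        then show ?thesis using h(2)[of k] neg[of k] neg[of i] k ratio_neg[of "?c k" "?c i"] by auto
      next
        case 4
        then show ?thesis using h(1) cn z by (simp add: divide_pos_neg)
      qed
    qed
  next
    assume R: ?R
    have RB: "?c (Suc i) / ?c i \<in> region Inner" if "i < n" "Suc i \<noteq> j" for i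
      using R[rule_format, of "Suc i"] that by (simp del: region.simps)
    have pos: "?c i > 0" if "i \<le> j - 1" for i
      using that
    proof (induction i)
      case (Suc i)
      then have "?c (Suc i) / ?c i \<in> region Inner" using j by (intro RB) auto
      then show ?case using Suc by (subst (asm) ratio_less_1) auto
    qed (simp add: c0)
    have neg: "?c i < 0" if "j \<le> i" "i \<le> n" for i
      using that
    proof (induction i rule: dec_induct)
      case base
      have "?c j / ?c (j - 1) < 0" using R[rule_format, of j] j by simp
      then show ?case using pos[of "j - 1"] by (simp add: divide_less_0_iff)
    next
      case (step i)
      then have "?c (Suc i) / ?c i \<in> region Inner" using j by (intro RB) auto
      then show ?case using step by (subst (asm) ratio_neg) auto
    qed
    have "?c i < ?c (Suc i)" if "j \<le> i" "Suc i < n + 1" for i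
    proof -
      have "?c (Suc i) / ?c i \<in> region Inner" using that j by (intro RB) auto
      then show ?thesis using neg[of i] that by (subst (asm) ratio_neg) auto
    qed
    moreover have "?c (Suc i) < ?c i" if "Suc i < j" for i
    proof -
      have "?c (Suc i) / ?c i \<in> region Inner" using that j by (intro RB) auto
      then show ?thesis using pos[of i] that by (subst (asm) ratio_less_1) auto
    qed
    ultimately show "t \<in> D1 n z j" unfolding D using pos[of "j - 1"] neg[of n] j by auto
  qed
qed

section \<open>The connection formula\<close>

context exponents begin

lemma reducible_append_inner:
  assumes "reducible S (word w S) \<sigma>" "S \<noteq> []" "distinct (T @ S)" "set (T @ S) \<subseteq> I" "\<And>k. k \<in> set T \<Longrightarrow> w k = Inner"
  shows "reducible (T @ S) (word w (T @ S)) (\<lambda>t. (\<Prod>k\<in>set T. s (t - \<alpha> k)) * \<sigma> t)"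
  using assms
proof (induction T)
  case (Cons b T)
  have "reducible (b # T @ S) (conv (letter Inner b) (word w (T @ S))) (\<lambda>t. s (t - \<alpha> b) * ((\<Prod>k\<in>set T. s (t - \<alpha> k)) * \<sigma> t))"
    using Cons by (intro reducible_step Cons.IH) auto
  moreover have "(\<lambda>t. s (t - \<alpha> b) * ((\<Prod>k\<in>set T. s (t - \<alpha> k)) * \<sigma> t)) = (\<lambda>t. (\<Prod>k\<in>set (b # T). s (t - \<alpha> k)) * \<sigma> t)"
    using Cons.prems by (auto simp: mult.assoc)
  ultimately show ?case using Cons.prems by (simp add: word_Cons)
qed simp

lemma reducible_expand_perm:
  assumes red: "reducible L (word w L) \<sigma>" and L: "distinct L" "set L \<subseteq> I" "mset L = mset S" and v: "v < 0"
  shows "word w S v = (\<Sum>j\<in>set L. \<sigma> (\<beta> j) / symbol (one_inner j) L (\<beta> j) * word (one_inner j) S v)"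
proof -
  have p: "word w' S v = word w' L v" for w'
    using L v by (intro word_perm[symmetric]) auto
  show ?thesis unfolding p by (rule reducible_expand[OF red L(1,2) v])
qed

text \<open>
  The quotient of the symbol of the word with inner letters only by the one with a single inner letter:
  the factor with index \<open>j\<close> cancels, and the signs in numerator and denominator agree.
\<close>
lemma coefficient:
  assumes J: "finite J" "J \<subseteq> I" "j \<in> J" "set L = J"
  shows "(\<Prod>k\<in>J. s (\<beta> j - \<alpha> k)) / symbol (one_inner j) L (\<beta> j) = (\<Prod>k\<in>J - {j}. s (\<alpha> k - \<beta> j) / s (\<beta> k - \<beta> j))"
proof -
  have "symbol (one_inner j) L (\<beta> j) = s (\<beta> j - \<alpha> j) * (\<Prod>k\<in>J - {j}. s (\<beta> j - \<beta> k))"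
    unfolding symbol_def J(4) prod.remove[OF J(1,3)]
    by (intro arg_cong2[of _ _ _ _ "(*)"] prod.cong) (auto simp: letter_symbol_def one_inner_apply)
  moreover have "(\<Prod>k\<in>J. s (\<beta> j - \<alpha> k)) = s (\<beta> j - \<alpha> j) * (\<Prod>k\<in>J - {j}. s (\<beta> j - \<alpha> k))"
    by (rule prod.remove[OF J(1,3)])
  moreover have "s (\<beta> j - \<alpha> j) \<noteq> 0" using J by (intro s_nonzero alpha_nonresonant) auto
  ultimately have "(\<Prod>k\<in>J. s (\<beta> j - \<alpha> k)) / symbol (one_inner j) L (\<beta> j)
    = (\<Prod>k\<in>J - {j}. s (\<beta> j - \<alpha> k) / s (\<beta> j - \<beta> k))"
    by (simp add: prod_dividef)
  also have "\<dots> = (\<Prod>k\<in>J - {j}. s (\<alpha> k - \<beta> j) / s (\<beta> k - \<beta> j))"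
  proof (intro prod.cong refl)
    fix k
    have "s (\<beta> j - \<alpha> k) = - s (\<alpha> k - \<beta> j)" "s (\<beta> j - \<beta> k) = - s (\<beta> k - \<beta> j)"
      by (simp_all flip: s_minus)
    then show "s (\<beta> j - \<alpha> k) / s (\<beta> j - \<beta> k) = s (\<alpha> k - \<beta> j) / s (\<beta> k - \<beta> j)" by simp
  qed
  finally show ?thesis .
qed

lemma word_all_inner:
  assumes L: "distinct L" "set L \<subseteq> I" "L \<noteq> []" "mset L = mset S" and v: "v < 0"
  shows "word (\<lambda>_. Inner) S v
    = (\<Sum>j\<in>set L. (\<Prod>k\<in>set L - {j}. s (\<alpha> k - \<beta> j) / s (\<beta> k - \<beta> j)) * word (one_inner j) S v)"
proof -
  obtain T m where Lm: "L = T @ [m]" using L(3) by (metis rev_exhaust)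
  have "word (\<lambda>_. Inner) [m] = word (one_inner m) [m]"
    by (intro word_cong) (simp add: one_inner_apply)
  moreover have "symbol (one_inner m) [m] = (\<lambda>t. s (t - \<alpha> m))"
    by (auto simp: symbol_def letter_symbol_def one_inner_apply)
  ultimately have "reducible [m] (word (\<lambda>_. Inner) [m]) (\<lambda>t. s (t - \<alpha> m))"
    using reducible.one_inner[of m "[m]"] by simp
  from reducible_append_inner[OF this, of T]
  have "reducible L (word (\<lambda>_. Inner) L) (\<lambda>t. (\<Prod>k\<in>set T. s (t - \<alpha> k)) * s (t - \<alpha> m))"
    using L by (simp add: Lm)
  moreover have "(\<lambda>t. (\<Prod>k\<in>set T. s (t - \<alpha> k)) * s (t - \<alpha> m)) = (\<lambda>t. \<Prod>k\<in>set L. s (t - \<alpha> k))"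
    using L(1) by (auto simp: Lm mult.commute)
  ultimately have red: "reducible L (word (\<lambda>_. Inner) L) (\<lambda>t. \<Prod>k\<in>set L. s (t - \<alpha> k))" by simp
  show ?thesis unfolding reducible_expand_perm[OF red L(1,2,4) v]
    using L by (intro sum.cong refl) (simp only: coefficient[OF finite_set L(2) _ refl])
qed

text \<open>
  The pair of negative letters contributes a constant to the symbol, in place of the factors
  \<open>s (t - \<alpha> i)\<close> and \<open>s (t - \<alpha> m)\<close> of two inner letters. This explains the additional factor in the coefficients.
\<close>
lemma word_two_negative:
  assumes L: "distinct L" "set L \<subseteq> I" "mset L = mset S" and v: "v < 0"
    and im: "i \<in> set L" "m \<in> set L" "i \<noteq> m"
  shows "word (\<lambda>k. if k = i \<or> k = m then Negative else Inner) S v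
    = (\<Sum>j\<in>set L. s (\<beta> i - \<alpha> i) * s (\<beta> m - \<alpha> m) / (s (\<beta> j - \<alpha> i) * s (\<beta> j - \<alpha> m))
        * (\<Prod>k\<in>set L - {j}. s (\<alpha> k - \<beta> j) / s (\<beta> k - \<beta> j)) * word (one_inner j) S v)"
    (is "word ?w S v = _")
proof -
  define T where "T = filter (\<lambda>k. k \<noteq> i \<and> k \<noteq> m) L"
  have dT: "distinct (T @ [i, m])" using L im by (auto simp: T_def)
  have sT: "set (T @ [i, m]) = set L" using im by (auto simp: T_def)
  have mT: "mset (T @ [i, m]) = mset S"
    using dT sT L(1,3) by (metis set_eq_iff_mset_eq_distinct)
  have "word ?w [i, m] = conv (letter Negative i) (letter Negative m)" by (simp add: word_def)
  then have "reducible [i, m] (word ?w [i, m]) (\<lambda>_. s (\<beta> i - \<alpha> i) * s (\<beta> m - \<alpha> m))"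
    using reducible_Negative_Negative[of i m] L im by auto
  from reducible_append_inner[OF this, of T]
  have red: "reducible (T @ [i, m]) (word ?w (T @ [i, m])) (\<lambda>t. (\<Prod>k\<in>set T. s (t - \<alpha> k)) * (s (\<beta> i - \<alpha> i) * s (\<beta> m - \<alpha> m)))"
    using dT sT L by (auto simp: T_def)
  show ?thesis unfolding reducible_expand_perm[OF red dT _ mT v, unfolded sT, OF L(2)]
  proof (intro sum.cong refl)
    fix j assume j: "j \<in> set L"
    have nz: "s (\<beta> j - \<alpha> i) \<noteq> 0" "s (\<beta> j - \<alpha> m) \<noteq> 0"
      using j im L by (auto intro!: s_nonzero dest: alpha_nonresonant)
    have "(\<Prod>k\<in>set L. s (\<beta> j - \<alpha> k)) = (\<Prod>k\<in>set T. s (\<beta> j - \<alpha> k)) * (s (\<beta> j - \<alpha> i) * s (\<beta> j - \<alpha> m))"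
      unfolding sT[symmetric] using dT by (simp add: mult_ac)
    then have "(\<Prod>k\<in>set T. s (\<beta> j - \<alpha> k)) = (\<Prod>k\<in>set L. s (\<beta> j - \<alpha> k)) / (s (\<beta> j - \<alpha> i) * s (\<beta> j - \<alpha> m))"
      using nz by simp
    then have "(\<Prod>k\<in>set T. s (\<beta> j - \<alpha> k)) * (s (\<beta> i - \<alpha> i) * s (\<beta> m - \<alpha> m)) / symbol (one_inner j) (T @ [i, m]) (\<beta> j)
      = s (\<beta> i - \<alpha> i) * s (\<beta> m - \<alpha> m) / (s (\<beta> j - \<alpha> i) * s (\<beta> j - \<alpha> m))
        * ((\<Prod>k\<in>set L. s (\<beta> j - \<alpha> k)) / symbol (one_inner j) (T @ [i, m]) (\<beta> j))"
      by simp
    then show "(\<Prod>k\<in>set T. s (\<beta> j - \<alpha> k)) * (s (\<beta> i - \<alpha> i) * s (\<beta> m - \<alpha> m)) / symbol (one_inner j) (T @ [i, m]) (\<beta> j) * word (one_inner j) S v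
      = s (\<beta> i - \<alpha> i) * s (\<beta> m - \<alpha> m) / (s (\<beta> j - \<alpha> i) * s (\<beta> j - \<alpha> m))
        * (\<Prod>k\<in>set L - {j}. s (\<alpha> k - \<beta> j) / s (\<beta> k - \<beta> j)) * word (one_inner j) S v"
      by (simp only: coefficient[OF finite_set L(2) j sT])
  qed
qed

end

theorem theorem3p3:
  fixes n :: nat and \<alpha> \<beta> :: "nat \<Rightarrow> complex" and z :: real
  assumes "n \<ge> 1"
    and "\<beta> (n + 1) = 1"
    and "\<And>i j. \<lbrakk>i \<in> {1..n + 1}; j \<in> {1..n + 1}; j \<noteq> i\<rbrakk> \<Longrightarrow> Re (\<alpha> i - \<beta> j + 1) > 0"
    and "\<And>j. j \<in> {1..n + 1} \<Longrightarrow> Re (\<beta> j - \<alpha> j) > 0"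
    and "\<And>i j. \<lbrakk>i \<in> {1..n + 1}; j \<in> {1..n + 1}\<rbrakk> \<Longrightarrow> \<alpha> i - \<beta> j \<notin> \<int>"
    and "\<And>i j. \<lbrakk>i \<in> {1..n + 1}; j \<in> {1..n + 1}; j \<noteq> i\<rbrakk> \<Longrightarrow> \<beta> i - \<beta> j \<notin> \<int>"
    and "0 < z" and "z < 1"
  shows "(\<forall>i\<in>{1..n}.
           F n \<alpha> \<beta> (D1 n z i) z =
             (\<Sum>j = 1..n + 1.
                (s (\<beta> i - \<alpha> i) * s (\<alpha> (n + 1))) /
                (s (\<beta> j - \<alpha> i) * s (\<beta> j - \<alpha> (n + 1))) *
                (\<Prod>k\<in>{1..n + 1} - {j}. s (\<alpha> k - \<beta> j) / s (\<beta> k - \<beta> j)) *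
                F n \<alpha> \<beta> (D0 n z j) z)) \<and>
         F n \<alpha> \<beta> (D1 n z (n + 1)) z =
           (\<Sum>j = 1..n + 1.
              (\<Prod>k\<in>{1..n + 1} - {j}. s (\<alpha> k - \<beta> j) / s (\<beta> k - \<beta> j)) *
              F n \<alpha> \<beta> (D0 n z j) z)"
proof -
  interpret exponents "{1..n+1}" \<alpha> \<beta>
  proof
    show "Re (\<beta> i) < Re (\<alpha> j) + 1" if "i \<in> {1..n+1}" "j \<in> {1..n+1}" "i \<noteq> j" for i j
      using assms(3)[of j i] that by simp
    show "\<beta> i - \<alpha> j \<notin> \<int>" if "i \<in> {1..n+1}" "j \<in> {1..n+1}" for i j
      using assms(5)[of j i] that by (metis Ints_minus minus_diff_eq)
  qed (use assms(4,6) in auto)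
  define L where "L = [1..<n+2]"
  \<comment> \<open>Nesting the integrals makes the kernel of the last step the outermost letter.\<close>
  define S where "S = rev L"
  define v where "v = ln z"
  define E where "E = exp (\<beta> (n + 1) * of_real v)"
  have v: "v < 0" using assms by (simp add: v_def)
  have L: "distinct L" "set L \<subseteq> {1..n+1}" "L \<noteq> []" "mset L = mset S" "set L = {1..n+1}"
    by (auto simp: L_def S_def)
  have z: "z > 0" "z \<noteq> 1" using assms by auto
  have FD0: "F n \<alpha> \<beta> (D0 n z j) z = E * word (one_inner j) S v" if j: "j \<in> {1..n+1}" for j
    unfolding E_def S_def v_def L_def
  proof (rule F_eq_word[OF order_refl _ z])
    show "chain_sign (one_inner j) (Suc n) = 1" unfolding chain_sign_def by (intro prod.neutral) (auto simp: one_inner_apply)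
    show "D0 n z j \<subseteq> {1..n} \<rightarrow>\<^sub>E UNIV" by (auto simp: D0_def)
    show "t \<in> D0 n z j \<longleftrightarrow> (\<forall>i\<in>{1..n+1}. coord n z t i / coord n z t (i - 1) \<in> region (one_inner j i))"
      if "t \<in> {1..n} \<rightarrow>\<^sub>E UNIV" for t
      unfolding one_inner_apply using assms j that by (intro D0_iff)
  qed
  have FD1_last: "F n \<alpha> \<beta> (D1 n z (n + 1)) z = E * word (\<lambda>_. Inner) S v"
    unfolding E_def S_def v_def L_def
  proof (rule F_eq_word[OF order_refl _ z])
    show "chain_sign (\<lambda>_. Inner) (Suc n) = 1" by (simp add: chain_sign_def)
    show "D1 n z (n + 1) \<subseteq> {1..n} \<rightarrow>\<^sub>E UNIV" by (auto simp: D1_def)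
    show "t \<in> D1 n z (n + 1) \<longleftrightarrow> (\<forall>i\<in>{1..n+1}. coord n z t i / coord n z t (i - 1) \<in> region Inner)"
      if "t \<in> {1..n} \<rightarrow>\<^sub>E UNIV" for t
      using assms that by (intro D1_last_iff)
  qed
  have FD1: "F n \<alpha> \<beta> (D1 n z i) z = E * word (\<lambda>k. if k = i \<or> k = n + 1 then Negative else Inner) S v"
    if i: "i \<in> {1..n}" for i
    unfolding E_def S_def v_def L_def
  proof (rule F_eq_word[OF order_refl _ z])
    let ?w = "\<lambda>k. if k = i \<or> k = n + 1 then Negative else Inner"
    have "chain_sign ?w (Suc n) = (\<Prod>k\<in>{1..n+1}. if k \<in> {i, n + 1} then -1 else 1)"
      unfolding chain_sign_def by (intro prod.cong) auto
    also have "\<dots> = (\<Prod>k\<in>{i, n + 1}. -1)"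
      using i by (subst prod.inter_restrict[symmetric]) (auto intro!: prod.cong)
    also have "\<dots> = 1" using i by simp
    finally show "chain_sign ?w (Suc n) = 1" .
    show "D1 n z i \<subseteq> {1..n} \<rightarrow>\<^sub>E UNIV" by (auto simp: D1_def split: if_splits)
    show "t \<in> D1 n z i \<longleftrightarrow> (\<forall>k\<in>{1..n+1}. coord n z t k / coord n z t (k - 1) \<in> region (?w k))"
      if "t \<in> {1..n} \<rightarrow>\<^sub>E UNIV" for t
      using assms i that by (intro D1_iff)
  qed
  have collect: "E * (\<Sum>j\<in>{1..n+1}. c j * word (one_inner j) S v) = (\<Sum>j = 1..n + 1. c j * F n \<alpha> \<beta> (D0 n z j) z)" for c
    unfolding sum_distrib_left by (intro sum.cong refl) (simp only: FD0 mult.left_commute)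
  have sm: "s (\<beta> (n + 1) - \<alpha> (n + 1)) = s (\<alpha> (n + 1))" by (simp only: assms(2) s_one_minus)
  show ?thesis
  proof (intro conjI ballI)
    fix i assume i: "i \<in> {1..n}"
    then have "i \<in> set L" "n + 1 \<in> set L" "i \<noteq> n + 1" unfolding L(5) by auto
    from word_two_negative[OF L(1,2,4) v this]
    show "F n \<alpha> \<beta> (D1 n z i) z = (\<Sum>j = 1..n + 1.
      (s (\<beta> i - \<alpha> i) * s (\<alpha> (n + 1))) / (s (\<beta> j - \<alpha> i) * s (\<beta> j - \<alpha> (n + 1))) *
      (\<Prod>k\<in>{1..n + 1} - {j}. s (\<alpha> k - \<beta> j) / s (\<beta> k - \<beta> j)) * F n \<alpha> \<beta> (D0 n z j) z)"
      unfolding FD1[OF i] L(5) sm by (simp only: collect)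
  next
    from word_all_inner[OF L(1-4) v]
    show "F n \<alpha> \<beta> (D1 n z (n + 1)) z = (\<Sum>j = 1..n + 1.
      (\<Prod>k\<in>{1..n + 1} - {j}. s (\<alpha> k - \<beta> j) / s (\<beta> k - \<beta> j)) * F n \<alpha> \<beta> (D0 n z j) z)"
      unfolding FD1_last L(5) by (simp only: collect)
  qed
qed

end
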